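(* Let $U$ be a non-empty open subset of $\mathbb{R}^{2n}$ with $\mathrm{Vol}(U,\omega_0)<\infty$. Then the fragmented Hofer's norm $\|\cdot\|_U\colon\mathrm{Ham}(\mathbb{R}^{2n},\omega_0)\to\mathbb{R}$ is not equivalent to the original Hofer's norm $\|\cdot\|$ on $\mathrm{Ham}(\mathbb{R}^{2n},\omega_0)$.
   Context: $\omega_0=dx_1\wedge dy_1+\cdots+dx_n\wedge dy_n$ is the standard symplectic form on $\mathbb{R}^{2n}$ with coordinates $(x,y)=(x_1,\dots,x_n,y_1,\dots,y_n)$, and $\mathrm{Vol}(U,\omega_0)=\int_U\omega_0^n$. Put $M=\mathbb{R}^{2n}$, $\omega=\omega_0$. A Hamiltonian function is a smooth compactly supported function $F\colon M\times[0,1]\to\mathbb{R}$; write $F_t(x)=F(x,t)$ and $\mathrm{Supp}(F)=\bigcup_{t\in[0,1]}\mathrm{Supp}(F_t)$. The Hamiltonian vector field $X_F^t$ is defined by $\omega(X_F^t,V)=-dF_t(V)$ for all vector fields $V$; $\{\phi_F^t\}_{t\in[0,1]}$ is the isotopy generated by $X_F^t$ with $\phi_F^0=\mathrm{id}$, and $\phi_F=\phi_F^1$ is the Hamiltonian diffeomorphism generated by $F$. $\mathrm{Ham}(M,\omega)$ is the group of all such Hamiltonian diffeomorphisms. Hofer's length: $\|F\|=\int_0^1(\max_M F_t-\min_M F_t)\,dt$. Hofer's norm: $\|\phi\|=\inf\{\|F\|\}$ over Hamiltonian functions $F\colon M\times[0,1]\to\mathbb{R}$ with $\phi=\phi_F$.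 Hofer's norm fragmented by a non-empty open $U\subset M$: $\|\phi\|_U=\inf\{\|F^1\|+\cdots+\|F^k\|\}$, the infimum being over all (finite) families of Hamiltonian functions $F^1,\dots,F^k\colon M\times[0,1]\to\mathbb{R}$ and Hamiltonian diffeomorphisms $h_1,\dots,h_k$ with $\mathrm{Supp}(F^i)\subset U$ for all $i$ and $\phi=h_1\phi_{F^1}h_1^{-1}\cdots h_k\phi_{F^k}h_k^{-1}$ (this is finite by Banyaga's fragmentation lemma). Two conjugation-invariant norms $\|\cdot\|_1,\|\cdot\|_2$ on a group $G$ are equivalent if there exist positive numbers $a,b$ such that $\frac1a\|\phi\|_1-b\leq\|\phi\|_2\leq a\|\phi\|_1+b$ for all $\phi\in G$. *)

theory Defs
  imports "HOL-Analysis.Analysis"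
begin

type_synonym 'n phase = "(real ^ 'n) \<times> (real ^ 'n)"

section \<open>Smooth maps\<close>

(* Meaningful for open S: all iterated directional derivatives up to order k exist and the
   k-th ones are continuous. *)
primrec Ck_on :: "nat \<Rightarrow> ('a::euclidean_space \<Rightarrow> 'b::real_normed_vector) \<Rightarrow> 'a set \<Rightarrow> bool"
where
  "Ck_on 0 f S \<longleftrightarrow> continuous_on S f"
| "Ck_on (Suc k) f S \<longleftrightarrow>
     (\<forall>x\<in>S. f differentiable (at x)) \<and> (\<forall>v. Ck_on k (\<lambda>x. frechet_derivative f (at x) v) S)"

(* On a set that need not be open, such as M \<times> [0,1], smooth means: restriction of a smooth map
   on an open neighbourhood. Values of f outside S are irrelevant. *)
definition smooth_on :: "('a::euclidean_space \<Rightarrow> 'b::real_normed_vector) \<Rightarrow> 'a set \<Rightarrow> bool"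
where
  "smooth_on f S \<longleftrightarrow>
     (\<exists>W g. open W \<and> S \<subseteq> W \<and> (\<forall>k. Ck_on k g W) \<and> (\<forall>x\<in>S. g x = f x))"

definition diffeomorphism :: "('a::euclidean_space \<Rightarrow> 'a) \<Rightarrow> bool"
where
  "diffeomorphism f \<longleftrightarrow> bij f \<and> smooth_on f UNIV \<and> smooth_on (inv f) UNIV"

definition isotopy :: "(real \<Rightarrow> 'a::euclidean_space \<Rightarrow> 'a) \<Rightarrow> bool"
where
  "isotopy \<phi> \<longleftrightarrow>
     smooth_on (\<lambda>(x, t). \<phi> t x) (UNIV \<times> {0..1}) \<and> (\<forall>t\<in>{0..1}. diffeomorphism (\<phi> t))"

section \<open>The standard symplectic space\<close>

definition omega0 :: "'n::finite phase \<Rightarrow> 'n phase \<Rightarrow> real"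
where
  "omega0 v w = (\<Sum>i\<in>UNIV. fst v $ i * snd w $ i - snd v $ i * fst w $ i)"

(* The n-th exterior power of omega0 is n! dx_1 \<and> dy_1 \<and> ... \<and> dx_n \<and> dy_n, so its integral over U
   is n! times the Lebesgue measure of U. *)
definition symplectic_volume :: "'n::finite phase set \<Rightarrow> ennreal"
where
  "symplectic_volume U = (\<integral>\<^sup>+x\<in>U. fact CARD('n) \<partial>lborel)"

section \<open>Hamiltonian functions and Hamiltonian diffeomorphisms\<close>

(* A function on M \<times> [0,1] is encoded by a total function on M \<times> \<real>; nothing below
   depends on its values outside M \<times> [0,1]. *)
definition hamiltonian :: "('n::finite phase \<times> real \<Rightarrow> real) \<Rightarrow> bool"
where
  "hamiltonian F \<longleftrightarrow>
     smooth_on F (UNIV \<times> {0..1}) \<and> compact (closure {z \<in> UNIV \<times> {0..1}. F z \<noteq> 0})"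

(* A union of closed sets, not itself closed in general. *)
definition ham_supp :: "('n::finite phase \<times> real \<Rightarrow> real) \<Rightarrow> 'n phase set"
where
  "ham_supp F = (\<Union>t\<in>{0..1}. closure {x. F (x, t) \<noteq> 0})"

definition ham_field :: "('n::finite phase \<times> real \<Rightarrow> real) \<Rightarrow> real \<Rightarrow> 'n phase \<Rightarrow> 'n phase"
where
  "ham_field F t x =
     (THE X. \<forall>V. omega0 X V = - frechet_derivative (\<lambda>q. F (q, t)) (at x) V)"

(* The smoothness contained in isotopy excludes no Hamiltonian function: the flow of the smooth,
   compactly supported field is complete and depends smoothly on the initial point. *)
definition ham_isotopy ::
  "('n::finite phase \<times> real \<Rightarrow> real) \<Rightarrow> (real \<Rightarrow> 'n phase \<Rightarrow> 'n phase) \<Rightarrow> bool"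
where
  "ham_isotopy F \<phi> \<longleftrightarrow> isotopy \<phi> \<and> \<phi> 0 = id \<and>
     (\<forall>x. \<forall>t\<in>{0..1}.
        ((\<lambda>s. \<phi> s x) has_vector_derivative ham_field F t (\<phi> t x)) (at t within {0..1}))"

(* The graph of the map sending F to its time-one map. *)
definition generates ::
  "('n::finite phase \<times> real \<Rightarrow> real) \<Rightarrow> ('n phase \<Rightarrow> 'n phase) \<Rightarrow> bool"
where
  "generates F f \<longleftrightarrow> (\<exists>\<phi>. ham_isotopy F \<phi> \<and> f = \<phi> 1)"

definition Ham :: "('n::finite phase \<Rightarrow> 'n phase) set"
where
  "Ham = {f. \<exists>F. hamiltonian F \<and> generates F f}"

section \<open>Hofer's norm and its fragmented version\<close>

(* For a Hamiltonian function F the supremum and infimum are attained. *)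
definition hofer_length :: "('n::finite phase \<times> real \<Rightarrow> real) \<Rightarrow> real"
where
  "hofer_length F = integral {0..1} (\<lambda>t. (SUP x. F (x, t)) - (INF x. F (x, t)))"

definition hofer_norm :: "('n::finite phase \<Rightarrow> 'n phase) \<Rightarrow> real"
where
  "hofer_norm f = Inf {hofer_length F | F. hamiltonian F \<and> generates F f}"

(* A triple (F, g, h) in the list stands for the factor h g h^(-1) with g generated by F.
   The empty list (for f = id) has length 0, as does the one-term family F = 0. *)
definition fragmented_hofer_norm ::
  "'n::finite phase set \<Rightarrow> ('n phase \<Rightarrow> 'n phase) \<Rightarrow> real"
where
  "fragmented_hofer_norm U f =
     Inf {(\<Sum>(F, g, h)\<leftarrow>L. hofer_length F) | L.
       (\<forall>(F, g, h)\<in>set L. hamiltonian F \<and> generates F g \<and> ham_supp F \<subseteq> U \<and> h \<in> Ham) \<and>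
       f = foldr (\<circ>) (map (\<lambda>(F, g, h). h \<circ> g \<circ> inv h) L) id}"

definition equivalent_norms :: "'g set \<Rightarrow> ('g \<Rightarrow> real) \<Rightarrow> ('g \<Rightarrow> real) \<Rightarrow> bool"
where
  "equivalent_norms G N1 N2 \<longleftrightarrow>
     (\<exists>a>0. \<exists>b>0. \<forall>g\<in>G. 1 / a * N1 g - b \<le> N2 g \<and> N2 g \<le> a * N1 g + b)"

end

theory Submission
  imports Defs
begin

text \<open>
  The Calabi invariant separates the two norms. Let \<open>\<lambda>\<close> be the primitive \<open>\<lambda>\<^sub>z v = omega0 z v / 2\<close> of
  the symplectic form. A Hamiltonian diffeomorphism \<open>\<phi>\<close> satisfies \<open>\<phi>\<^sup>*\<lambda> - \<lambda> = dA\<close> for a unique function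
  \<open>A\<close> of bounded support, and the integral of \<open>A\<close> depends on \<open>\<phi>\<close> alone, is additive under
  composition, and is invariant under conjugation. If \<open>F\<close> generates \<open>\<phi>\<close>, this integral is
  \<open>- (n + 1)\<close> times the integral of \<open>F\<close> over space and time. For \<open>F\<close> supported in \<open>U\<close> the latter is at most
  the volume of \<open>U\<close> times the Hofer length of \<open>F\<close>, because a compactly supported function takes the
  value 0 somewhere and hence \<open>\<bar>F\<^sub>t\<bar> \<le> max F\<^sub>t - min F\<^sub>t\<close>. Thus every fragmentation of \<open>\<phi>\<close> into conjugates of
  diffeomorphisms generated in \<open>U\<close> has total length at least a constant times the absolute value
  of the Calabi invariant of \<open>\<phi>\<close>.

  Hofer's norm obeys no such bound. Take a bump supported in a small ball in \<open>U\<close> and generate from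
  it a twist of that ball. Conjugating the twist by Hamiltonian half turns about suitable centres
  moves it to \<open>m\<close> pairwise disjoint balls. The product of these \<open>m\<close> conjugates is generated by the sum
  of \<open>m\<close> bumps with disjoint supports, so that its Hofer norm stays bounded by 1, while its Calabi
  invariant, and with it its fragmented norm, grows linearly in \<open>m\<close>. The product is given as a
  fragmentation, so its fragmented norm is the infimum of a nonempty set.

  The construction of \<open>A\<close> is the lemma \<open>generates_calabi_potential\<close>, its algebra is in
  \<open>calabi_potential_comp\<close>, \<open>calabi_potential_inv\<close> and \<open>calabi_potential_unique\<close>, the estimate is
  \<open>calabi_integral_bound\<close>, and the twists are in \<open>disjoint_twists\<close>. All flows in the construction are
  explicit rotations, and the properties of a general Hamiltonian flow are derived from the
  smoothness that belongs to the notion of isotopy.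
\<close>

section \<open>Calculus of smooth maps\<close>

lemma Ck_on_cong:
  assumes "open S" and "\<And>x. x \<in> S \<Longrightarrow> f x = g x" and "Ck_on k f S"
  shows "Ck_on k g S"
  using assms(2,3)
proof (induction k arbitrary: f g)
  case 0
  then show ?case using continuous_on_cong[of S S f g] by simp
next
  case (Suc k)
  have g: "(g has_derivative frechet_derivative f (at x)) (at x)" if "x \<in> S" for x
    using Suc.prems that assms(1)
    by (auto intro!: has_derivative_transform_within_open[of f _ x UNIV S g] simp: frechet_derivative_works)
  then have eq: "frechet_derivative f (at x) = frechet_derivative g (at x)" if "x \<in> S" for x
    using that frechet_derivative_at by blast
  show ?case
    unfolding Ck_on.simps
  proof (intro conjI ballI allI)
    fix v show "Ck_on k (\<lambda>x. frechet_derivative g (at x) v) S"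
      by (rule Suc.IH[of "\<lambda>x. frechet_derivative f (at x) v"]) (use eq Suc.prems in auto)
  qed (use g differentiable_def in blast)
qed

text \<open>
  The recursive clause of \<open>Ck_on\<close> speaks about the chosen derivative \<open>frechet_derivative\<close>; this rule
  accepts any formula for the derivative, since both agree on the open set \<open>S\<close>.
\<close>

lemma Ck_on_Suc:
  assumes "open S" "\<And>x. x \<in> S \<Longrightarrow> (f has_derivative f' x) (at x)" "\<And>v. Ck_on k (\<lambda>x. f' x v) S"
  shows "Ck_on (Suc k) f S"
proof -
  have eq: "f' x = frechet_derivative f (at x)" if "x \<in> S" for x
    using assms(2)[OF that] by (rule frechet_derivative_at)
  show ?thesis
    unfolding Ck_on.simps
  proof (intro conjI ballI allI)
    fix v show "Ck_on k (\<lambda>x. frechet_derivative f (at x) v) S"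
      by (rule Ck_on_cong[OF assms(1) _ assms(3)[of v]]) (simp add: eq)
  qed (use assms(2) differentiable_def in blast)
qed

lemma Ck_on_continuous: "Ck_on k f S \<Longrightarrow> continuous_on S f"
  by (cases k) (auto intro!: continuous_at_imp_continuous_on differentiable_imp_continuous_within)

lemma Ck_on_SucD: "Ck_on (Suc k) f S \<Longrightarrow> Ck_on k f S"
proof (induction k arbitrary: f)
  case 0
  then show ?case using Ck_on_continuous[of "Suc 0" f S] by simp
next
  case (Suc k)
  have d: "\<forall>x\<in>S. f differentiable (at x)" "Ck_on (Suc k) (\<lambda>x. frechet_derivative f (at x) v) S" for v
    using Suc.prems unfolding Ck_on.simps(2)[of "Suc k"] by blast+
  show ?case
    unfolding Ck_on.simps(2)[of k] using d(1) Suc.IH[OF d(2)] by blast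
qed

lemma Ck_on_subset: "Ck_on k f S \<Longrightarrow> T \<subseteq> S \<Longrightarrow> Ck_on k f T"
  by (induction k arbitrary: f) (auto intro: continuous_on_subset)

lemma Ck_on_has_derivative:
  "Ck_on (Suc k) f S \<Longrightarrow> x \<in> S \<Longrightarrow> (f has_derivative frechet_derivative f (at x)) (at x)"
  by (auto simp: frechet_derivative_works)

lemma Ck_on_frechet_derivative:
  "Ck_on (Suc k) f S \<Longrightarrow> Ck_on k (\<lambda>x. frechet_derivative f (at x) v) S"
  by (simp only: Ck_on.simps)

lemma Ck_on_const: "open S \<Longrightarrow> Ck_on k (\<lambda>x. c) S"
  by (induction k arbitrary: c) (auto)

lemma Ck_on_bounded_linear:
  assumes "open S" "bounded_linear f" shows "Ck_on k f S"
proof (cases k)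
  case 0
  then show ?thesis using assms(2) by (simp add: linear_continuous_on)
next
  case (Suc m)
  show ?thesis unfolding Suc
    by (rule Ck_on_Suc[OF assms(1), where f'="\<lambda>x. f"])
      (auto intro: bounded_linear_imp_has_derivative Ck_on_const assms)
qed

lemma Ck_on_add:
  assumes "open S" "Ck_on k f S" "Ck_on k g S" shows "Ck_on k (\<lambda>x. f x + g x) S"
  using assms(2,3)
proof (induction k arbitrary: f g)
  case 0 then show ?case by (auto intro: continuous_on_add)
next
  case (Suc k)
  show ?case
    by (rule Ck_on_Suc[OF assms(1) has_derivative_add[OF Suc.prems[THEN Ck_on_has_derivative]]])
      (use Suc in auto)
qed

lemma Ck_on_sum:
  assumes "open S" "\<And>i. i \<in> I \<Longrightarrow> Ck_on k (f i) S" shows "Ck_on k (\<lambda>x. \<Sum>i\<in>I. f i x) S"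
  using assms(2)
  by (induction I rule: infinite_finite_induct) (auto intro!: Ck_on_add Ck_on_const assms(1))

lemma Ck_on_bilinear:
  assumes "bounded_bilinear b" "open S" "Ck_on k f S" "Ck_on k g S"
  shows "Ck_on k (\<lambda>x. b (f x) (g x)) S"
  using assms(3,4)
proof (induction k arbitrary: f g)
  case 0 then show ?case using bounded_bilinear.continuous_on[OF assms(1)] by auto
next
  case (Suc k)
  show ?case
    by (rule Ck_on_Suc[OF assms(2) bounded_bilinear.FDERIV[OF assms(1) Suc.prems[THEN Ck_on_has_derivative]]])
      (use Suc.prems Ck_on_SucD[OF Suc.prems(1)] Ck_on_SucD[OF Suc.prems(2)]
        in \<open>auto intro!: Ck_on_add assms(2) Suc.IH\<close>)
qed

lemma Ck_on_bounded_linear_compose: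
  assumes "bounded_linear h" "open S" "Ck_on k f S"
  shows "Ck_on k (\<lambda>x. h (f x)) S"
  using assms(3)
proof (induction k arbitrary: f)
  case 0 then show ?case using linear_continuous_on[OF assms(1)]
    by (auto intro: continuous_on_compose2)
next
  case (Suc k)
  show ?case
    by (rule Ck_on_Suc[OF assms(2) bounded_linear.has_derivative[OF assms(1) Suc.prems[THEN Ck_on_has_derivative]]])
      (use Suc in auto)
qed

text \<open>
  The chain rule applies the derivative of \<open>g\<close> at \<open>f x\<close> to a vector that itself depends on \<open>x\<close>.
  Expanding that vector in the standard basis leaves a sum of products of a scalar function with a
  composition to which the induction hypothesis applies.
\<close>

lemma Ck_on_compose:
  fixes f :: "'a::euclidean_space \<Rightarrow> 'b::euclidean_space" and g :: "'b \<Rightarrow> 'c::real_normed_vector"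
  assumes "open S" "open T" "f ` S \<subseteq> T" "Ck_on k f S" "Ck_on k g T"
  shows "Ck_on k (\<lambda>x. g (f x)) S"
  using assms(4,5)
proof (induction k arbitrary: g)
  case 0 then show ?case using assms(3) by (auto intro: continuous_on_compose2)
next
  case (Suc k)
  let ?Df = "\<lambda>x. frechet_derivative f (at x)" and ?Dg = "\<lambda>x. frechet_derivative g (at x)"
  have d: "((\<lambda>x. g (f x)) has_derivative (\<lambda>v. \<Sum>b\<in>Basis. (?Df x v \<bullet> b) *\<^sub>R ?Dg (f x) b)) (at x)"
    if "x \<in> S" for x
  proof -
    have "(g has_derivative ?Dg (f x)) (at (f x))"
      using assms(3) that by (intro Ck_on_has_derivative[OF Suc.prems(2)]) blast
    then have "((\<lambda>x. g (f x)) has_derivative (\<lambda>v. ?Dg (f x) (?Df x v))) (at x)"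
      by (rule has_derivative_compose[OF Ck_on_has_derivative[OF Suc.prems(1) that]])
    moreover have lin: "linear (?Dg (f x))"
      using \<open>(g has_derivative ?Dg (f x)) (at (f x))\<close> has_derivative_linear by blast
    have "?Dg (f x) (?Df x v) = (\<Sum>b\<in>Basis. (?Df x v \<bullet> b) *\<^sub>R ?Dg (f x) b)" for v
    proof -
      have "?Dg (f x) (?Df x v) = ?Dg (f x) (\<Sum>b\<in>Basis. (?Df x v \<bullet> b) *\<^sub>R b)"
        by (simp only: euclidean_representation)
      then show ?thesis by (simp only: linear_sum[OF lin] linear_cmul[OF lin])
    qed
    ultimately show ?thesis by simp
  qed
  show ?case
  proof (rule Ck_on_Suc[OF assms(1) d])
    fix v
    have "Ck_on k (\<lambda>x. ?Dg (f x) b) S" for b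
      using Suc.prems(2) by (intro Suc.IH[OF Ck_on_SucD[OF Suc.prems(1)]]) simp
    moreover have "Ck_on k (\<lambda>x. ?Df x v \<bullet> b) S" for b
      using Suc.prems by (intro Ck_on_bounded_linear_compose[OF bounded_linear_inner_left assms(1)]) auto
    ultimately show "Ck_on k (\<lambda>x. \<Sum>b\<in>Basis. (?Df x v \<bullet> b) *\<^sub>R ?Dg (f x) b) S"
      by (intro Ck_on_sum[OF assms(1)] Ck_on_bilinear[OF bounded_bilinear_scaleR assms(1)])
  qed
qed

lemma Ck_on_Pair:
  assumes "open S" "Ck_on k f S" "Ck_on k g S" shows "Ck_on k (\<lambda>x. (f x, g x)) S"
proof -
  have "Ck_on k (\<lambda>x. (f x, 0) + (0, g x)) S"
    using assms by (intro Ck_on_add Ck_on_bounded_linear_compose[of "\<lambda>y. (y, 0)"]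
      Ck_on_bounded_linear_compose[of "\<lambda>y. (0, y)"] bounded_linear_Pair bounded_linear_ident bounded_linear_zero)
  then show ?thesis by simp
qed

text \<open>
  The increment of \<open>f\<close> in direction \<open>w\<close> is the integral of the derivative in direction \<open>w\<close>.
  Differentiating under the integral in direction \<open>v\<close>, and then in the upper limit, takes the two
  derivatives in the opposite order.
\<close>

lemma symmetric_second_derivative:
  fixes f :: "'a::euclidean_space \<Rightarrow> 'b::banach"
  assumes "open S" "Ck_on 2 f S" "x \<in> S"
  shows "frechet_derivative (\<lambda>x. frechet_derivative f (at x) v) (at x) w =
         frechet_derivative (\<lambda>x. frechet_derivative f (at x) w) (at x) v"
proof -
  let ?D = "\<lambda>v x. frechet_derivative f (at x) v"
  let ?DD = "\<lambda>v w x. frechet_derivative (?D v) (at x) w"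
  have C2: "Ck_on (Suc (Suc 0)) f S" using assms(2) by (simp add: numeral_2_eq_2 del: Ck_on.simps)
  have d1: "(f has_derivative (\<lambda>v. ?D v y)) (at y)" if "y \<in> S" for y
    using C2 that by (rule Ck_on_has_derivative)
  have C1: "Ck_on (Suc 0) (?D v) S" for v
    using C2 by auto
  have d2: "(?D v has_derivative (\<lambda>w. ?DD v w y)) (at y)" if "y \<in> S" for y v
    using C1 that by (rule Ck_on_has_derivative)
  have cD: "continuous_on S (?D v)" "continuous_on S (?DD v w)" for v w
    using C1[of v] Ck_on_continuous[OF C1] by auto
  obtain r where r: "r > 0" "ball x r \<subseteq> S"
    using assms(1,3) openE by blast
  \<comment> \<open>small enough for the parallelogram with sides \<open>e v\<close> and \<open>e w\<close> at \<open>x\<close> to stay in the ball\<close>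
  define e where "e = r / (2 * (norm v + norm w + 1))"
  have e: "e > 0" using r by (auto simp: e_def add_nonneg_pos intro!: divide_pos_pos)
  have inS: "x + s *\<^sub>R v + t *\<^sub>R w \<in> S" if "\<bar>s\<bar> \<le> e" "\<bar>t\<bar> \<le> e" for s t
  proof -
    have "norm (s *\<^sub>R v + t *\<^sub>R w) \<le> \<bar>s\<bar> * norm v + \<bar>t\<bar> * norm w"
      by (rule norm_triangle_le) simp
    also have "\<dots> \<le> e * norm v + e * norm w"
      using that by (intro add_mono mult_right_mono) auto
    also have "\<dots> < 2 * (e * (norm v + norm w + 1))"
    proof -
      have "0 \<le> e * norm v" "0 \<le> e * norm w" using e by auto
      then show ?thesis using e by (simp only: distrib_left)
    qed
    also have "\<dots> = r"
    proof -
      have "0 < norm v + norm w + 1" by (simp add: add_nonneg_pos)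
      then show ?thesis by (simp add: e_def field_simps)
    qed
    finally have "norm (s *\<^sub>R v + t *\<^sub>R w) < r" .
    moreover have "dist x (x + u) = norm u" for u :: 'a by (simp add: dist_norm)
    ultimately have "x + (s *\<^sub>R v + t *\<^sub>R w) \<in> ball x r" by (simp only: mem_ball)
    then show ?thesis using r by (auto simp: add.assoc)
  qed
  have vd: "((\<lambda>t. g (y + t *\<^sub>R u)) has_vector_derivative G u) (at t within T)"
    if "(g has_derivative G) (at (y + t *\<^sub>R u))" for g :: "'a \<Rightarrow> 'b" and G y t T u
  proof -
    have "((\<lambda>t. y + t *\<^sub>R u) has_derivative (\<lambda>h. h *\<^sub>R u)) (at t within T)"
      by (auto intro!: derivative_eq_intros)
    then have "((\<lambda>t. g (y + t *\<^sub>R u)) has_derivative (\<lambda>h. G (h *\<^sub>R u))) (at t within T)"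
      by (rule has_derivative_compose) (rule that)
    then show ?thesis
      unfolding has_vector_derivative_def linear_cmul[OF has_derivative_linear[OF that]] .
  qed
  have vds: "((\<lambda>s. g (x + s *\<^sub>R v + t *\<^sub>R w)) has_vector_derivative G v) (at s within T)"
    if "(g has_derivative G) (at (x + s *\<^sub>R v + t *\<^sub>R w))" for g :: "'a \<Rightarrow> 'b" and G s t T
    using vd[of g G "x + t *\<^sub>R w" s v T] that by (simp add: algebra_simps)
  have cl: "continuous_on {0..e} (\<lambda>\<tau>. h (x + \<tau> *\<^sub>R w))" if "continuous_on S h" for h :: "'a \<Rightarrow> 'b"
    using inS[of 0] e by (intro continuous_on_compose2[OF that] continuous_intros) auto
  have inc: "f (x + s *\<^sub>R v + t *\<^sub>R w) - f (x + s *\<^sub>R v) =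
      integral (cbox 0 t) (\<lambda>\<tau>. ?D w (x + s *\<^sub>R v + \<tau> *\<^sub>R w))" if "\<bar>s\<bar> \<le> e" "0 \<le> t" "t \<le> e" for s t
  proof -
    have "((\<lambda>\<tau>. ?D w (x + s *\<^sub>R v + \<tau> *\<^sub>R w)) has_integral
       f (x + s *\<^sub>R v + t *\<^sub>R w) - f (x + s *\<^sub>R v + 0 *\<^sub>R w)) {0..t}"
      using that by (intro fundamental_theorem_of_calculus vd d1 inS) auto
    then show ?thesis by (simp add: integral_unique)
  qed
  have key: "?D v (x + t *\<^sub>R w) - ?D v x = integral {0..t} (\<lambda>\<tau>. ?DD w v (x + \<tau> *\<^sub>R w))"
    if t: "0 \<le> t" "t \<le> e" for t
  proof -
    have cont: "continuous_on ({-e..e} \<times> cbox 0 t) (\<lambda>(s, \<tau>). h (x + s *\<^sub>R v + \<tau> *\<^sub>R w))"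
      if "continuous_on S h" for h :: "'a \<Rightarrow> 'b"
      unfolding split_beta using t
      by (intro continuous_on_compose2[OF that] continuous_intros) (auto intro!: inS)
    have "((\<lambda>s. integral (cbox 0 t) (\<lambda>\<tau>. ?D w (x + s *\<^sub>R v + \<tau> *\<^sub>R w))) has_vector_derivative
        integral (cbox 0 t) (\<lambda>\<tau>. ?DD w v (x + 0 *\<^sub>R v + \<tau> *\<^sub>R w))) (at 0 within {-e..e})"
    proof (rule leibniz_rule_vector_derivative[OF _ _ cont])
      fix s assume s: "s \<in> {-e..e}"
      show "(\<lambda>\<tau>. ?D w (x + s *\<^sub>R v + \<tau> *\<^sub>R w)) integrable_on cbox 0 t"
        using s t by (intro integrable_continuous continuous_on_compose2[OF cD(1)] continuous_intros)
          (auto intro!: inS)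
      fix \<tau> assume "\<tau> \<in> cbox 0 t"
      then show "((\<lambda>s. ?D w (x + s *\<^sub>R v + \<tau> *\<^sub>R w)) has_vector_derivative
          ?DD w v (x + s *\<^sub>R v + \<tau> *\<^sub>R w)) (at s within {-e..e})"
        using s t by (intro vds d2 inS) auto
    qed (use e cD in auto)
    then have "((\<lambda>s. f (x + s *\<^sub>R v + t *\<^sub>R w) - f (x + s *\<^sub>R v)) has_vector_derivative
        integral (cbox 0 t) (\<lambda>\<tau>. ?DD w v (x + 0 *\<^sub>R v + \<tau> *\<^sub>R w))) (at 0 within {-e..e})"
      by (rule has_vector_derivative_transform[rotated 2]) (use e t in \<open>auto simp: inc\<close>)
    moreover have "((\<lambda>s. f (x + s *\<^sub>R v + t *\<^sub>R w) - f (x + s *\<^sub>R v + 0 *\<^sub>R w)) has_vector_derivative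
        ?D v (x + 0 *\<^sub>R v + t *\<^sub>R w) - ?D v (x + 0 *\<^sub>R v + 0 *\<^sub>R w)) (at 0 within {-e..e})"
      using t e by (intro has_vector_derivative_diff vds d1 inS) auto
    ultimately show ?thesis
      using e vector_derivative_unique_within_closed_interval[of "-e" e 0] by simp
  qed
  have "((\<lambda>t. integral {0..t} (\<lambda>\<tau>. ?DD w v (x + \<tau> *\<^sub>R w))) has_vector_derivative
      ?DD w v (x + 0 *\<^sub>R w)) (at 0 within {0..e})"
    using e assms(3) by (intro integral_has_vector_derivative cl cD) auto
  then have "((\<lambda>t. ?D v (x + t *\<^sub>R w) - ?D v x) has_vector_derivative ?DD w v (x + 0 *\<^sub>R w)) (at 0 within {0..e})"
    by (rule has_vector_derivative_transform[rotated 2]) (use e in \<open>auto simp: key\<close>)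
  moreover have "((\<lambda>t. ?D v (x + t *\<^sub>R w) - ?D v x) has_vector_derivative ?DD v w x - 0) (at 0 within {0..e})"
    using d2[OF assms(3)] by (intro has_vector_derivative_diff vd has_vector_derivative_const) auto
  ultimately show ?thesis
    using e vector_derivative_unique_within_closed_interval[of 0 e 0] by simp
qed

lemma smooth_on_UNIV: "smooth_on f UNIV \<longleftrightarrow> (\<forall>k. Ck_on k f UNIV)"
proof
  assume "smooth_on f UNIV"
  then obtain g where g: "\<And>k. Ck_on k g UNIV" "\<And>x. g x = f x"
    unfolding smooth_on_def by (metis UNIV_I top.extremum_uniqueI)
  have "g = f" using g(2) by blast
  then show "\<forall>k. Ck_on k f UNIV" using g(1) by blast
next
  assume "\<forall>k. Ck_on k f UNIV"
  then show "smooth_on f UNIV" unfolding smooth_on_def by blast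
qed

lemma slice_x:
  assumes "(h has_derivative h') (at (x, t))"
  shows "((\<lambda>x. h (x, t)) has_derivative (\<lambda>v. h' (v, 0))) (at x)"
  by (rule has_derivative_compose[OF has_derivative_Pair[OF has_derivative_ident has_derivative_const] assms])

lemma slice_t:
  assumes h: "(h has_derivative h') (at (x, t))"
  shows "((\<lambda>t. h (x, t)) has_vector_derivative h' (0, 1)) (at t within S)"
proof -
  have "((\<lambda>t. h (x, t)) has_derivative (\<lambda>r. h' (0, r))) (at t within S)"
    by (rule has_derivative_compose[OF has_derivative_Pair[OF has_derivative_const has_derivative_ident] h])
  moreover have "(\<lambda>r. h' (0, r)) = (\<lambda>r. r *\<^sub>R h' (0, 1))"
  proof
    fix r show "h' (0, r) = r *\<^sub>R h' (0, 1)"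
      using linear_cmul[OF has_derivative_linear[OF h], of r "(0, 1)"] by simp
  qed
  ultimately show ?thesis by (simp only: has_vector_derivative_def)
qed

lemma smooth_has_derivative:
  assumes "\<And>k. Ck_on k f UNIV" shows "(f has_derivative frechet_derivative f (at x)) (at x)"
  by (rule Ck_on_has_derivative[OF assms UNIV_I])

lemma smooth_compose:
  fixes f :: "'a::euclidean_space \<Rightarrow> 'b::euclidean_space" and g :: "'b \<Rightarrow> 'c::real_normed_vector"
  shows "Ck_on k f UNIV \<Longrightarrow> Ck_on k g UNIV \<Longrightarrow> Ck_on k (\<lambda>x. g (f x)) UNIV"
  by (rule Ck_on_compose[OF open_UNIV open_UNIV]) auto

lemma frechet_derivative_cong_open:
  assumes "open O'" "x \<in> O'" and eq: "\<And>y. y \<in> O' \<Longrightarrow> f y = g y"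
  shows "frechet_derivative f (at x) = frechet_derivative g (at x)"
proof -
  have "(f has_derivative D) (at x) = (g has_derivative D) (at x)" for D
    using has_derivative_transform_within_open[of f D x UNIV O' g]
      has_derivative_transform_within_open[of g D x UNIV O' f] assms by metis
  then show ?thesis unfolding frechet_derivative_def by simp
qed

lemma Ck_on_SucI1:
  fixes f :: "real \<Rightarrow> 'b::real_normed_vector"
  assumes "open S" "\<And>x. x \<in> S \<Longrightarrow> (f has_vector_derivative f' x) (at x)" "Ck_on k f' S"
  shows "Ck_on (Suc k) f S"
  by (rule Ck_on_Suc[OF assms(1), where f'="\<lambda>x v. v *\<^sub>R f' x"])
    (use assms Ck_on_bounded_linear_compose[OF bounded_linear_scaleR_right] in
      \<open>auto simp: has_vector_derivative_def\<close>)

lemma Ck_on_sin_cos: "Ck_on k (sin :: real \<Rightarrow> real) UNIV \<and> Ck_on k (cos :: real \<Rightarrow> real) UNIV"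
proof (induction k)
  case (Suc k)
  have "Ck_on k (\<lambda>x::real. - sin x) UNIV"
    using Suc by (intro Ck_on_bounded_linear_compose[OF bounded_linear_minus[OF bounded_linear_ident]]) auto
  then show ?case
    by (intro conjI Ck_on_SucI1[of UNIV sin cos] Ck_on_SucI1[of UNIV cos "\<lambda>x. - sin x"])
      (use Suc in \<open>auto intro!: derivative_eq_intros simp flip: has_real_derivative_iff_has_vector_derivative\<close>)
qed (auto intro: continuous_intros)

lemma Ck_on_inverse: "Ck_on k (inverse :: real \<Rightarrow> real) (- {0})"
proof (induction k)
  case (Suc k)
  have "Ck_on k (\<lambda>x::real. - (inverse x * inverse x)) (- {0})"
    using Suc by (intro Ck_on_bounded_linear_compose[OF bounded_linear_minus[OF bounded_linear_ident]]
      Ck_on_bilinear[OF bounded_bilinear_mult]) auto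
  then show ?case
    by (intro Ck_on_SucI1[of "- {0}" inverse "\<lambda>x. - (inverse x * inverse x)"])
      (auto intro!: derivative_eq_intros simp flip: has_real_derivative_iff_has_vector_derivative)
qed (auto intro!: continuous_intros)

text \<open>
  For \<open>m = 0\<close> this is the standard smooth function that is flat at 0. With the factors \<open>(1/x)\<^sup>m\<close> the
  linear combinations of the family are closed under differentiation.
\<close>

definition flat_exp :: "nat \<Rightarrow> real \<Rightarrow> real" where
  "flat_exp m x = (if x > 0 then inverse x ^ m * exp (- inverse x) else 0)"

lemma power_le_fact_exp:
  fixes y :: real assumes "y \<ge> 0" shows "y ^ N \<le> fact N * exp y"
proof -
  have "(\<Sum>n\<in>{N}. inverse (fact n) *\<^sub>R y ^ n) \<le> (\<Sum>n. inverse (fact n) *\<^sub>R y ^ n)"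
    using assms summable_exp_generic[of y] by (intro sum_le_suminf) auto
  then show ?thesis by (simp add: exp_def field_simps)
qed

text \<open>
  A quadratic bound makes the derivative at 0 vanish, whatever the power of \<open>1/x\<close>.
\<close>

lemma flat_exp_bound: "\<bar>flat_exp m x\<bar> \<le> fact (m + 2) * x\<^sup>2"
proof (cases "x > 0")
  case True
  let ?y = "inverse x"
  have y: "?y > 0" "x = inverse ?y" using True by auto
  have "?y ^ m * ?y\<^sup>2 \<le> fact (m + 2) * exp ?y"
    using power_le_fact_exp[of ?y "m + 2"] y by (simp add: power_add power2_eq_square mult_ac)
  then have "?y ^ m * exp (- ?y) \<le> fact (m + 2) * x\<^sup>2"
    using y True by (simp add: exp_minus field_simps)
  then show ?thesis using True by (simp add: flat_exp_def)
qed (simp add: flat_exp_def)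

lemma flat_exp_has_derivative:
  "(flat_exp m has_real_derivative flat_exp (m + 2) x - m * flat_exp (m + 1) x) (at x)"
proof -
  consider "x > 0" | "x < 0" | "x = 0" by linarith
  then show ?thesis
  proof cases
    case 1
    have "((\<lambda>x. inverse x ^ m * exp (- inverse x)) has_real_derivative
        flat_exp (m + 2) x - m * flat_exp (m + 1) x) (at x)"
      using 1 by (cases m)
        (auto intro!: derivative_eq_intros simp: flat_exp_def field_simps power_add power2_eq_square,
          metis One_nat_def mult.commute neq0_conv power_minus_mult)
    then show ?thesis
      by (rule has_field_derivative_transform_within_open[of _ _ _ "{0<..}"]) (use 1 in \<open>auto simp: flat_exp_def\<close>)
  next
    case 2
    have "((\<lambda>x. 0) has_real_derivative flat_exp (m + 2) x - m * flat_exp (m + 1) x) (at x)"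
      using 2 by (auto simp: flat_exp_def)
    then show ?thesis
      by (rule has_field_derivative_transform_within_open[of _ _ _ "{..<0}"]) (use 2 in \<open>auto simp: flat_exp_def\<close>)
  next
    case 3
    have "(\<lambda>h. flat_exp m h / h) \<midarrow>0\<rightarrow> 0"
    proof (rule Lim_null_comparison)
      show "\<forall>\<^sub>F h in at 0. norm (flat_exp m h / h) \<le> fact (m + 2) * \<bar>h\<bar>"
      proof (rule always_eventually, rule)
        fix h :: real
        show "norm (flat_exp m h / h) \<le> fact (m + 2) * \<bar>h\<bar>"
          using flat_exp_bound[of m h] power2_abs[of h]
          by (cases "h = 0") (auto simp del: power2_abs fact_Suc simp: abs_divide pos_divide_le_eq power2_eq_square mult.assoc)
      qed
    qed (auto intro!: tendsto_eq_intros)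
    then show ?thesis
      using 3 by (simp add: DERIV_def flat_exp_def)
  qed
qed

lemma Ck_on_flat_exp: "Ck_on k (flat_exp m) UNIV"
proof (induction k arbitrary: m)
  case 0
  have "isCont (flat_exp m) x" for x
    using flat_exp_has_derivative DERIV_isCont by blast
  then show ?case by (simp add: continuous_at_imp_continuous_on)
next
  case (Suc k)
  have "Ck_on k (\<lambda>x. flat_exp (m + 2) x + (- real m) *\<^sub>R flat_exp (m + 1) x) UNIV"
    by (intro Ck_on_add Ck_on_bounded_linear_compose[OF bounded_linear_scaleR_right] Suc) auto
  then show ?case
    using flat_exp_has_derivative[of m]
    by (intro Ck_on_SucI1[of UNIV "flat_exp m" "\<lambda>x. flat_exp (m + 2) x - m * flat_exp (m + 1) x"])
      (auto simp flip: has_real_derivative_iff_has_vector_derivative)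
qed



definition smooth_step :: "real \<Rightarrow> real \<Rightarrow> real \<Rightarrow> real" where
  "smooth_step a b x = flat_exp 0 (b - x) * inverse (flat_exp 0 (b - x) + flat_exp 0 (x - a))"

lemma Ck_on_smooth_step:
  assumes "a < b" shows "Ck_on k (smooth_step a b) UNIV"
proof -
  have aff: "Ck_on k (\<lambda>x. flat_exp 0 (b - x)) UNIV" "Ck_on k (\<lambda>x. flat_exp 0 (x - a)) UNIV"
    using Ck_on_add[OF _ Ck_on_const Ck_on_bounded_linear[OF _ bounded_linear_minus[OF bounded_linear_ident]], of UNIV k b]
      Ck_on_add[OF _ Ck_on_bounded_linear[OF _ bounded_linear_ident] Ck_on_const, of UNIV k "- a"]
    by (auto intro!: Ck_on_compose[OF _ _ _ _ Ck_on_flat_exp])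
  have pos: "flat_exp 0 (b - x) + flat_exp 0 (x - a) \<noteq> 0" for x
  proof -
    have "flat_exp 0 (b - x) \<ge> 0" "flat_exp 0 (x - a) \<ge> 0" "flat_exp 0 (b - x) > 0 \<or> flat_exp 0 (x - a) > 0"
      using assms by (auto simp: flat_exp_def)
    then show ?thesis by linarith
  qed
  have "Ck_on k (\<lambda>x. inverse (flat_exp 0 (b - x) + flat_exp 0 (x - a))) UNIV"
    using pos by (intro Ck_on_compose[OF _ _ _ _ Ck_on_inverse] Ck_on_add aff) auto
  then show ?thesis
    unfolding smooth_step_def[abs_def] by (intro Ck_on_bilinear[OF bounded_bilinear_mult] aff) auto
qed

lemma smooth_step_values:
  assumes "a < b"
  shows "x \<le> a \<Longrightarrow> smooth_step a b x = 1" "b \<le> x \<Longrightarrow> smooth_step a b x = 0"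
  using assms by (auto simp: smooth_step_def flat_exp_def)

section \<open>Integrals of compactly supported functions\<close>

definition bounded_support :: "('a::real_normed_vector \<Rightarrow> 'b::zero) \<Rightarrow> bool" where
  "bounded_support f \<longleftrightarrow> (\<exists>R. \<forall>x. R < norm x \<longrightarrow> f x = 0)"

lemma integral_UNIV_eq_cbox:
  fixes f :: "'a::euclidean_space \<Rightarrow> 'b::banach"
  assumes "\<And>x. x \<notin> cbox a b \<Longrightarrow> f x = 0"
  shows "integral UNIV f = integral (cbox a b) f"
proof -
  have "(\<lambda>x. if x \<in> cbox a b then f x else 0) = f" using assms by auto
  then show ?thesis using Henstock_Kurzweil_Integration.integral_restrict_UNIV[of "cbox a b" f] by simp
qed

lemma integrable_bounded_support:
  fixes f :: "'a::euclidean_space \<Rightarrow> 'b::banach"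
  assumes "continuous_on UNIV f" "bounded_support f"
  shows "f integrable_on UNIV"
proof -
  obtain R where R: "\<And>x. R < norm x \<Longrightarrow> f x = 0" using assms(2) by (auto simp: bounded_support_def)
  obtain c where c: "cball (0::'a) R \<subseteq> cbox (-c) c" using bounded_subset_cbox_symmetric[OF bounded_cball] by blast
  have "(\<lambda>x. if x \<in> cbox (-c) c then f x else 0) = f" using R c by (force simp: not_le[symmetric])
  moreover have "f integrable_on cbox (-c) c"
    using assms(1) continuous_on_subset by (intro integrable_continuous) blast
  ultimately show ?thesis using Henstock_Kurzweil_Integration.integrable_restrict_UNIV[of "cbox (-c) c" f] by simp
qed

lemma derivative_zero_outside:
  assumes "(f has_derivative f') (at x)" "\<And>x. R < norm x \<Longrightarrow> f x = 0" "R < norm x"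
  shows "f' v = 0"
proof -
  have "open {x. R < norm x}" by (intro open_Collect_less continuous_intros)
  then have "((\<lambda>x. 0) has_derivative f') (at x)"
    using assms by (auto intro: has_derivative_transform_within_open[OF assms(1)])
  then have "f' = (\<lambda>v. 0)" by (rule has_derivative_unique) simp
  then show ?thesis by simp
qed

text \<open>
  By translation invariance the integral of \<open>g (x + s v)\<close> over \<open>x\<close> does not depend on \<open>s\<close>; its
  derivative at \<open>s = 0\<close> is the integral in question.
\<close>

lemma integral_directional_derivative:
  fixes g :: "'a::euclidean_space \<Rightarrow> real"
  assumes d: "\<And>x. (g has_derivative g' x) (at x)" and c: "continuous_on UNIV (\<lambda>x. g' x v)"
    and "bounded_support g"
  shows "integral UNIV (\<lambda>x. g' x v) = 0"
proof -
  obtain R where R: "\<And>x. R < norm x \<Longrightarrow> g x = 0" using assms(3) by (auto simp: bounded_support_def)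
  have R': "g' x v = 0" if "R < norm x" for x
    using derivative_zero_outside[OF d R that] .
  obtain b where b: "cball (0::'a) (R + norm v) \<subseteq> cbox (-b) b"
    using bounded_subset_cbox_symmetric[OF bounded_cball] by blast
  have b': "x \<in> cbox (-b) b" if "\<not> R + norm v < norm x" for x
    using b that by auto
  have gc: "continuous_on UNIV g"
    by (intro continuous_at_imp_continuous_on ballI has_derivative_continuous[OF d])
  have const: "integral (cbox (-b) b) (\<lambda>x. g (x + s *\<^sub>R v)) = integral UNIV g" if "s \<in> {0..1}" for s
  proof -
    have "integral (cbox (-b) b) (\<lambda>x. g (x + s *\<^sub>R v)) = integral (cbox (-b + s *\<^sub>R v) (b + s *\<^sub>R v)) g"
      using integral_shift_cbox_plus[of "-b" b g "s *\<^sub>R v"] by (simp add: o_def add.commute)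
    also have "\<dots> = integral UNIV g"
    proof (rule integral_UNIV_eq_cbox[symmetric], rule ccontr)
      fix x assume x: "x \<notin> cbox (-b + s *\<^sub>R v) (b + s *\<^sub>R v)" and "g x \<noteq> 0"
      then have "norm x \<le> R" using R not_less by blast
      have "norm (x - s *\<^sub>R v) \<le> norm x + norm (s *\<^sub>R v)" by (rule norm_triangle_ineq4)
      also have "\<dots> \<le> R + norm v"
        using \<open>norm x \<le> R\<close> that by (auto intro!: add_mono mult_left_le_one_le)
      finally have "x - s *\<^sub>R v \<in> cbox (-b) b" using b by auto
      then have "x \<in> (+) (s *\<^sub>R v) ` cbox (-b) b" by (intro image_eqI[of _ _ "x - s *\<^sub>R v"]) auto
      then show False using x cbox_translation[of "s *\<^sub>R v" "-b" b] by (simp add: add.commute)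
    qed
    finally show ?thesis .
  qed
  have "((\<lambda>s. integral (cbox (-b) b) (\<lambda>x. g (x + s *\<^sub>R v))) has_vector_derivative
      integral (cbox (-b) b) (\<lambda>x. g' (x + 0 *\<^sub>R v) v)) (at 0 within {0..1})"
  proof (rule leibniz_rule_vector_derivative)
    fix s :: real and x
    have "((\<lambda>s. x + s *\<^sub>R v) has_derivative (\<lambda>h. h *\<^sub>R v)) (at s within {0..1})"
      by (auto intro!: derivative_eq_intros)
    then have "((\<lambda>s. g (x + s *\<^sub>R v)) has_derivative (\<lambda>h. g' (x + s *\<^sub>R v) (h *\<^sub>R v))) (at s within {0..1})"
      by (rule has_derivative_compose) (rule d)
    then show "((\<lambda>s. g (x + s *\<^sub>R v)) has_vector_derivative g' (x + s *\<^sub>R v) v) (at s within {0..1})"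
      unfolding has_vector_derivative_def linear_cmul[OF has_derivative_linear[OF d]] .
  next
    show "(\<lambda>x. g (x + s *\<^sub>R v)) integrable_on cbox (-b) b" for s
      by (intro integrable_continuous continuous_on_compose2[OF gc] continuous_intros) auto
    show "continuous_on ({0..1} \<times> cbox (- b) b) (\<lambda>(s, x). g' (x + s *\<^sub>R v) v)"
      unfolding split_beta by (intro continuous_on_compose2[OF c] continuous_intros) auto
  qed auto
  then have "((\<lambda>s::real. integral UNIV g) has_vector_derivative
      integral (cbox (-b) b) (\<lambda>x. g' (x + 0 *\<^sub>R v) v)) (at 0 within {0..1})"
    by (rule has_vector_derivative_transform[rotated 2]) (use const in auto)
  then have "integral (cbox (-b) b) (\<lambda>x. g' (x + 0 *\<^sub>R v) v) = 0"
    using vector_derivative_unique_within_closed_interval[of 0 1 0 "\<lambda>s. integral UNIV g" _ 0]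
    by simp
  moreover have "integral UNIV (\<lambda>x. g' x v) = integral (cbox (-b) b) (\<lambda>x. g' x v)"
  proof (rule integral_UNIV_eq_cbox)
    fix x assume "x \<notin> cbox (- b) b"
    then have "R + norm v < norm x" using b' by blast
    then have "R < norm x" using norm_ge_zero[of v] by linarith
    then show "g' x v = 0" by (rule R')
  qed
  ultimately show ?thesis by simp
qed

text \<open>
  This is the divergence theorem for \<open>g\<close> times the position vector, obtained by summing the previous
  lemma over the products of \<open>g\<close> with the coordinate functions.
\<close>

lemma integral_euler_field:
  fixes g :: "'a::euclidean_space \<Rightarrow> real"
  assumes d: "\<And>x. (g has_derivative g' x) (at x)" and c: "\<And>v. continuous_on UNIV (\<lambda>x. g' x v)"
    and bs: "bounded_support g"
  shows "integral UNIV (\<lambda>x. g' x x) = - real DIM('a) * integral UNIV g"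
proof -
  obtain R where R: "\<And>x. R < norm x \<Longrightarrow> g x = 0" using bs by (auto simp: bounded_support_def)
  have R': "g' x v = 0" if "R < norm x" for x v
    using derivative_zero_outside[OF d R that] .
  have gc: "continuous_on UNIV g"
    by (intro continuous_at_imp_continuous_on ballI has_derivative_continuous[OF d])
  let ?h = "\<lambda>e x. g' x e * (x \<bullet> e) + g x"
  have bsh: "bounded_support (\<lambda>x. g x * (x \<bullet> e))" "bounded_support (?h e)" for e
    unfolding bounded_support_def by (intro exI[of _ R] allI impI, simp only: R R' mult_zero_left mult_zero_right add_0_left)+
  have hc: "continuous_on UNIV (?h e)" for e
    by (intro continuous_intros c gc)
  have zero: "integral UNIV (?h e) = 0" if e: "e \<in> Basis" for e
  proof -
    have "((\<lambda>x. g x * (x \<bullet> e)) has_derivative (\<lambda>v. g x * (v \<bullet> e) + g' x v * (x \<bullet> e))) (at x)" for x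
      by (intro has_derivative_mult d has_derivative_inner_left has_derivative_ident)
    from integral_directional_derivative[OF this _ bsh(1), of e]
    show ?thesis using hc[of e] e by (simp add: add.commute)
  qed
  have eq: "(\<Sum>e\<in>Basis. ?h e x) = g' x x + real DIM('a) * g x" for x
  proof -
    have lin: "linear (g' x)" using d has_derivative_linear by blast
    have "g' x x = g' x (\<Sum>e\<in>Basis. (x \<bullet> e) *\<^sub>R e)" by (simp only: euclidean_representation)
    also have "\<dots> = (\<Sum>e\<in>Basis. (x \<bullet> e) * g' x e)"
      by (simp add: linear_sum[OF lin] linear_cmul[OF lin])
    finally show ?thesis by (simp add: sum.distrib mult.commute)
  qed
  have ig: "g integrable_on UNIV" by (rule integrable_bounded_support[OF gc bs])
  have "integral UNIV (\<lambda>x. \<Sum>e\<in>Basis. ?h e x) = (\<Sum>e\<in>Basis. integral UNIV (?h e))"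
    by (intro integral_sum integrable_bounded_support hc bsh) auto
  then have 0: "integral UNIV (\<lambda>x. g' x x + real DIM('a) * g x) = 0"
    using zero by (simp add: eq)
  have "(\<lambda>x. g' x x + real DIM('a) * g x) integrable_on UNIV"
    unfolding eq[symmetric] by (intro integrable_sum integrable_bounded_support hc bsh) auto
  from integral_diff[OF this integrable_on_mult_right[OF ig, of "real DIM('a)"]]
  show ?thesis using 0 by simp
qed

section \<open>Linear symplectic geometry\<close>

text \<open>
  The linear map that turns the inner product into \<open>omega0\<close>; the Hamiltonian field of \<open>F\<close> is
  \<open>symp_J\<close> applied to the gradient of \<open>F\<close>.
\<close>

definition symp_J :: "'n::finite phase \<Rightarrow> 'n phase" where "symp_J v = (- snd v, fst v)"

lemma omega0_eq_inner: "omega0 v w = symp_J v \<bullet> w"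
  by (simp add: omega0_def symp_J_def inner_prod_def inner_vec_def sum_subtractf sum_negf)

lemma bounded_linear_symp_J: "bounded_linear symp_J"
  unfolding symp_J_def[abs_def]
  by (intro bounded_linear_Pair bounded_linear_minus bounded_linear_fst bounded_linear_snd)

lemma symp_J_simps [simp]:
  "symp_J (v + w) = symp_J v + symp_J w" "symp_J (v - w) = symp_J v - symp_J w"
  "symp_J (r *\<^sub>R v) = r *\<^sub>R symp_J v" "symp_J (- v) = - symp_J v" "symp_J 0 = 0"
  "symp_J (symp_J v) = - v"
  by (auto simp: symp_J_def prod_eq_iff)

lemma inner_symp_J: "symp_J v \<bullet> symp_J w = v \<bullet> w" "symp_J v \<bullet> w = - (v \<bullet> symp_J w)" "symp_J v \<bullet> v = 0"
  by (auto simp: symp_J_def inner_prod_def inner_commute)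

lemma bounded_bilinear_omega0: "bounded_bilinear (omega0 :: 'n::finite phase \<Rightarrow> _)"
  unfolding omega0_eq_inner[abs_def]
  by (rule bounded_bilinear.comp1[OF bounded_bilinear_inner bounded_linear_symp_J])

lemma omega0_skew: "omega0 v w = - omega0 w v"
  by (simp add: omega0_def sum_subtractf algebra_simps)

lemma omega0_nondegenerate: "(\<And>w. omega0 u w = omega0 v w) \<Longrightarrow> u = v"
proof -
  assume "\<And>w. omega0 u w = omega0 v w"
  then have "symp_J (u - v) \<bullet> w = 0" for w by (simp add: omega0_eq_inner inner_diff_left)
  then have "symp_J (u - v) = 0" using inner_eq_zero_iff by blast
  then have "symp_J (symp_J (u - v)) = symp_J 0" by (rule arg_cong)
  then show "u = v" by simp
qed

text \<open>
  Up to sign, \<open>symp_J\<close> exchanges the basis vectors \<open>(b, 0)\<close> and \<open>(0, b)\<close>, and by symmetry of \<open>B\<close> the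
  two terms of each pair cancel.
\<close>

lemma sum_Basis_symp_J:
  fixes B :: "'n::finite phase \<Rightarrow> 'n phase \<Rightarrow> real"
  assumes "\<And>v. linear (B v)" "\<And>v w. B v w = B w v"
  shows "(\<Sum>e\<in>Basis. B e (symp_J e)) = 0"
proof -
  have "B (0, b) (- b, 0) = - B (b, 0) (0, b)" for b
    using linear_neg[OF assms(1), of "(0, b)" "(b, 0)"] assms(2)[of "(0, b)" "(b, 0)"] by simp
  then have "(\<Sum>e\<in>Basis. B e (symp_J e)) = (\<Sum>b\<in>Basis. B (b, 0) (0, b)) + (\<Sum>b\<in>Basis. - B (b, 0) (0, b))"
    unfolding Basis_prod_def
    by (subst sum.union_disjoint) (auto simp: sum.reindex inj_on_def symp_J_def)
  then show ?thesis by (simp add: sum_negf)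
qed

text \<open>
  Here \<open>w\<close> is the Hamiltonian field of \<open>b\<close>. Its divergence is 0, because it is a trace of
  \<open>symp_J\<close> against the symmetric second derivative of \<open>b\<close>; hence the derivative of \<open>a\<close> along \<open>w\<close> is the
  divergence of the field \<open>a w\<close> of bounded support.
\<close>

lemma integral_poisson_bracket:
  fixes a b :: "'n::finite phase \<Rightarrow> real"
  assumes a: "Ck_on 1 a UNIV" "bounded_support a" and b: "Ck_on 2 b UNIV"
    and w: "\<And>x v. omega0 (w x) v = - frechet_derivative b (at x) v"
  shows "integral UNIV (\<lambda>x. frechet_derivative a (at x) (w x)) = 0"
proof -
  let ?a = "\<lambda>v x. frechet_derivative a (at x) v" and ?b = "\<lambda>v x. frechet_derivative b (at x) v"
  let ?bb = "\<lambda>v w x. frechet_derivative (?b v) (at x) w"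
  have C2: "Ck_on (Suc (Suc 0)) b UNIV" using b by (simp add: numeral_2_eq_2 del: Ck_on.simps)
  have C1a: "Ck_on (Suc 0) a UNIV" using a(1) by (simp del: Ck_on.simps)
  have da: "(a has_derivative (\<lambda>v. ?a v x)) (at x)" for x
    using Ck_on_has_derivative[OF C1a] by simp
  have db: "(b has_derivative (\<lambda>v. ?b v x)) (at x)" for x
    using Ck_on_has_derivative[OF C2] by simp
  have C1: "Ck_on (Suc 0) (?b v) UNIV" for v
    using C2 unfolding Ck_on.simps(2)[of "Suc 0"] by blast
  have ddb: "(?b v has_derivative (\<lambda>w. ?bb v w x)) (at x)" for v x
    using Ck_on_has_derivative[OF C1] by simp
  have cont: "continuous_on UNIV (?bb v w)" "continuous_on UNIV (?b v)" "continuous_on UNIV (?a v)"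
    "continuous_on UNIV a" for v w
    by (rule Ck_on_continuous[OF Ck_on_frechet_derivative[OF C1]] Ck_on_continuous[OF C1]
      Ck_on_continuous[OF Ck_on_frechet_derivative[OF C1a]] Ck_on_continuous[OF C1a])+
  obtain R where R: "\<And>x. R < norm x \<Longrightarrow> a x = 0" using a(2) by (auto simp: bounded_support_def)
  have R': "?a v x = 0" if "R < norm x" for x v
    using derivative_zero_outside[OF da R that] .
  let ?h = "\<lambda>e x. a x * ?bb e (symp_J e) x + ?a (symp_J e) x * ?b e x"
  have bsh: "bounded_support (\<lambda>x. a x * ?b e x)" "bounded_support (?h e)" for e
    unfolding bounded_support_def by (intro exI[of _ R] allI impI, simp only: R R' mult_zero_left mult_zero_right add_0_left)+
  have hc: "continuous_on UNIV (?h e)" for e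
    by (intro continuous_intros cont)
  have zero: "integral UNIV (?h e) = 0" for e
    by (rule integral_directional_derivative[OF has_derivative_mult[OF da ddb] hc bsh(1)])
  have eq: "(\<Sum>e\<in>Basis. ?h e x) = ?a (w x) x" for x
  proof -
    have lin: "linear (\<lambda>v. ?a v x)" using da has_derivative_linear by blast
    have "(\<Sum>e\<in>Basis. ?bb e (symp_J e) x) = 0"
      by (rule sum_Basis_symp_J[OF has_derivative_linear[OF ddb] symmetric_second_derivative[OF open_UNIV b UNIV_I]])
    then have "(\<Sum>e\<in>Basis. ?h e x) = (\<Sum>e\<in>Basis. ?a (symp_J e) x * ?b e x)"
      by (simp only: sum.distrib sum_distrib_left[symmetric])
    also have "\<dots> = ?a (\<Sum>e\<in>Basis. ?b e x *\<^sub>R symp_J e) x"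
      by (simp only: linear_sum[OF lin] linear_cmul[OF lin] real_scaleR_def mult.commute)
    also have "(\<Sum>e\<in>Basis. ?b e x *\<^sub>R symp_J e) = w x"
    proof -
      have "?b e x = - (symp_J (w x) \<bullet> e)" for e using w[of x e] by (simp add: omega0_eq_inner)
      then have "(\<Sum>e\<in>Basis. ?b e x *\<^sub>R symp_J e) = - (\<Sum>e\<in>Basis. symp_J ((symp_J (w x) \<bullet> e) *\<^sub>R e))"
        by (simp add: sum_negf)
      also have "\<dots> = - symp_J (\<Sum>e\<in>Basis. (symp_J (w x) \<bullet> e) *\<^sub>R e)"
        by (simp only: linear_sum[OF bounded_linear.linear[OF bounded_linear_symp_J]])
      finally show ?thesis by (simp add: euclidean_representation)
    qed
    finally show ?thesis .
  qed
  have "integral UNIV (\<lambda>x. \<Sum>e\<in>Basis. ?h e x) = (\<Sum>e\<in>Basis. integral UNIV (?h e))"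
    by (intro integral_sum integrable_bounded_support hc bsh) auto
  then show ?thesis using zero by (simp add: eq)
qed

section \<open>The action of a Hamiltonian isotopy\<close>

lemma ham_field_eqI:
  assumes "\<And>V. omega0 X V = - frechet_derivative (\<lambda>q. F (q, t)) (at x) V"
  shows "ham_field F t x = X"
  unfolding ham_field_def
proof (rule the_equality)
  show "\<forall>V. omega0 X V = - frechet_derivative (\<lambda>q. F (q, t)) (at x) V" using assms by blast
  show "Y = X" if "\<forall>V. omega0 Y V = - frechet_derivative (\<lambda>q. F (q, t)) (at x) V" for Y
    by (rule omega0_nondegenerate) (simp only: assms spec[OF that])
qed

lemma omega0_ham_field:
  assumes "(\<lambda>q. F (q, t)) differentiable (at x)"
  shows "omega0 (ham_field F t x) V = - frechet_derivative (\<lambda>q. F (q, t)) (at x) V"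
proof -
  let ?D = "frechet_derivative (\<lambda>q. F (q, t)) (at x)"
  have lin: "linear ?D"
    using assms has_derivative_linear frechet_derivative_works by blast
  define X where "X = (\<Sum>e\<in>Basis. ?D e *\<^sub>R symp_J e)"
  have X: "omega0 X V = - ?D V" for V
  proof -
    have "symp_J X = - (\<Sum>e\<in>Basis. ?D e *\<^sub>R e)"
      unfolding X_def linear_sum[OF bounded_linear.linear[OF bounded_linear_symp_J]] by (simp add: sum_negf)
    then have "omega0 X V = - (\<Sum>e\<in>Basis. ?D e * (e \<bullet> V))"
      by (simp add: omega0_eq_inner inner_sum_left)
    also have "\<dots> = - ?D (\<Sum>e\<in>Basis. (V \<bullet> e) *\<^sub>R e)"
      by (simp add: linear_sum[OF lin] linear_cmul[OF lin] inner_commute mult.commute)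
    finally show ?thesis by (simp only: euclidean_representation)
  qed
  then show ?thesis using ham_field_eqI[of X F t x] by simp
qed

text \<open>
  The map \<open>g\<close> extends the flow to an open neighbourhood \<open>W\<close> of \<open>M \<times> [0,1]\<close>, as smoothness on that slab
  demands. Derivatives of the flow are taken from \<open>g\<close>: in this way they are two-sided also at times
  0 and 1, and mixed derivatives may be exchanged on the whole slab.
\<close>

locale hamiltonian_flow =
  fixes F :: "'n::finite phase \<times> real \<Rightarrow> real" and \<phi> :: "real \<Rightarrow> 'n phase \<Rightarrow> 'n phase"
    and g :: "'n phase \<times> real \<Rightarrow> 'n phase" and W R
  assumes W: "open W" "UNIV \<times> {0..1} \<subseteq> W" and g_smooth: "\<And>k. Ck_on k g W"
    and g: "\<And>x t. t \<in> {0..1} \<Longrightarrow> g (x, t) = \<phi> t x"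
    and F_smooth_slice: "\<And>t k. t \<in> {0..1} \<Longrightarrow> Ck_on k (\<lambda>x. F (x, t)) UNIV"
    and F_continuous: "continuous_on (UNIV \<times> {0..1}) F"
    and dF_continuous: "\<And>v. continuous_on (UNIV \<times> {0..1}) (\<lambda>(x, t). frechet_derivative (\<lambda>q. F (q, t)) (at x) v)"
    and F_supp: "\<And>x t. t \<in> {0..1} \<Longrightarrow> R < norm x \<Longrightarrow> F (x, t) = 0"
    and \<phi>0: "\<phi> 0 = id"
    and ode: "\<And>x t. t \<in> {0..1} \<Longrightarrow>
      ((\<lambda>s. \<phi> s x) has_vector_derivative ham_field F t (\<phi> t x)) (at t within {0..1})"
begin

definition dx :: "real \<Rightarrow> 'n phase \<Rightarrow> 'n phase \<Rightarrow> 'n phase" where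
  "dx t x v = frechet_derivative g (at (x, t)) (v, 0)"

definition dt :: "real \<Rightarrow> 'n phase \<Rightarrow> 'n phase" where
  "dt t x = frechet_derivative g (at (x, t)) (0, 1)"

definition dxdt :: "real \<Rightarrow> 'n phase \<Rightarrow> 'n phase \<Rightarrow> 'n phase" where
  "dxdt t x v = frechet_derivative (\<lambda>z. frechet_derivative g (at z) (0, 1)) (at (x, t)) (v, 0)"

definition dF :: "real \<Rightarrow> 'n phase \<Rightarrow> 'n phase \<Rightarrow> real" where
  "dF t x v = frechet_derivative (\<lambda>q. F (q, t)) (at x) v"

lemma inW: "t \<in> {0..1} \<Longrightarrow> (x, t) \<in> W"
  by (rule subsetD[OF W(2)]) simp

lemma continuous_on_slab: "continuous_on W f \<Longrightarrow> continuous_on (UNIV \<times> {0..1}) f"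
  by (rule continuous_on_subset[OF _ W(2)])

lemma g_has_derivative: "z \<in> W \<Longrightarrow> (g has_derivative frechet_derivative g (at z)) (at z)"
  by (rule Ck_on_has_derivative[OF g_smooth])

lemma dg_smooth: "Ck_on k (\<lambda>z. frechet_derivative g (at z) u) W"
  by (rule Ck_on_frechet_derivative[OF g_smooth])

lemma dg_has_derivative: "z \<in> W \<Longrightarrow> ((\<lambda>z. frechet_derivative g (at z) u) has_derivative
    frechet_derivative (\<lambda>z. frechet_derivative g (at z) u) (at z)) (at z)"
  by (rule Ck_on_has_derivative[OF dg_smooth])

lemma \<phi>_has_derivative:
  assumes t: "t \<in> {0..1}" shows "(\<phi> t has_derivative dx t x) (at x)"
proof -
  have "(\<lambda>x. g (x, t)) = \<phi> t" using g[OF t] by blast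
  then show ?thesis
    using slice_x[OF g_has_derivative[OF inW[OF t, of x]]] unfolding dx_def[abs_def] by (simp only:)
qed

lemma dx_has_vector_derivative:
  assumes t: "t \<in> {0..1}"
  shows "((\<lambda>s. dx s x v) has_vector_derivative dxdt t x v) (at t within S)"
proof -
  have "dxdt t x v = frechet_derivative (\<lambda>z. frechet_derivative g (at z) (v, 0)) (at (x, t)) (0, 1)"
    unfolding dxdt_def by (rule symmetric_second_derivative[OF W(1) g_smooth inW[OF t]])
  then show ?thesis
    using slice_t[OF dg_has_derivative[OF inW[OF t, of x], of "(v, 0)"], of S] unfolding dx_def by (simp only:)
qed

lemma dt_has_derivative:
  assumes t: "t \<in> {0..1}" shows "(dt t has_derivative dxdt t x) (at x)"
  using slice_x[OF dg_has_derivative[OF inW[OF t, of x], of "(0, 1)"]] unfolding dt_def[abs_def] dxdt_def[abs_def] .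

lemma \<phi>_has_vector_derivative:
  assumes t: "t \<in> {0..1}"
  shows "((\<lambda>s. \<phi> s x) has_vector_derivative dt t x) (at t within {0..1})"
proof (rule has_vector_derivative_transform[OF t])
  show "((\<lambda>s. g (x, s)) has_vector_derivative dt t x) (at t within {0..1})"
    unfolding dt_def by (rule slice_t[OF g_has_derivative[OF inW[OF t]]])
qed (rule g[symmetric])

lemma dt_eq:
  assumes t: "t \<in> {0..1}" shows "dt t x = ham_field F t (\<phi> t x)"
proof (rule vector_derivative_unique_within_closed_interval[of 0 1 t "\<lambda>s. \<phi> s x"])
  show "((\<lambda>s. \<phi> s x) has_vector_derivative dt t x) (at t within cbox 0 1)"
    unfolding box_real by (rule \<phi>_has_vector_derivative[OF t])
  show "((\<lambda>s. \<phi> s x) has_vector_derivative ham_field F t (\<phi> t x)) (at t within cbox 0 1)"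
    unfolding box_real by (rule ode[OF t])
qed (use t in auto)

lemma F_has_derivative:
  assumes t: "t \<in> {0..1}" shows "((\<lambda>x. F (x, t)) has_derivative dF t x) (at x)"
  using Ck_on_has_derivative[OF F_smooth_slice[OF t] UNIV_I] unfolding dF_def[abs_def] .

lemma omega0_field:
  assumes t: "t \<in> {0..1}" shows "omega0 (ham_field F t x) v = - dF t x v"
  unfolding dF_def by (rule omega0_ham_field[OF differentiableI[OF F_has_derivative[OF t]]])

lemma omega0_dt:
  assumes t: "t \<in> {0..1}" shows "omega0 (dt t x) v = - dF t (\<phi> t x) v"
  unfolding dt_eq[OF t] by (rule omega0_field[OF t])

lemma dF_zero:
  assumes t: "t \<in> {0..1}" and x: "R < norm x" shows "dF t x v = 0"
  by (rule derivative_zero_outside[OF F_has_derivative[OF t] F_supp[OF t] x])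

lemma field_zero:
  assumes "t \<in> {0..1}" "R < norm x" shows "ham_field F t x = 0"
proof (rule omega0_nondegenerate)
  show "omega0 (ham_field F t x) v = omega0 0 v" for v
    unfolding omega0_field[OF assms(1)] dF_zero[OF assms] by (simp add: omega0_eq_inner)
qed

lemma \<phi>_continuous: "continuous_on {0..1} (\<lambda>s. \<phi> s x)"
  unfolding continuous_on_eq_continuous_within
  by (intro ballI has_vector_derivative_continuous[OF \<phi>_has_vector_derivative])

text \<open>
  Among the times at which the trajectory of \<open>x\<close> sits at \<open>x\<close>, each has a neighbourhood in which the
  trajectory stays where the field vanishes and is constant there. So the set of these times is open
  as well as closed, and it contains 0.
\<close>

lemma \<phi>_outside:
  assumes x: "R < norm x" and t: "t \<in> {0..1}"
  shows "\<phi> t x = x"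
proof -
  have lim: "((\<lambda>s. \<phi> s x) \<longlongrightarrow> \<phi> s x) (at s within {0..1})" if "s \<in> {0..1}" for s
    using \<phi>_continuous that by (simp add: continuous_on_def)
  have local: "\<forall>\<^sub>F r in at s within {0..1}. (\<phi> s x = x) = (\<phi> r x = x)" if s: "s \<in> {0..1}" for s
  proof (cases "\<phi> s x = x")
    case False
    then have "\<forall>\<^sub>F r in at s within {0..1}. \<phi> r x \<noteq> x"
      by (rule tendsto_imp_eventually_ne[OF lim[OF s]])
    then show ?thesis using False by simp
  next
    case True
    then have "R < norm (\<phi> s x)" using x by simp
    then have "\<forall>\<^sub>F r in at s within {0..1}. R < norm (\<phi> r x)"
      by (rule order_tendstoD(1)[OF tendsto_norm[OF lim[OF s]]])
    then obtain e where "e > 0" and "\<forall>r\<in>{0..1}. r \<noteq> s \<and> dist r s < e \<longrightarrow> R < norm (\<phi> r x)"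
      unfolding eventually_at by blast
    then have e: "R < norm (\<phi> r x)" if "r \<in> {0..1}" "dist r s < e" for r
      using that \<open>R < norm (\<phi> s x)\<close> by (cases "r = s") auto
    let ?C = "{0..1} \<inter> ball s e"
    have d: "((\<lambda>s. \<phi> s x) has_vector_derivative 0) (at r within ?C)" if "r \<in> ?C" for r
    proof -
      have r: "r \<in> {0..1}" "dist r s < e" using that by (auto simp: dist_commute)
      have "((\<lambda>s. \<phi> s x) has_vector_derivative 0) (at r within {0..1})"
        using ode[OF r(1), of x] field_zero[OF r(1) e[OF r]] by simp
      then show ?thesis by (rule has_vector_derivative_within_subset) auto
    qed
    have "convex ?C" by (intro convex_Int) auto
    then obtain c where c: "\<And>r. r \<in> ?C \<Longrightarrow> \<phi> r x = c"
      using has_vector_derivative_zero_constant[OF _ d] by blast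
    have "s \<in> ?C" using s \<open>e > 0\<close> by simp
    have "\<phi> r x = x" if "r \<in> {0..1}" "dist r s < e" for r
    proof -
      have "r \<in> ?C" using that by (auto simp: dist_commute)
      then show ?thesis using c[OF \<open>s \<in> ?C\<close>] c[of r] True by simp
    qed
    then show ?thesis
      unfolding eventually_at using \<open>e > 0\<close> True by blast
  qed
  have "(\<phi> 0 x = x) = (\<phi> t x = x)"
    by (rule connected_local_const[of "{0..1}" 0 t "\<lambda>s. \<phi> s x = x"]) (use t local in auto)
  then show ?thesis using \<phi>0 by simp
qed

lemma \<phi>_smooth:
  assumes "t \<in> {0..1}" shows "Ck_on k (\<phi> t) UNIV"
proof -
  have "Ck_on k (\<lambda>x. g (x, t)) UNIV"
  proof (rule Ck_on_compose[OF open_UNIV W(1) _ _ g_smooth])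
    show "range (\<lambda>x. (x, t)) \<subseteq> W" using inW[OF assms] by blast
    show "Ck_on k (\<lambda>x. (x, t)) UNIV"
      by (rule Ck_on_Pair[OF open_UNIV Ck_on_bounded_linear[OF open_UNIV bounded_linear_ident] Ck_on_const[OF open_UNIV]])
  qed
  then show ?thesis by (simp only: g[OF assms])
qed

lemma dx_smooth:
  assumes "t \<in> {0..1}" shows "Ck_on k (\<lambda>x. dx t x v) UNIV"
proof -
  have "frechet_derivative (\<phi> t) (at x) = dx t x" for x
    by (rule frechet_derivative_at[OF \<phi>_has_derivative[OF assms], symmetric])
  then show ?thesis
    using Ck_on_frechet_derivative[OF \<phi>_smooth[OF assms, of "Suc k"], of v] by (simp only:)
qed

lemma dx_0: "dx 0 x v = v"
proof -
  have "(\<phi> 0 has_derivative dx 0 x) (at x)" by (rule \<phi>_has_derivative) simp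
  moreover have "(\<phi> 0 has_derivative (\<lambda>v. v)) (at x)" unfolding \<phi>0 id_def by simp
  ultimately have "dx 0 x = (\<lambda>v. v)" by (rule has_derivative_unique)
  then show ?thesis by (simp only:)
qed

lemma continuous_slab:
  "continuous_on (UNIV \<times> {0..1}) (\<lambda>(x, t). \<phi> t x)"
  "continuous_on (UNIV \<times> {0..1}) (\<lambda>(x, t). dx t x v)"
  "continuous_on (UNIV \<times> {0..1}) (\<lambda>(x, t). dt t x)"
  "continuous_on (UNIV \<times> {0..1}) (\<lambda>(x, t). dxdt t x v)"
  "continuous_on (UNIV \<times> {0..1}) (\<lambda>(x, t). dF t x v)"
proof -
  show "continuous_on (UNIV \<times> {0..1}) (\<lambda>(x, t). \<phi> t x)"
    using continuous_on_slab[OF Ck_on_continuous[OF g_smooth]] by (rule continuous_on_eq) (auto simp: g)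
  show "continuous_on (UNIV \<times> {0..1}) (\<lambda>(x, t). dx t x v)"
    unfolding dx_def using continuous_on_slab[OF Ck_on_continuous[OF dg_smooth]]
    by (simp add: case_prod_unfold)
  show "continuous_on (UNIV \<times> {0..1}) (\<lambda>(x, t). dt t x)"
    unfolding dt_def using continuous_on_slab[OF Ck_on_continuous[OF dg_smooth]]
    by (simp add: case_prod_unfold)
  show "continuous_on (UNIV \<times> {0..1}) (\<lambda>(x, t). dxdt t x v)"
    unfolding dxdt_def using continuous_on_slab[OF Ck_on_continuous[OF Ck_on_frechet_derivative[OF dg_smooth]]]
    by (simp add: case_prod_unfold)
  show "continuous_on (UNIV \<times> {0..1}) (\<lambda>(x, t). dF t x v)"
    unfolding dF_def by (rule dF_continuous)
qed

lemma continuous_slab_compose: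
  assumes "continuous_on (UNIV \<times> {0..1}) (\<lambda>(x, t). h t x)" "continuous_on S p" "continuous_on S q" "q ` S \<subseteq> {0..1}"
  shows "continuous_on S (\<lambda>z. h (q z) (p z))"
proof -
  have "continuous_on S (\<lambda>z. (\<lambda>(x, t). h t x) (p z, q z))"
    by (rule continuous_on_compose2[OF assms(1)]) (use assms in \<open>auto intro!: continuous_intros\<close>)
  then show ?thesis by simp
qed

end

context hamiltonian_flow
begin

text \<open>
  The function \<open>\<lambda>(X\<^sub>t) - F\<^sub>t\<close>, pulled back by \<open>\<phi>\<^sub>t\<close>. By Cartan's formula its differential is the time
  derivative of \<open>\<phi>\<^sub>t\<^sup>*\<lambda>\<close>.
\<close>

definition action_density :: "real \<Rightarrow> 'n phase \<Rightarrow> real" where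
  "action_density t x = 1/2 * omega0 (\<phi> t x) (dt t x) - F (\<phi> t x, t)"

definition action :: "real \<Rightarrow> 'n phase \<Rightarrow> real" where
  "action t x = integral {0..t} (\<lambda>s. action_density s x)"

text \<open>
  The one-form \<open>\<phi>\<^sub>t\<^sup>*\<lambda> - \<lambda>\<close>.
\<close>

definition liouville_defect :: "real \<Rightarrow> 'n phase \<Rightarrow> 'n phase \<Rightarrow> real" where
  "liouville_defect t x v = 1/2 * omega0 (\<phi> t x) (dx t x v) - 1/2 * omega0 x v"

text \<open>
  The derivative of the previous one-form with respect to \<open>t\<close>.
\<close>

definition dt_defect :: "real \<Rightarrow> 'n phase \<Rightarrow> 'n phase \<Rightarrow> real" where
  "dt_defect t x v = 1/2 * (omega0 (\<phi> t x) (dxdt t x v) + omega0 (dt t x) (dx t x v))"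

lemma continuous_on_omega0 [continuous_intros]:
  "continuous_on S a \<Longrightarrow> continuous_on S b \<Longrightarrow> continuous_on S (\<lambda>z. omega0 (a z :: 'n phase) (b z))"
  by (rule bounded_bilinear.continuous_on[OF bounded_bilinear_omega0])

lemma continuous_action_density:
  "continuous_on (UNIV \<times> {0..1}) (\<lambda>(x, t). action_density t x)"
proof -
  have "continuous_on (UNIV \<times> {0..1}) (\<lambda>z. F ((\<lambda>(x, t). \<phi> t x) z, snd z))"
    by (rule continuous_on_compose2[OF F_continuous])
      (auto intro!: continuous_on_Pair[OF continuous_slab(1)] continuous_intros)
  then show ?thesis
    unfolding action_density_def case_prod_beta
    by (intro continuous_intros continuous_slab[unfolded case_prod_beta]) (simp add: case_prod_beta)
qed

lemma continuous_dt_defect: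
  "continuous_on (UNIV \<times> {0..1}) (\<lambda>(x, t). dt_defect t x v)"
  unfolding dt_defect_def case_prod_beta
  by (intro continuous_intros continuous_slab[unfolded case_prod_beta])

text \<open>
  Differentiating \<open>\<lambda>(X\<^sub>t)\<close> produces the term \<open>omega0 (D\<phi> v) X / 2\<close>, and differentiating \<open>- F\<^sub>t\<close> produces
  \<open>omega0 X (D\<phi> v)\<close> by definition of the field; together they give \<open>omega0 X (D\<phi> v) / 2\<close>, the second
  summand of \<open>dt_defect\<close>.
\<close>

lemma action_density_has_derivative:
  assumes t: "t \<in> {0..1}"
  shows "(action_density t has_derivative dt_defect t x) (at x)"
proof -
  have 1: "((\<lambda>x. omega0 (\<phi> t x) (dt t x)) has_derivative
      (\<lambda>v. omega0 (\<phi> t x) (dxdt t x v) + omega0 (dx t x v) (dt t x))) (at x)"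
    by (rule bounded_bilinear.FDERIV[OF bounded_bilinear_omega0 \<phi>_has_derivative[OF t] dt_has_derivative[OF t]])
  have 2: "((\<lambda>x. F (\<phi> t x, t)) has_derivative (\<lambda>v. dF t (\<phi> t x) (dx t x v))) (at x)"
    by (rule has_derivative_compose[OF \<phi>_has_derivative[OF t] F_has_derivative[OF t]])
  have eq: "1/2 * (omega0 (\<phi> t x) (dxdt t x v) + omega0 (dx t x v) (dt t x)) - dF t (\<phi> t x) (dx t x v) = dt_defect t x v" for v
    using omega0_dt[OF t, of x "dx t x v"] omega0_skew[of "dx t x v" "dt t x"] by (simp add: dt_defect_def)
  show ?thesis
    using has_derivative_diff[OF has_derivative_mult_right[OF 1, of "1/2"] 2] unfolding action_density_def[abs_def] eq .
qed

lemma integral_dt_defect: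
  assumes t: "t \<in> {0..1}"
  shows "integral {0..t} (\<lambda>s. dt_defect s x v) = liouville_defect t x v"
proof -
  have d: "((\<lambda>s. 1/2 * omega0 (\<phi> s x) (dx s x v)) has_vector_derivative dt_defect s x v) (at s within {0..t})"
    if s: "s \<in> {0..t}" for s
  proof -
    have s': "s \<in> {0..1}" using s t by auto
    have "((\<lambda>s. \<phi> s x) has_vector_derivative dt s x) (at s within {0..t})"
      by (rule has_vector_derivative_within_subset[OF \<phi>_has_vector_derivative[OF s']]) (use t in auto)
    from bounded_bilinear.has_vector_derivative[OF bounded_bilinear_omega0 this dx_has_vector_derivative[OF s']]
    have "((\<lambda>s. omega0 (\<phi> s x) (dx s x v)) has_vector_derivative
      omega0 (\<phi> s x) (dxdt s x v) + omega0 (dt s x) (dx s x v)) (at s within {0..t})" .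
    from has_vector_derivative_mult_right[OF this, of "1/2"]
    show ?thesis unfolding dt_defect_def .
  qed
  have "((\<lambda>s. dt_defect s x v) has_integral 1/2 * omega0 (\<phi> t x) (dx t x v) - 1/2 * omega0 (\<phi> 0 x) (dx 0 x v)) {0..t}"
    by (rule fundamental_theorem_of_calculus[OF _ d]) (use t in auto)
  then show ?thesis by (simp add: integral_unique liouville_defect_def \<phi>0 dx_0)
qed

lemma action_has_derivative:
  assumes t: "t \<in> {0..1}"
  shows "(action t has_derivative liouville_defect t x) (at x)"
proof -
  let ?B = "\<lambda>x s. Blinfun (dt_defect s x)"
  have in01: "s \<in> {0..1}" if "s \<in> cbox 0 t" for s using that t by auto
  have B: "blinfun_apply (?B x s) = dt_defect s x" if "s \<in> cbox 0 t" for x s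
    by (rule bounded_linear_Blinfun_apply[OF has_derivative_bounded_linear[OF action_density_has_derivative[OF in01[OF that]]]])
  have sub: "UNIV \<times> cbox 0 t \<subseteq> UNIV \<times> {0..1}" using in01 by blast
  have cB: "continuous_on (UNIV \<times> cbox 0 t) (\<lambda>(x, s). ?B x s)"
  proof (rule continuous_on_blinfun_componentwise)
    fix i :: "'n phase"
    have "continuous_on (UNIV \<times> cbox 0 t) (\<lambda>(x, s). dt_defect s x i)"
      by (rule continuous_on_subset[OF continuous_dt_defect sub])
    then show "continuous_on (UNIV \<times> cbox 0 t) (\<lambda>z. blinfun_apply (case z of (x, s) \<Rightarrow> ?B x s) i)"
      by (rule continuous_on_eq) (use B in auto)
  qed
  have ci: "continuous_on (cbox 0 t) (\<lambda>s. h (x, s))"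
    if "continuous_on (UNIV \<times> cbox 0 t) h" for h :: "'n phase \<times> real \<Rightarrow> 'b::real_normed_vector" and x
    by (rule continuous_on_compose2[OF that]) (auto intro!: continuous_intros)
  have "((\<lambda>x. integral (cbox 0 t) (\<lambda>s. action_density s x)) has_derivative
      blinfun_apply (integral (cbox 0 t) (?B x))) (at x within UNIV)"
  proof (rule leibniz_rule[OF _ _ cB])
    show "((\<lambda>x. action_density s x) has_derivative blinfun_apply (?B y s)) (at y within UNIV)"
      if "s \<in> cbox 0 t" for y s
      unfolding B[OF that] using action_density_has_derivative[OF in01[OF that]] by simp
    show "(\<lambda>s. action_density s y) integrable_on cbox 0 t" for y
      using ci[OF continuous_on_subset[OF continuous_action_density sub], of y]
      by (intro integrable_continuous) simp
  qed auto
  moreover have "blinfun_apply (integral (cbox 0 t) (?B x)) = liouville_defect t x"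
  proof
    fix v
    have "?B x integrable_on cbox 0 t"
      using ci[OF cB, of x] by (intro integrable_continuous) simp
    then have "blinfun_apply (integral (cbox 0 t) (?B x)) v = integral (cbox 0 t) (\<lambda>s. blinfun_apply (?B x s) v)"
      by (rule blinfun_apply_integral)
    also have "\<dots> = integral (cbox 0 t) (\<lambda>s. dt_defect s x v)"
      by (rule integral_cong) (simp only: B)
    finally show "blinfun_apply (integral (cbox 0 t) (?B x)) v = liouville_defect t x v"
      using integral_dt_defect[OF t] by simp
  qed
  ultimately show ?thesis
    unfolding action_def[abs_def] by (simp only: box_real)
qed

lemma action_density_outside:
  assumes "t \<in> {0..1}" "R < norm x" shows "action_density t x = 0"
proof -
  have "dt t x = 0"
    using dt_eq[OF assms(1)] field_zero[OF assms] \<phi>_outside[OF assms(2,1)] by simp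
  then show ?thesis
    unfolding action_density_def \<phi>_outside[OF assms(2,1)] F_supp[OF assms]
    by (simp add: bounded_bilinear.zero_right[OF bounded_bilinear_omega0])
qed

lemma action_outside:
  assumes "t \<in> {0..1}" "R < norm x" shows "action t x = 0"
proof -
  have "integral {0..t} (\<lambda>s. action_density s x) = integral {0..t} (\<lambda>s. 0)"
    by (rule integral_cong) (use assms action_density_outside in auto)
  then show ?thesis by (simp add: action_def)
qed

lemma smooth_omega0:
  "Ck_on k a UNIV \<Longrightarrow> Ck_on k b UNIV \<Longrightarrow> Ck_on k (\<lambda>x. omega0 (a x :: 'n phase) (b x)) UNIV"
  by (rule Ck_on_bilinear[OF bounded_bilinear_omega0 open_UNIV])

lemma liouville_defect_smooth:
  assumes t: "t \<in> {0..1}" shows "Ck_on k (\<lambda>x. liouville_defect t x v) UNIV"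
proof -
  have "Ck_on k (\<lambda>x. 1/2 * omega0 (\<phi> t x) (dx t x v) + (-1/2) * omega0 x v) UNIV"
    by (intro Ck_on_add[OF open_UNIV] Ck_on_bounded_linear_compose[OF bounded_linear_mult_right open_UNIV]
      smooth_omega0 \<phi>_smooth[OF t] dx_smooth[OF t] Ck_on_const[OF open_UNIV]
      Ck_on_bounded_linear[OF open_UNIV bounded_linear_ident])
  then show ?thesis by (simp add: liouville_defect_def)
qed

lemma action_smooth:
  assumes t: "t \<in> {0..1}" shows "Ck_on k (action t) UNIV"
  by (rule Ck_on_SucD[OF Ck_on_Suc[OF open_UNIV action_has_derivative[OF t] liouville_defect_smooth[OF t]]])

text \<open>
  The one-form \<open>\<phi>\<^sub>t\<^sup>*\<lambda> - \<lambda>\<close> is exact by the previous lemmas, so its exterior derivative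
  \<open>\<phi>\<^sub>t\<^sup>*omega0 - omega0\<close> vanishes. In coordinates: its derivative is symmetric, and so is the second
  derivative of \<open>\<phi>\<^sub>t\<close>.
\<close>

lemma dx_symplectic:
  assumes t: "t \<in> {0..1}"
  shows "omega0 (dx t x v) (dx t x w) = omega0 v w"
proof -
  let ?D = "\<lambda>v w. frechet_derivative (\<lambda>x. dx t x v) (at x) w"
  have d\<phi>: "frechet_derivative (\<phi> t) (at x) = dx t x" for x
    by (rule frechet_derivative_at[OF \<phi>_has_derivative[OF t], symmetric])
  have D_sym: "?D v w = ?D w v" for v w
    using symmetric_second_derivative[OF open_UNIV \<phi>_smooth[OF t] UNIV_I, of v x w] unfolding d\<phi> .
  have dA: "frechet_derivative (action t) (at x) = liouville_defect t x" for x
    by (rule frechet_derivative_at[OF action_has_derivative[OF t], symmetric])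
  have sym: "frechet_derivative (\<lambda>x. liouville_defect t x v) (at x) w =
      frechet_derivative (\<lambda>x. liouville_defect t x w) (at x) v"
    using symmetric_second_derivative[OF open_UNIV action_smooth[OF t] UNIV_I, of v x w] unfolding dA .
  have D: "frechet_derivative (\<lambda>x. liouville_defect t x v) (at x) w =
    1/2 * (omega0 (\<phi> t x) (?D v w) + omega0 (dx t x w) (dx t x v)) - 1/2 * omega0 w v" for v w
  proof -
    have "((\<lambda>x. dx t x v) has_derivative ?D v) (at x)"
      by (rule Ck_on_has_derivative[OF dx_smooth[OF t] UNIV_I])
    from bounded_bilinear.FDERIV[OF bounded_bilinear_omega0 \<phi>_has_derivative[OF t] this]
    have 1: "((\<lambda>x. omega0 (\<phi> t x) (dx t x v)) has_derivative
      (\<lambda>w. omega0 (\<phi> t x) (?D v w) + omega0 (dx t x w) (dx t x v))) (at x)" .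
    have 2: "((\<lambda>x. omega0 x v) has_derivative (\<lambda>w. omega0 w v)) (at x)"
      by (rule bounded_linear_imp_has_derivative[OF bounded_bilinear.bounded_linear_left[OF bounded_bilinear_omega0]])
    have "((\<lambda>x. liouville_defect t x v) has_derivative (\<lambda>w. 1/2 * (omega0 (\<phi> t x) (?D v w) + omega0 (dx t x w) (dx t x v))
        - 1/2 * omega0 w v)) (at x)"
      unfolding liouville_defect_def
      by (rule has_derivative_diff[OF has_derivative_mult_right[OF 1] has_derivative_mult_right[OF 2]])
    from fun_cong[OF frechet_derivative_at[OF this, symmetric]] show ?thesis .
  qed
  have cancel: "S = o'" if "1/2 * (P + S') - 1/2 * o'' = 1/2 * (P + S) - 1/2 * o'" "S' = - S" "o'' = - o'"
    for P S S' o' o'' :: real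
    using that by (simp add: field_simps)
  show ?thesis
    by (rule cancel[OF sym[unfolded D D_sym[of w v]] omega0_skew omega0_skew])
qed

lemma dx_surj:
  assumes t: "t \<in> {0..1}" shows "surj (dx t x)"
proof (rule linear_injective_imp_surjective)
  show lin: "linear (dx t x)" by (rule has_derivative_linear[OF \<phi>_has_derivative[OF t]])
  show "inj (dx t x)"
    unfolding linear_injective_0[OF lin]
  proof (intro allI impI)
    fix v assume v: "dx t x v = 0"
    show "v = 0"
    proof (rule omega0_nondegenerate)
      show "omega0 v w = omega0 0 w" for w
        using dx_symplectic[OF t, of x v w] unfolding v bounded_bilinear.zero_left[OF bounded_bilinear_omega0] by simp
    qed
  qed
qed auto

text \<open>
  Liouville's theorem on the preservation of volume, tested against smooth functions. Since \<open>D\<phi>\<^sub>t\<close> is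
  symplectic, the time derivative of \<open>f \<circ> \<phi>\<^sub>t\<close> is the Poisson bracket of \<open>f \<circ> \<phi>\<^sub>t\<close> and \<open>F\<^sub>t \<circ> \<phi>\<^sub>t\<close>, and
  this integrates to 0.
\<close>

lemma integral_compose_flow:
  assumes f: "\<And>k. Ck_on k f UNIV" "bounded_support f" and t: "t \<in> {0..1}"
  shows "integral UNIV (\<lambda>x. f (\<phi> t x) :: real) = integral UNIV f"
proof -
  let ?Df = "\<lambda>y v. frechet_derivative f (at y) v"
  obtain R' where R': "\<And>x. R' < norm x \<Longrightarrow> f x = 0" using f(2) by (auto simp: bounded_support_def)
  define M where "M = max R R'"
  have out: "f (\<phi> s x) = 0" if "M < norm x" "s \<in> {0..1}" for s x
    using \<phi>_outside[of x s] R'[of x] that by (simp add: M_def)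
  obtain b where b: "cball (0::'n phase) M \<subseteq> cbox (-b) b"
    using bounded_subset_cbox_symmetric[OF bounded_cball] by blast
  have b': "M < norm x" if "x \<notin> cbox (-b) b" for x
    using b that by (meson mem_cball_0 not_less subsetD)
  have df: "(f has_derivative ?Df y) (at y)" for y
    by (rule Ck_on_has_derivative[OF f(1) UNIV_I])
  have bs: "bounded_support (\<lambda>x. f (\<phi> s x))" if "s \<in> {0..1}" for s
    unfolding bounded_support_def by (intro exI[of _ M] allI impI out that)
  have dfs: "((\<lambda>x. f (\<phi> s x)) has_derivative (\<lambda>v. ?Df (\<phi> s x) (dx s x v))) (at x)" if "s \<in> {0..1}" for s x
    by (rule has_derivative_compose[OF \<phi>_has_derivative[OF that] df])
  have zero: "integral UNIV (\<lambda>x. ?Df (\<phi> s x) (dt s x)) = 0" if s: "s \<in> {0..1}" for s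
  proof -
    let ?a = "\<lambda>x. f (\<phi> s x)" and ?b = "\<lambda>x. F (\<phi> s x, s)"
    have a: "Ck_on k ?a UNIV" for k
      by (rule Ck_on_compose[OF open_UNIV open_UNIV _ \<phi>_smooth[OF s] f(1)]) simp
    have b: "Ck_on k ?b UNIV" for k
      by (rule Ck_on_compose[OF open_UNIV open_UNIV _ \<phi>_smooth[OF s] F_smooth_slice[OF s]]) simp
    have db: "(?b has_derivative (\<lambda>v. dF s (\<phi> s x) (dx s x v))) (at x)" for x
      by (rule has_derivative_compose[OF \<phi>_has_derivative[OF s] F_has_derivative[OF s]])
    \<comment> \<open>the Hamiltonian field of the function \<open>F\<^sub>s \<circ> \<phi>\<^sub>s\<close>, which \<open>D\<phi>\<^sub>s\<close> maps to \<open>X\<^sub>s\<close>\<close>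
    define w where "w x = ham_field (\<lambda>(q, r). F (\<phi> s q, s)) 0 x" for x
    have w: "omega0 (w x) v = - frechet_derivative ?b (at x) v" for x v
      unfolding w_def using omega0_ham_field[of "\<lambda>(q, r). F (\<phi> s q, s)" 0 x v] differentiableI[OF db] by simp
    have dxw: "dx s x (w x) = dt s x" for x
    proof (rule omega0_nondegenerate)
      fix V
      obtain v where V: "V = dx s x v" by (rule surjE[OF dx_surj[OF s]])
      show "omega0 (dx s x (w x)) V = omega0 (dt s x) V"
        unfolding V dx_symplectic[OF s] w frechet_derivative_at[OF db, symmetric] omega0_dt[OF s] ..
    qed
    have "integral UNIV (\<lambda>x. frechet_derivative ?a (at x) (w x)) = 0"
      by (rule integral_poisson_bracket[OF a bs[OF s] b w])
    then show ?thesis unfolding frechet_derivative_at[OF dfs[OF s], symmetric] dxw .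
  qed
  have dfout: "?Df (\<phi> s x) (dt s x) = 0" if s: "s \<in> {0..1}" and x: "M < norm x" for s x
  proof -
    obtain v where v: "dt s x = dx s x v" by (rule surjE[OF dx_surj[OF s]])
    show ?thesis
      unfolding v by (rule derivative_zero_outside[OF dfs[OF s] out[OF _ s] x])
  qed
  have cont: "continuous_on ({0..1} \<times> cbox (-b) b) (\<lambda>(s, x). ?Df (\<phi> s x) (dt s x))"
  proof -
    have "?Df (\<phi> s x) (dt s x) = (\<Sum>e\<in>Basis. (dt s x \<bullet> e) * ?Df (\<phi> s x) e)" for s x
    proof -
      have lin: "linear (?Df (\<phi> s x))" by (rule has_derivative_linear[OF df])
      have "?Df (\<phi> s x) (dt s x) = ?Df (\<phi> s x) (\<Sum>e\<in>Basis. (dt s x \<bullet> e) *\<^sub>R e)"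
        by (simp only: euclidean_representation)
      then show ?thesis by (simp only: linear_sum[OF lin] linear_cmul[OF lin] real_scaleR_def)
    qed
    moreover have "continuous_on ({0..1} \<times> cbox (-b) b) (\<lambda>z. ?Df (\<phi> (fst z) (snd z)) e)" for e
      by (rule continuous_on_compose2[OF Ck_on_continuous[OF Ck_on_frechet_derivative[OF f(1)]]
          continuous_slab_compose[OF continuous_slab(1)]]) (auto intro!: continuous_intros)
    moreover have "continuous_on ({0..1} \<times> cbox (-b) b) (\<lambda>z. dt (fst z) (snd z))"
      by (rule continuous_slab_compose[OF continuous_slab(3)]) (auto intro!: continuous_intros)
    ultimately show ?thesis
      unfolding case_prod_beta by (simp only:) (intro continuous_intros)
  qed
  have "((\<lambda>s. integral (cbox (-b) b) (\<lambda>x. f (\<phi> s x))) has_vector_derivative 0) (at s within {0..1})"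
    if s: "s \<in> {0..1}" for s
  proof -
    have "((\<lambda>s. integral (cbox (-b) b) (\<lambda>x. f (\<phi> s x))) has_vector_derivative
        integral (cbox (-b) b) (\<lambda>x. ?Df (\<phi> s x) (dt s x))) (at s within {0..1})"
    proof (rule leibniz_rule_vector_derivative[OF _ _ cont s])
      fix s :: real and x assume s: "s \<in> {0..1}"
      from \<phi>_has_vector_derivative[OF s, of x, unfolded has_vector_derivative_def]
      have "((\<lambda>s. f (\<phi> s x)) has_derivative (\<lambda>h. ?Df (\<phi> s x) (h *\<^sub>R dt s x))) (at s within {0..1})"
        by (rule has_derivative_compose[OF _ df])
      then show "((\<lambda>s. f (\<phi> s x)) has_vector_derivative ?Df (\<phi> s x) (dt s x)) (at s within {0..1})"
        unfolding has_vector_derivative_def linear_cmul[OF has_derivative_linear[OF df]] .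
    next
      fix s :: real assume s: "s \<in> {0..1}"
      show "(\<lambda>x. f (\<phi> s x)) integrable_on cbox (-b) b"
        by (rule integrable_continuous)
          (rule continuous_on_compose2[OF Ck_on_continuous[OF f(1)[of 0]] continuous_on_subset[OF Ck_on_continuous[OF \<phi>_smooth[OF s, of 0]]]], auto)
    qed simp
    also have "integral (cbox (-b) b) (\<lambda>x. ?Df (\<phi> s x) (dt s x)) = integral UNIV (\<lambda>x. ?Df (\<phi> s x) (dt s x))"
      by (rule integral_UNIV_eq_cbox[symmetric]) (rule dfout[OF s b'])
    finally show ?thesis unfolding zero[OF s] .
  qed
  then obtain c where c: "\<And>s. s \<in> {0..1} \<Longrightarrow> integral (cbox (-b) b) (\<lambda>x. f (\<phi> s x)) = c"
    using has_vector_derivative_zero_constant[OF convex_real_interval(5)] by blast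
  have "integral UNIV (\<lambda>x. f (\<phi> s x)) = c" if "s \<in> {0..1}" for s
    unfolding c[OF that, symmetric] by (rule integral_UNIV_eq_cbox) (rule out[OF b' that])
  from this[OF t] this[of 0] show ?thesis by (simp add: \<phi>0)
qed

text \<open>
  Volume preservation removes \<open>\<phi>\<^sub>t\<close> from the integrand. What remains is \<open>\<lambda>(X\<^sub>t) - F\<^sub>t\<close>, and \<open>\<lambda>(X\<^sub>t)\<close> is half
  the derivative of \<open>F\<^sub>t\<close> along the position vector, which integrates to \<open>- n\<close> times the integral of
  \<open>F\<^sub>t\<close>.
\<close>

lemma integral_action_density:
  assumes t: "t \<in> {0..1}"
  shows "integral UNIV (action_density t) = - (real CARD('n) + 1) * integral UNIV (\<lambda>x. F (x, t))"
proof -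
  let ?F = "\<lambda>x. F (x, t)"
  let ?h = "\<lambda>x. 1/2 * dF t x x - F (x, t)"
  have h_eq: "action_density t x = ?h (\<phi> t x)" for x
    using omega0_skew[of "\<phi> t x" "dt t x"] omega0_dt[OF t, of x "\<phi> t x"] by (simp add: action_density_def)
  have dFs: "Ck_on k (\<lambda>x. dF t x v) UNIV" for k v
    unfolding dF_def by (rule Ck_on_frechet_derivative[OF F_smooth_slice[OF t]])
  have dF_sum: "dF t x x = (\<Sum>e\<in>Basis. (x \<bullet> e) * dF t x e)" for x
  proof -
    have lin: "linear (dF t x)" by (rule has_derivative_linear[OF F_has_derivative[OF t]])
    have "dF t x x = dF t x (\<Sum>e\<in>Basis. (x \<bullet> e) *\<^sub>R e)" by (simp only: euclidean_representation)
    then show ?thesis by (simp only: linear_sum[OF lin] linear_cmul[OF lin] real_scaleR_def)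
  qed
  have dFx: "Ck_on k (\<lambda>x. dF t x x) UNIV" for k
    unfolding dF_sum
    by (intro Ck_on_sum[OF open_UNIV] Ck_on_bilinear[OF bounded_bilinear_mult open_UNIV] dFs
      Ck_on_bounded_linear[OF open_UNIV bounded_linear_inner_left])
  have h: "Ck_on k ?h UNIV" for k
  proof -
    have "Ck_on k (\<lambda>x. 1/2 * dF t x x + (-1) * F (x, t)) UNIV"
      by (intro Ck_on_add[OF open_UNIV] Ck_on_bounded_linear_compose[OF bounded_linear_mult_right open_UNIV]
        dFx F_smooth_slice[OF t])
    then show ?thesis by simp
  qed
  have bs: "bounded_support ?F" "bounded_support (\<lambda>x. dF t x x)" "bounded_support ?h"
    unfolding bounded_support_def
    by (intro exI[of _ R] allI impI, simp add: F_supp[OF t] dF_zero[OF t])+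
  have "integral UNIV (action_density t) = integral UNIV ?h"
    using integral_compose_flow[OF h bs(3) t] by (simp add: h_eq[abs_def])
  also have "\<dots> = 1/2 * integral UNIV (\<lambda>x. dF t x x) - integral UNIV ?F"
  proof -
    have "(\<lambda>x. dF t x x) integrable_on UNIV" "?F integrable_on UNIV"
      by (rule integrable_bounded_support[OF Ck_on_continuous[OF dFx[of 0]] bs(2)]
        integrable_bounded_support[OF Ck_on_continuous[OF F_smooth_slice[OF t, of 0]] bs(1)])+
    then show ?thesis by (simp add: integral_diff integrable_on_mult_right)
  qed
  also have "integral UNIV (\<lambda>x. dF t x x) = - real DIM('n phase) * integral UNIV ?F"
    by (rule integral_euler_field[OF F_has_derivative[OF t] Ck_on_continuous[OF dFs[of 0]] bs(1)])
  finally show ?thesis by (simp add: algebra_simps)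
qed

lemma integral_action:
  "integral UNIV (action 1) = - (real CARD('n) + 1) * integral {0..1} (\<lambda>t. integral UNIV (\<lambda>x. F (x, t)))"
proof -
  obtain b where b: "cball (0::'n phase) R \<subseteq> cbox (-b) b"
    using bounded_subset_cbox_symmetric[OF bounded_cball] by blast
  have b': "R < norm x" if "x \<notin> cbox (-b) b" for x
    using b that by (meson mem_cball_0 not_less subsetD)
  have "integral UNIV (action 1) = integral (cbox (-b) b) (action 1)"
    by (rule integral_UNIV_eq_cbox) (rule action_outside[OF _ b'], auto)
  also have "\<dots> = integral (cbox (-b) b) (\<lambda>x. integral (cbox 0 1) (\<lambda>s. action_density s x))"
    unfolding action_def[abs_def] box_real ..
  also have "\<dots> = integral (cbox 0 1) (\<lambda>s. integral (cbox (-b) b) (\<lambda>x. action_density s x))"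
    by (rule integral_swap_continuous[OF continuous_on_subset[OF continuous_action_density]])
      (auto simp: cbox_Pair_eq)
  also have "\<dots> = integral (cbox 0 1) (\<lambda>t. - (real CARD('n) + 1) * integral UNIV (\<lambda>x. F (x, t)))"
  proof (rule integral_cong)
    fix s :: real assume "s \<in> cbox 0 1"
    then have s: "s \<in> {0..1}" by simp
    have "integral UNIV (action_density s) = integral (cbox (-b) b) (action_density s)"
      by (rule integral_UNIV_eq_cbox) (rule action_density_outside[OF s b'])
    then show "integral (cbox (-b) b) (\<lambda>x. action_density s x) = - (real CARD('n) + 1) * integral UNIV (\<lambda>x. F (x, s))"
      using integral_action_density[OF s] by simp
  qed
  finally show ?thesis by simp
qed

end

section \<open>The Calabi invariant\<close>

text \<open>
  The equation for the derivative says that \<open>A\<close> is a primitive of \<open>\<phi>\<^sup>*\<lambda> - \<lambda>\<close>; the integral of \<open>A\<close> is the Calabi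
  invariant of \<open>\<phi>\<close> up to normalisation. The last clause says that \<open>\<phi>\<close> preserves volume, in a weak form
  that is stable under composition and inversion.
\<close>

definition calabi_potential :: "('n::finite phase \<Rightarrow> 'n phase) \<Rightarrow> ('n phase \<Rightarrow> real) \<Rightarrow> bool" where
  "calabi_potential \<phi> A \<longleftrightarrow> diffeomorphism \<phi> \<and> (\<forall>k. Ck_on k A UNIV) \<and> bounded_support A \<and>
     (\<forall>x v. frechet_derivative A (at x) v =
        1/2 * omega0 (\<phi> x) (frechet_derivative \<phi> (at x) v) - 1/2 * omega0 x v) \<and>
     (\<forall>f. (\<forall>k. Ck_on k f UNIV) \<longrightarrow> bounded_support f \<longrightarrow>
        integral UNIV (\<lambda>x. f (\<phi> x)) = (integral UNIV f :: real))"

lemma calabi_potentialD: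
  assumes "calabi_potential \<phi> A"
  shows "diffeomorphism \<phi>" "Ck_on k A UNIV" "bounded_support A"
    "frechet_derivative A (at x) v = 1/2 * omega0 (\<phi> x) (frechet_derivative \<phi> (at x) v) - 1/2 * omega0 x v"
    "(\<And>k. Ck_on k f UNIV) \<Longrightarrow> bounded_support f \<Longrightarrow> integral UNIV (\<lambda>x. f (\<phi> x)) = (integral UNIV f :: real)"
proof -
  note c = assms[unfolded calabi_potential_def, THEN conjunct2]
  show "diffeomorphism \<phi>" by (rule assms[unfolded calabi_potential_def, THEN conjunct1])
  show "Ck_on k A UNIV" by (rule c[THEN conjunct1, THEN spec])
  show "bounded_support A" by (rule c[THEN conjunct2, THEN conjunct1])
  show "frechet_derivative A (at x) v = 1/2 * omega0 (\<phi> x) (frechet_derivative \<phi> (at x) v) - 1/2 * omega0 x v"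
    by (rule c[THEN conjunct2, THEN conjunct2, THEN conjunct1, THEN spec, THEN spec])
  show "integral UNIV (\<lambda>x. f (\<phi> x)) = integral UNIV f" if "\<And>k. Ck_on k f UNIV" "bounded_support f"
    by (rule c[THEN conjunct2, THEN conjunct2, THEN conjunct2, THEN spec, THEN mp, THEN mp, OF allI])
      (rule that)+
qed

lemma diffeomorphism_smooth:
  assumes "diffeomorphism \<phi>" shows "Ck_on k \<phi> UNIV" "Ck_on k (inv \<phi>) UNIV"
  using assms by (simp_all add: diffeomorphism_def smooth_on_UNIV)

lemma diffeomorphism_comp:
  assumes "diffeomorphism \<phi>" "diffeomorphism \<psi>"
  shows "diffeomorphism (\<phi> \<circ> \<psi>)"
proof -
  have b: "bij \<phi>" "bij \<psi>" using assms by (auto simp: diffeomorphism_def)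
  have "bij (\<phi> \<circ> \<psi>)" using b by (rule bij_comp[rotated])
  moreover have "Ck_on k (\<phi> \<circ> \<psi>) UNIV" for k
    unfolding comp_def by (rule smooth_compose[OF diffeomorphism_smooth(1)[OF assms(2)] diffeomorphism_smooth(1)[OF assms(1)]])
  moreover have "Ck_on k (inv (\<phi> \<circ> \<psi>)) UNIV" for k
    unfolding o_inv_distrib[OF b] unfolding comp_def
    by (rule smooth_compose[OF diffeomorphism_smooth(2)[OF assms(1)] diffeomorphism_smooth(2)[OF assms(2)]])
  ultimately show ?thesis by (simp add: diffeomorphism_def smooth_on_UNIV)
qed

lemma diffeomorphism_inv:
  assumes "diffeomorphism \<phi>" shows "diffeomorphism (inv \<phi>)"
  using assms by (simp add: diffeomorphism_def bij_imp_bij_inv inv_inv_eq)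

lemma bounded_support_compose:
  assumes "diffeomorphism \<phi>" "bounded_support f"
  shows "bounded_support (\<lambda>x. f (\<phi> x))"
proof -
  obtain R where R: "\<And>x. R < norm x \<Longrightarrow> f x = 0" using assms(2) by (auto simp: bounded_support_def)
  have b: "bij \<phi>" using assms(1) by (simp add: diffeomorphism_def)
  have "continuous_on UNIV (inv \<phi>)"
    by (rule Ck_on_continuous[OF diffeomorphism_smooth(2)[OF assms(1), of 0]])
  then have "bounded (inv \<phi> ` cball 0 R)"
    by (rule compact_imp_bounded[OF compact_continuous_image[OF continuous_on_subset[OF _ subset_UNIV] compact_cball]])
  then obtain B where B: "\<forall>x\<in>inv \<phi> ` cball 0 R. norm x \<le> B"
    unfolding bounded_iff by (rule exE)
  have "f (\<phi> x) = 0" if "B < norm x" for x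
  proof (rule R, rule ccontr)
    assume "\<not> R < norm (\<phi> x)"
    then have "inv \<phi> (\<phi> x) \<in> inv \<phi> ` cball 0 R" by (intro imageI) auto
    then have "x \<in> inv \<phi> ` cball 0 R" by (simp only: inv_f_f[OF bij_is_inj[OF b]])
    then show False using bspec[OF B] that by force
  qed
  then show ?thesis unfolding bounded_support_def by blast
qed

lemma bounded_support_add:
  fixes f g :: "'a::real_normed_vector \<Rightarrow> real"
  assumes "bounded_support f" "bounded_support g" shows "bounded_support (\<lambda>x. f x + g x)"
proof -
  obtain R R' where "\<And>x. R < norm x \<Longrightarrow> f x = 0" "\<And>x. R' < norm x \<Longrightarrow> g x = 0"
    using assms by (auto simp: bounded_support_def)
  then show ?thesis unfolding bounded_support_def by (intro exI[of _ "max R R'"]) auto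
qed

text \<open>
  The cocycle identity \<open>(\<phi> \<circ> \<psi>)\<^sup>*\<lambda> - \<lambda> = \<psi>\<^sup>*(\<phi>\<^sup>*\<lambda> - \<lambda>) + (\<psi>\<^sup>*\<lambda> - \<lambda>)\<close>. Because \<open>\<psi>\<close> preserves volume, the
  pullback of \<open>A\<close> has the same integral as \<open>A\<close>.
\<close>

lemma calabi_potential_comp:
  assumes \<phi>: "calabi_potential \<phi> A" and \<psi>: "calabi_potential \<psi> B"
  shows "calabi_potential (\<phi> \<circ> \<psi>) (\<lambda>x. A (\<psi> x) + B x)"
    and "integral UNIV (\<lambda>x. A (\<psi> x) + B x) = integral UNIV A + integral UNIV B"
proof -
  note s = calabi_potentialD(2)[OF \<phi>] calabi_potentialD(2)[OF \<psi>]
    diffeomorphism_smooth(1)[OF calabi_potentialD(1)[OF \<phi>]] diffeomorphism_smooth(1)[OF calabi_potentialD(1)[OF \<psi>]]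
  note d = s[THEN smooth_has_derivative]
  have A\<psi>: "Ck_on k (\<lambda>x. A (\<psi> x)) UNIV" "bounded_support (\<lambda>x. A (\<psi> x))" for k
    by (rule smooth_compose[OF s(4) s(1)])
      (rule bounded_support_compose[OF calabi_potentialD(1)[OF \<psi>] calabi_potentialD(3)[OF \<phi>]])
  have sum: "Ck_on k (\<lambda>x. A (\<psi> x) + B x) UNIV" "bounded_support (\<lambda>x. A (\<psi> x) + B x)" for k
    by (rule Ck_on_add[OF open_UNIV A\<psi>(1) s(2)])
      (rule bounded_support_add[OF A\<psi>(2) calabi_potentialD(3)[OF \<psi>]])
  have "frechet_derivative (\<lambda>x. A (\<psi> x) + B x) (at x) v =
      1/2 * omega0 ((\<phi> \<circ> \<psi>) x) (frechet_derivative (\<phi> \<circ> \<psi>) (at x) v) - 1/2 * omega0 x v" for x v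
  proof -
    have 1: "frechet_derivative (\<lambda>x. A (\<psi> x) + B x) (at x) =
      (\<lambda>v. frechet_derivative A (at (\<psi> x)) (frechet_derivative \<psi> (at x) v) + frechet_derivative B (at x) v)"
      by (rule frechet_derivative_at[OF has_derivative_add[OF has_derivative_compose[OF d(4) d(1)] d(2)], symmetric])
    have 2: "frechet_derivative (\<phi> \<circ> \<psi>) (at x) =
      (\<lambda>v. frechet_derivative \<phi> (at (\<psi> x)) (frechet_derivative \<psi> (at x) v))"
      unfolding comp_def by (rule frechet_derivative_at[OF has_derivative_compose[OF d(4) d(3)], symmetric])
    show ?thesis
      unfolding 1 2 calabi_potentialD(4)[OF \<phi>] calabi_potentialD(4)[OF \<psi>] comp_apply by simp
  qed
  moreover have "integral UNIV (\<lambda>x. f ((\<phi> \<circ> \<psi>) x)) = integral UNIV f"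
    if f: "\<forall>k. Ck_on k f UNIV" "bounded_support f" for f :: "'a phase \<Rightarrow> real"
  proof -
    have "integral UNIV (\<lambda>x. (\<lambda>y. f (\<phi> y)) (\<psi> x)) = integral UNIV (\<lambda>y. f (\<phi> y))"
      by (rule calabi_potentialD(5)[OF \<psi> smooth_compose[OF s(3) f(1)[rule_format]]
        bounded_support_compose[OF calabi_potentialD(1)[OF \<phi>] f(2)]])
    also have "\<dots> = integral UNIV f"
      by (rule calabi_potentialD(5)[OF \<phi> f(1)[rule_format] f(2)])
    finally show ?thesis by simp
  qed
  ultimately show "calabi_potential (\<phi> \<circ> \<psi>) (\<lambda>x. A (\<psi> x) + B x)"
    unfolding calabi_potential_def
    using diffeomorphism_comp[OF calabi_potentialD(1)[OF \<phi>] calabi_potentialD(1)[OF \<psi>]] sum by blast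
  have "integral UNIV (\<lambda>x. A (\<psi> x) + B x) = integral UNIV (\<lambda>x. A (\<psi> x)) + integral UNIV B"
    by (rule integral_add[OF integrable_bounded_support[OF Ck_on_continuous[OF A\<psi>(1)[of 0]] A\<psi>(2)]
      integrable_bounded_support[OF Ck_on_continuous[OF s(2)[of 0]] calabi_potentialD(3)[OF \<psi>]]])
  also have "integral UNIV (\<lambda>x. A (\<psi> x)) = integral UNIV A"
    by (rule calabi_potentialD(5)[OF \<psi> s(1) calabi_potentialD(3)[OF \<phi>]])
  finally show "integral UNIV (\<lambda>x. A (\<psi> x) + B x) = integral UNIV A + integral UNIV B" .
qed

lemma calabi_potential_inv:
  assumes \<phi>: "calabi_potential \<phi> A"
  shows "calabi_potential (inv \<phi>) (\<lambda>x. - A (inv \<phi> x))"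
    and "integral UNIV (\<lambda>x. - A (inv \<phi> x)) = - integral UNIV A"
proof -
  let ?\<psi> = "inv \<phi>"
  have diff: "diffeomorphism \<phi>" "diffeomorphism ?\<psi>"
    using calabi_potentialD(1)[OF \<phi>] diffeomorphism_inv by blast+
  have bij: "bij \<phi>" using diff(1) by (simp add: diffeomorphism_def)
  have inv: "\<phi> (?\<psi> x) = x" "?\<psi> (\<phi> x) = x" for x
    using bij by (simp_all add: bij_is_surj surj_f_inv_f bij_is_inj)
  note s = calabi_potentialD(2)[OF \<phi>] diffeomorphism_smooth(1)[OF diff(1)] diffeomorphism_smooth(1)[OF diff(2)]
  note d = s[THEN smooth_has_derivative]
  have A\<psi>: "Ck_on k (\<lambda>x. - A (?\<psi> x)) UNIV" "bounded_support (\<lambda>x. - A (?\<psi> x))" for k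
  proof -
    show "Ck_on k (\<lambda>x. - A (?\<psi> x)) UNIV"
      by (rule Ck_on_bounded_linear_compose[OF bounded_linear_minus[OF bounded_linear_ident] open_UNIV smooth_compose[OF s(3) s(1)]])
    show "bounded_support (\<lambda>x. - A (?\<psi> x))"
      using bounded_support_compose[OF diff(2) calabi_potentialD(3)[OF \<phi>]] by (simp add: bounded_support_def)
  qed
  have "frechet_derivative (\<lambda>x. - A (?\<psi> x)) (at x) v =
      1/2 * omega0 (?\<psi> x) (frechet_derivative ?\<psi> (at x) v) - 1/2 * omega0 x v" for x v
  proof -
    have 1: "frechet_derivative (\<lambda>x. - A (?\<psi> x)) (at x) =
      (\<lambda>v. - frechet_derivative A (at (?\<psi> x)) (frechet_derivative ?\<psi> (at x) v))"
      by (rule frechet_derivative_at[OF has_derivative_minus[OF has_derivative_compose[OF d(3) d(1)]], symmetric])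
    have "((\<lambda>x. \<phi> (?\<psi> x)) has_derivative
      (\<lambda>v. frechet_derivative \<phi> (at (?\<psi> x)) (frechet_derivative ?\<psi> (at x) v))) (at x)"
      by (rule has_derivative_compose[OF d(3) d(2)])
    then have "((\<lambda>x. x) has_derivative
      (\<lambda>v. frechet_derivative \<phi> (at (?\<psi> x)) (frechet_derivative ?\<psi> (at x) v))) (at x)"
      by (simp only: inv)
    then have "(\<lambda>v. frechet_derivative \<phi> (at (?\<psi> x)) (frechet_derivative ?\<psi> (at x) v)) = (\<lambda>v. v)"
      by (rule has_derivative_unique) (rule has_derivative_ident)
    then have 2: "frechet_derivative \<phi> (at (?\<psi> x)) (frechet_derivative ?\<psi> (at x) v) = v"
      by (rule fun_cong)
    show ?thesis
      unfolding 1 calabi_potentialD(4)[OF \<phi>] 2 inv by simp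
  qed
  moreover have vol: "integral UNIV (\<lambda>x. f (?\<psi> x)) = integral UNIV f"
    if f: "\<forall>k. Ck_on k f UNIV" "bounded_support f" for f :: "'a phase \<Rightarrow> real"
    using calabi_potentialD(5)[OF \<phi> smooth_compose[OF s(3) f(1)[rule_format]] bounded_support_compose[OF diff(2) f(2)]]
    unfolding inv by (rule sym)
  ultimately show "calabi_potential ?\<psi> (\<lambda>x. - A (?\<psi> x))"
    unfolding calabi_potential_def using diff(2) A\<psi> by blast
  show "integral UNIV (\<lambda>x. - A (?\<psi> x)) = - integral UNIV A"
    using vol[OF _ calabi_potentialD(3)[OF \<phi>]] s(1) by simp
qed

text \<open>
  Two primitives differ by a constant, and far away both of them vanish.
\<close>

lemma calabi_potential_unique:
  assumes A: "calabi_potential \<phi> A" and B: "calabi_potential \<phi> B"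
  shows "A = B"
proof -
  have "((\<lambda>x. A x - B x) has_derivative (\<lambda>v. 0)) (at x)" for x
  proof -
    have eq: "frechet_derivative A (at x) v - frechet_derivative B (at x) v = 0" for v
      unfolding calabi_potentialD(4)[OF A] calabi_potentialD(4)[OF B] by simp
    show ?thesis
      using has_derivative_diff[OF smooth_has_derivative[OF calabi_potentialD(2)[OF A]]
        smooth_has_derivative[OF calabi_potentialD(2)[OF B]], of x] unfolding eq .
  qed
  then obtain c where c: "\<And>x. A x - B x = c"
    using has_derivative_zero_constant[OF convex_UNIV, of "\<lambda>x. A x - B x"] by auto
  obtain R R' where R: "\<And>x. R < norm x \<Longrightarrow> A x = 0" "\<And>x. R' < norm x \<Longrightarrow> B x = 0"
    using calabi_potentialD(3)[OF A] calabi_potentialD(3)[OF B] by (auto simp: bounded_support_def)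
  obtain y :: "'a phase" where "norm y = max (max R R') 0 + 1"
    by (rule vector_choose_size[of "max (max R R') 0 + 1"]) simp_all
  then have "R < norm y" "R' < norm y" by linarith+
  then have "c = 0" using c[of y] R by simp
  then show ?thesis using c by (auto simp: fun_eq_iff)
qed

lemma calabi_potential_id: "calabi_potential id (\<lambda>x. 0)"
proof -
  have "diffeomorphism id"
    unfolding diffeomorphism_def smooth_on_UNIV inv_id
    by (simp add: Ck_on_bounded_linear[OF open_UNIV bounded_linear_ident[folded id_def]])
  then show ?thesis
    by (simp add: calabi_potential_def Ck_on_const bounded_support_def)
qed

lemma calabi_potential_conjugate:
  assumes h: "calabi_potential h H" and g: "calabi_potential g A"
  obtains C where "calabi_potential (h \<circ> g \<circ> inv h) C" "integral UNIV C = integral UNIV A"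
proof -
  note hg = calabi_potential_comp[OF h g] and ih = calabi_potential_inv[OF h]
  note c = calabi_potential_comp[OF hg(1) ih(1)]
  show thesis by (rule that[OF c(1)]) (simp only: c(2) hg(2) ih(2))
qed

lemma hamiltonian_support:
  fixes F :: "'n::finite phase \<times> real \<Rightarrow> real"
  assumes "hamiltonian F"
  obtains R where "\<forall>t\<in>{0..1}. \<forall>x. R < norm x \<longrightarrow> F (x, t) = 0"
proof -
  have "bounded (closure {z \<in> UNIV \<times> {0..1}. F z \<noteq> 0})"
    by (rule compact_imp_bounded[OF conjunct2[OF assms[unfolded hamiltonian_def]]])
  then obtain R where R: "\<forall>z\<in>closure {z \<in> UNIV \<times> {0..1}. F z \<noteq> 0}. norm z \<le> R"
    unfolding bounded_iff by (rule exE)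
  have "\<forall>t\<in>{0..1}. \<forall>x. R < norm x \<longrightarrow> F (x, t) = 0"
  proof (intro ballI allI impI, rule ccontr)
    fix t :: real and x :: "'n phase" assume that: "t \<in> {0..1}" "R < norm x"
    assume "F (x, t) \<noteq> 0"
    then have "(x, t) \<in> {z \<in> UNIV \<times> {0..1}. F z \<noteq> 0}" using that by simp
    then have "norm (x, t) \<le> R" by (rule bspec[OF R subsetD[OF closure_subset]])
    moreover have "norm x \<le> norm (x, t)" by (rule norm_fst_le)
    ultimately show False using that by linarith
  qed
  then show thesis by (rule that)
qed

lemma hamiltonian_flowI:
  fixes F :: "'n::finite phase \<times> real \<Rightarrow> real"
  assumes F: "hamiltonian F" and \<phi>: "ham_isotopy F \<phi>"
  obtains g W R where "hamiltonian_flow F \<phi> g W R"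
proof -
  obtain V G where V: "open V" "UNIV \<times> {0..1} \<subseteq> V" and G: "\<And>k. Ck_on k G V"
    and GF: "\<And>z. z \<in> UNIV \<times> {0..1} \<Longrightarrow> G z = F z"
    using F unfolding hamiltonian_def smooth_on_def by blast
  obtain W g where W: "open W" "UNIV \<times> {0..1} \<subseteq> W" and g: "\<And>k. Ck_on k g W"
    and g\<phi>: "\<And>z. z \<in> UNIV \<times> {0..1} \<Longrightarrow> g z = (\<lambda>(x, t). \<phi> t x) z"
    using \<phi> unfolding ham_isotopy_def isotopy_def smooth_on_def by blast
  obtain R where "\<forall>t\<in>{0..1}. \<forall>x. R < norm x \<longrightarrow> F (x, t) = 0"
    by (rule hamiltonian_support[OF F])
  note R = this[rule_format]
  have slice: "(\<lambda>x. F (x, t)) = (\<lambda>x. G (x, t))" if "t \<in> {0..1}" for t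
    using GF that by (intro ext) simp
  have inV: "(x, t) \<in> V" if "t \<in> {0..1}" for x t
    by (rule subsetD[OF V(2)]) (use that in simp)
  have "hamiltonian_flow F \<phi> g W R"
  proof
    show "open W" "UNIV \<times> {0..1} \<subseteq> W" by fact+
    show "Ck_on k g W" for k by (rule g)
    show "g (x, t) = \<phi> t x" if "t \<in> {0..1}" for x t using g\<phi>[of "(x, t)"] that by simp
    show "Ck_on k (\<lambda>x. F (x, t)) UNIV" if "t \<in> {0..1}" for t k
      unfolding slice[OF that]
    proof (rule Ck_on_compose[OF open_UNIV V(1) _ _ G])
      show "range (\<lambda>x. (x, t)) \<subseteq> V" using inV[OF that] by blast
      show "Ck_on k (\<lambda>x. (x, t)) UNIV"
        by (rule Ck_on_Pair[OF open_UNIV Ck_on_bounded_linear[OF open_UNIV bounded_linear_ident] Ck_on_const[OF open_UNIV]])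
    qed
    show "continuous_on (UNIV \<times> {0..1}) F"
      by (rule continuous_on_eq[OF continuous_on_subset[OF Ck_on_continuous[OF G[of 0]] V(2)] GF])
    show "continuous_on (UNIV \<times> {0..1}) (\<lambda>(x, t). frechet_derivative (\<lambda>q. F (q, t)) (at x) v)" for v
    proof (rule continuous_on_eq[OF continuous_on_subset[OF Ck_on_continuous[OF Ck_on_frechet_derivative[OF G]] V(2)]])
      fix z :: "'n phase \<times> real" assume z: "z \<in> UNIV \<times> {0..1}"
      obtain x t where xt: "z = (x, t)" "t \<in> {0..1}" using z by auto
      have "frechet_derivative (\<lambda>q. G (q, t)) (at x) = (\<lambda>v. frechet_derivative G (at (x, t)) (v, 0))"
        by (rule frechet_derivative_at[OF slice_x[OF Ck_on_has_derivative[OF G inV[OF xt(2)]]], symmetric])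
      then show "frechet_derivative G (at z) (v, 0) = (case z of (x, t) \<Rightarrow> frechet_derivative (\<lambda>q. F (q, t)) (at x) v)"
        unfolding xt(1) by (simp only: slice[OF xt(2)] prod.case)
    qed
    show "F (x, t) = 0" if "t \<in> {0..1}" "R < norm x" for x t by (rule R[OF that])
    show "((\<lambda>s. \<phi> s x) has_vector_derivative ham_field F t (\<phi> t x)) (at t within {0..1})" if "t \<in> {0..1}" for x t
      by (rule \<phi>[unfolded ham_isotopy_def, THEN conjunct2, THEN conjunct2, rule_format, OF that])
    show "\<phi> 0 = id" by (rule \<phi>[unfolded ham_isotopy_def, THEN conjunct2, THEN conjunct1])
  qed
  then show thesis by (rule that)
qed

text \<open>
  The usual formula for the Calabi invariant of the diffeomorphism generated by \<open>F\<close>.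
\<close>

definition calabi_integral :: "('n::finite phase \<times> real \<Rightarrow> real) \<Rightarrow> real" where
  "calabi_integral F = integral {0..1} (\<lambda>t. integral UNIV (\<lambda>x. F (x, t)))"

text \<open>
  The potential is the action of the flow at time 1.
\<close>

lemma generates_calabi_potential:
  fixes F :: "'n::finite phase \<times> real \<Rightarrow> real"
  assumes F: "hamiltonian F" and f: "generates F f"
  obtains A where "calabi_potential f A" "integral UNIV A = - (real CARD('n) + 1) * calabi_integral F"
proof -
  obtain \<phi> where \<phi>: "ham_isotopy F \<phi>" "f = \<phi> 1" using f unfolding generates_def by blast
  obtain g W R where "hamiltonian_flow F \<phi> g W R" by (rule hamiltonian_flowI[OF F \<phi>(1)])
  then interpret hamiltonian_flow F \<phi> g W R .
  have 1: "(1::real) \<in> {0..1}" by simp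
  have d\<phi>: "frechet_derivative (\<phi> 1) (at x) = dx 1 x" for x
    by (rule frechet_derivative_at[OF \<phi>_has_derivative[OF 1], symmetric])
  have dA: "frechet_derivative (action 1) (at x) = liouville_defect 1 x" for x
    by (rule frechet_derivative_at[OF action_has_derivative[OF 1], symmetric])
  have "isotopy \<phi>" by (rule \<phi>(1)[unfolded ham_isotopy_def, THEN conjunct1])
  from this[unfolded isotopy_def, THEN conjunct2, rule_format, OF 1]
  have diffeo: "diffeomorphism (\<phi> 1)" .
  have "calabi_potential f (action 1)"
    unfolding calabi_potential_def \<phi>(2)
  proof (intro conjI allI impI)
    show "diffeomorphism (\<phi> 1)" by (rule diffeo)
    show "Ck_on k (action 1) UNIV" for k by (rule action_smooth[OF 1])
    show "bounded_support (action 1)"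
      unfolding bounded_support_def by (intro exI[of _ R] allI impI action_outside[OF 1])
    show "frechet_derivative (action 1) (at x) v =
        1/2 * omega0 (\<phi> 1 x) (frechet_derivative (\<phi> 1) (at x) v) - 1/2 * omega0 x v" for x v
      unfolding d\<phi> dA liouville_defect_def ..
    show "integral UNIV (\<lambda>x. f (\<phi> 1 x)) = integral UNIV f"
      if "\<forall>k. Ck_on k f UNIV" "bounded_support f" for f :: "'n phase \<Rightarrow> real"
      by (rule integral_compose_flow[OF that(1)[rule_format] that(2) 1])
  qed
  moreover have "integral UNIV (action 1) = - (real CARD('n) + 1) * calabi_integral F"
    unfolding calabi_integral_def by (rule integral_action)
  ultimately show thesis by (rule that)
qed

section \<open>Hofer length controls the Calabi invariant\<close>

context
  fixes F :: "'n::finite phase \<times> real \<Rightarrow> real"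
  assumes F: "hamiltonian F"
begin

lemma hamiltonian_continuous: "continuous_on (UNIV \<times> {0..1}) F"
proof -
  obtain V G where V: "UNIV \<times> {0..1} \<subseteq> V" and G: "\<And>k. Ck_on k G V"
    and GF: "\<And>z. z \<in> UNIV \<times> {0..1} \<Longrightarrow> G z = F z"
    using F unfolding hamiltonian_def smooth_on_def by blast
  show ?thesis
    by (rule continuous_on_eq[OF continuous_on_subset[OF Ck_on_continuous[OF G[of 0]] V] GF])
qed

lemma hamiltonian_slice_continuous:
  assumes "t \<in> {0..1}" shows "continuous_on UNIV (\<lambda>x. F (x, t))"
  by (rule continuous_on_compose2[OF hamiltonian_continuous]) (use assms in \<open>auto intro!: continuous_intros\<close>)

lemma hamiltonian_slice_support:
  assumes "t \<in> {0..1}" shows "bounded_support (\<lambda>x. F (x, t))"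
proof -
  obtain R where "\<forall>t\<in>{0..1}. \<forall>x. R < norm x \<longrightarrow> F (x, t) = 0"
    by (rule hamiltonian_support[OF F])
  note R = this[rule_format]
  show ?thesis unfolding bounded_support_def by (intro exI[of _ R] allI impI R[OF assms])
qed

lemma hamiltonian_bounded:
  obtains M where "\<forall>t\<in>{0..1}. \<forall>x. \<bar>F (x, t)\<bar> \<le> M"
proof -
  obtain R where "\<forall>t\<in>{0..1}. \<forall>x. R < norm x \<longrightarrow> F (x, t) = 0"
    by (rule hamiltonian_support[OF F])
  note R = this[rule_format]
  have "compact (F ` (cball 0 R \<times> {0..1}))"
    by (rule compact_continuous_image[OF continuous_on_subset[OF hamiltonian_continuous] compact_Times]) auto
  then have "bounded (F ` (cball 0 R \<times> {0..1}))" by (rule compact_imp_bounded)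
  then obtain M where M: "\<forall>y\<in>F ` (cball 0 R \<times> {0..1}). norm y \<le> M"
    unfolding bounded_iff by (rule exE)
  have bound: "\<bar>F (x, t)\<bar> \<le> max M 0" if "t \<in> {0..1}" for x t
  proof (cases "R < norm x")
    case False
    then have "F (x, t) \<in> F ` (cball 0 R \<times> {0..1})" using that by (intro imageI) simp
    with M have "norm (F (x, t)) \<le> M" by (rule bspec)
    then show ?thesis by simp
  qed (simp add: R[OF that])
  show thesis by (rule that[of "max M 0"]) (intro ballI allI bound)
qed

lemma hamiltonian_bdd:
  assumes "t \<in> {0..1}"
  shows "bdd_above (range (\<lambda>x. F (x, t)))" "bdd_below (range (\<lambda>x. F (x, t)))"
proof -
  obtain M where "\<forall>t\<in>{0..1}. \<forall>x. \<bar>F (x, t)\<bar> \<le> M" by (rule hamiltonian_bounded)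
  note M = this[rule_format]
  show "bdd_above (range (\<lambda>x. F (x, t)))"
    by (rule bdd_aboveI2[of _ _ M]) (use M[OF assms] in \<open>simp add: abs_le_iff\<close>)
  show "bdd_below (range (\<lambda>x. F (x, t)))"
    by (rule bdd_belowI2[of _ "- M"]) (use M[OF assms] in \<open>simp add: abs_le_iff minus_le_iff\<close>)
qed

lemma hamiltonian_uniform:
  assumes "e > 0"
  obtains d where "d > 0" "\<forall>s\<in>{0..1}. \<forall>t\<in>{0..1}. \<forall>x. \<bar>s - t\<bar> < d \<longrightarrow> \<bar>F (x, s) - F (x, t)\<bar> < e"
proof -
  obtain R where "\<forall>t\<in>{0..1}. \<forall>x. R < norm x \<longrightarrow> F (x, t) = 0"
    by (rule hamiltonian_support[OF F])
  note R = this[rule_format]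
  have "uniformly_continuous_on (cball 0 R \<times> {0..1}) F"
    by (rule compact_uniformly_continuous[OF continuous_on_subset[OF hamiltonian_continuous] compact_Times]) auto
  from this[unfolded uniformly_continuous_on_def, rule_format, OF assms]
  obtain d where "d > 0" and "\<forall>z\<in>cball 0 R \<times> {0..1}. \<forall>z'\<in>cball 0 R \<times> {0..1}.
      dist z' z < d \<longrightarrow> dist (F z') (F z) < e"
    by (elim exE conjE)
  note d = this(1) this(2)[rule_format]
  have unif: "\<bar>F (x, s) - F (x, t)\<bar> < e" if "s \<in> {0..1}" "t \<in> {0..1}" "\<bar>s - t\<bar> < d" for s t x
  proof (cases "R < norm x")
    case True
    then show ?thesis using R that assms by simp
  next
    case False
    have "dist (F (x, s)) (F (x, t)) < e"
      by (rule d(2)) (use False that in \<open>auto simp: dist_Pair_Pair dist_real_def\<close>)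
    then show ?thesis by (simp add: dist_real_def)
  qed
  show thesis by (rule that[OF d(1)]) (intro ballI allI impI unif)
qed

text \<open>
  The integral in the definition of the Hofer length is 0 by convention if the integrand is not
  integrable; continuity excludes that case.
\<close>

lemma hamiltonian_oscillation_continuous:
  "continuous_on {0..1} (\<lambda>t. (SUP x. F (x, t)) - (INF x. F (x, t)))"
proof (rule continuous_on_diff)
  have SUP: "(SUP x. F (x, s)) \<le> (SUP x. F (x, t)) + e"
    if "t \<in> {0..1}" "\<And>x. \<bar>F (x, s) - F (x, t)\<bar> < e" for s t e
  proof (rule cSUP_least)
    fix x show "F (x, s) \<le> (SUP x. F (x, t)) + e"
      using cSUP_upper[OF UNIV_I hamiltonian_bdd(1)[OF that(1)], of x] that(2)[of x] by linarith
  qed simp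
  have INF: "(INF x. F (x, t)) - e \<le> (INF x. F (x, s))"
    if "t \<in> {0..1}" "\<And>x. \<bar>F (x, s) - F (x, t)\<bar> < e" for s t e
  proof (rule cINF_greatest)
    fix x show "(INF x. F (x, t)) - e \<le> F (x, s)"
      using cINF_lower[OF hamiltonian_bdd(2)[OF that(1)] UNIV_I, of x] that(2)[of x] by linarith
  qed simp
  show "continuous_on {0..1} (\<lambda>t. SUP x. F (x, t))"
    unfolding continuous_on_iff
  proof (intro ballI allI impI)
    fix t e :: real assume t: "t \<in> {0..1}" and e: "0 < e"
    from e have "0 < e/2" by simp
    then obtain d where "d > 0" "\<forall>s\<in>{0..1}. \<forall>t\<in>{0..1}. \<forall>x. \<bar>s - t\<bar> < d \<longrightarrow> \<bar>F (x, s) - F (x, t)\<bar> < e/2"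
      by (rule hamiltonian_uniform)
    note d = this(1) this(2)[rule_format]
    have "dist (SUP x. F (x, s)) (SUP x. F (x, t)) < e" if s: "s \<in> {0..1}" "dist s t < d" for s
    proof -
      have st: "\<bar>t - s\<bar> < d" "\<bar>s - t\<bar> < d" using s(2) by (simp_all only: dist_real_def abs_minus_commute)
      note ineq = SUP[OF t d(2)[OF s(1) t st(2)]] SUP[OF s(1) d(2)[OF t s(1) st(1)]]
      show ?thesis unfolding dist_real_def abs_less_iff using ineq e by (intro conjI; linarith)
    qed
    then show "\<exists>d>0. \<forall>s\<in>{0..1}. dist s t < d \<longrightarrow> dist (SUP x. F (x, s)) (SUP x. F (x, t)) < e"
      using d(1) by blast
  qed
  show "continuous_on {0..1} (\<lambda>t. INF x. F (x, t))"
    unfolding continuous_on_iff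
  proof (intro ballI allI impI)
    fix t e :: real assume t: "t \<in> {0..1}" and e: "0 < e"
    from e have "0 < e/2" by simp
    then obtain d where "d > 0" "\<forall>s\<in>{0..1}. \<forall>t\<in>{0..1}. \<forall>x. \<bar>s - t\<bar> < d \<longrightarrow> \<bar>F (x, s) - F (x, t)\<bar> < e/2"
      by (rule hamiltonian_uniform)
    note d = this(1) this(2)[rule_format]
    have "dist (INF x. F (x, s)) (INF x. F (x, t)) < e" if s: "s \<in> {0..1}" "dist s t < d" for s
    proof -
      have st: "\<bar>t - s\<bar> < d" "\<bar>s - t\<bar> < d" using s(2) by (simp_all only: dist_real_def abs_minus_commute)
      note ineq = INF[OF t d(2)[OF s(1) t st(2)]] INF[OF s(1) d(2)[OF t s(1) st(1)]]
      show ?thesis unfolding dist_real_def abs_less_iff using ineq e by (intro conjI; linarith)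
    qed
    then show "\<exists>d>0. \<forall>s\<in>{0..1}. dist s t < d \<longrightarrow> dist (INF x. F (x, s)) (INF x. F (x, t)) < e"
      using d(1) by blast
  qed
qed

text \<open>
  As \<open>F\<^sub>t\<close> vanishes far away, 0 lies between its infimum and its supremum.
\<close>

lemma hamiltonian_le_oscillation:
  assumes t: "t \<in> {0..1}"
  shows "\<bar>F (x, t)\<bar> \<le> (SUP x. F (x, t)) - (INF x. F (x, t))"
proof -
  obtain R where "\<forall>t\<in>{0..1}. \<forall>x. R < norm x \<longrightarrow> F (x, t) = 0"
    by (rule hamiltonian_support[OF F])
  note R = this[rule_format]
  obtain y :: "'n phase" where y: "norm y = max R 0 + 1"
    by (rule vector_choose_size[of "max R 0 + 1"]) simp_all
  then have "R < norm y" by linarith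
  then have "F (y, t) = 0" by (rule R[OF t])
  then show ?thesis
    using cSUP_upper[OF UNIV_I hamiltonian_bdd(1)[OF t], of x] cINF_lower[OF hamiltonian_bdd(2)[OF t] UNIV_I, of x]
      cSUP_upper[OF UNIV_I hamiltonian_bdd(1)[OF t], of y] cINF_lower[OF hamiltonian_bdd(2)[OF t] UNIV_I, of y]
    by linarith
qed

lemma hofer_length_nonneg: "0 \<le> hofer_length F"
  unfolding hofer_length_def
proof (rule integral_nonneg)
  show "(\<lambda>t. (SUP x. F (x, t)) - (INF x. F (x, t))) integrable_on {0..1}"
    by (rule integrable_continuous_real[OF hamiltonian_oscillation_continuous])
  show "0 \<le> (SUP x. F (x, t)) - (INF x. F (x, t))" if "t \<in> {0..1}" for t
    using hamiltonian_le_oscillation[OF that, of undefined] by linarith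
qed

lemma calabi_integral_bound:
  assumes U: "U \<in> lmeasurable" "ham_supp F \<subseteq> U"
  shows "\<bar>calabi_integral F\<bar> \<le> measure lebesgue U * hofer_length F"
proof -
  let ?o = "\<lambda>t. (SUP x. F (x, t)) - (INF x. F (x, t))"
  have slice: "\<bar>integral UNIV (\<lambda>x. F (x, t))\<bar> \<le> measure lebesgue U * ?o t" if t: "t \<in> {0..1}" for t
  proof -
    have ind: "(indicator U has_integral measure lebesgue U) UNIV"
      by (rule lmeasurable_iff_has_integral[THEN iffD1, OF U(1)])
    have out: "F (x, t) = 0" if "x \<notin> U" for x
    proof (rule ccontr)
      assume "F (x, t) \<noteq> 0"
      then have "x \<in> {x. F (x, t) \<noteq> 0}" by simp
      then have "x \<in> closure {x. F (x, t) \<noteq> 0}" by (rule subsetD[OF closure_subset])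
      then have "x \<in> ham_supp F" unfolding ham_supp_def by (rule UN_I[OF t])
      then show False using that subsetD[OF U(2)] by simp
    qed
    have "norm (integral UNIV (\<lambda>x. F (x, t))) \<le> integral UNIV (\<lambda>x. indicator U x * ?o t)"
    proof (rule integral_norm_bound_integral)
      show "(\<lambda>x. F (x, t)) integrable_on UNIV"
        by (rule integrable_bounded_support[OF hamiltonian_slice_continuous[OF t] hamiltonian_slice_support[OF t]])
      show "(\<lambda>x. indicator U x * ?o t) integrable_on UNIV"
        using has_integral_mult_left[OF ind] by blast
      show "norm (F (x, t)) \<le> indicator U x * ?o t" for x
        using hamiltonian_le_oscillation[OF t, of x] out[of x] by (cases "x \<in> U") auto
    qed
    also have "integral UNIV (\<lambda>x. indicator U x * ?o t) = measure lebesgue U * ?o t"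
      by (rule integral_unique[OF has_integral_mult_left[OF ind]])
    finally show ?thesis by simp
  qed
  have "norm (calabi_integral F) \<le> integral {0..1} (\<lambda>t. measure lebesgue U * ?o t)"
    unfolding calabi_integral_def
  proof (rule integral_norm_bound_integral)
    obtain R where "\<forall>t\<in>{0..1}. \<forall>x. R < norm x \<longrightarrow> F (x, t) = 0"
      by (rule hamiltonian_support[OF F])
    note R = this[rule_format]
    obtain b where b: "cball (0::'n phase) R \<subseteq> cbox (-b) b"
      using bounded_subset_cbox_symmetric[OF bounded_cball] by blast
    have "continuous_on {0..1} (\<lambda>t. integral (cbox (-b) b) (\<lambda>x. F (x, t)))"
      by (rule integral_continuous_on_param, unfold case_prod_beta)
        (auto intro!: continuous_on_compose2[OF hamiltonian_continuous] continuous_intros)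
    moreover have "integral (cbox (-b) b) (\<lambda>x. F (x, t)) = integral UNIV (\<lambda>x. F (x, t))" if "t \<in> {0..1}" for t
    proof (rule integral_UNIV_eq_cbox[symmetric])
      fix x assume "x \<notin> cbox (-b) b"
      then have "x \<notin> cball 0 R" using b by blast
      then show "F (x, t) = 0" using R[OF that, of x] by simp
    qed
    ultimately have "continuous_on {0..1} (\<lambda>t. integral UNIV (\<lambda>x. F (x, t)))"
      by (rule continuous_on_eq)
    then show "(\<lambda>t. integral UNIV (\<lambda>x. F (x, t))) integrable_on {0..1}"
      by (rule integrable_continuous_real)
    show "(\<lambda>t. measure lebesgue U * ?o t) integrable_on {0..1}"
      by (rule integrable_on_mult_right[OF integrable_continuous_real[OF hamiltonian_oscillation_continuous]])
    show "norm (integral UNIV (\<lambda>x. F (x, t))) \<le> measure lebesgue U * ?o t" if "t \<in> {0..1}" for t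
      using slice[OF that] by simp
  qed
  then show ?thesis by (simp add: hofer_length_def)
qed

end

text \<open>
  The integral of the potential is a homomorphism into an abelian group, so the conjugating
  diffeomorphisms contribute nothing.
\<close>

lemma fragmentation_calabi:
  fixes L :: "(('n::finite phase \<times> real \<Rightarrow> real) \<times> ('n phase \<Rightarrow> 'n phase) \<times> ('n phase \<Rightarrow> 'n phase)) list"
  assumes "\<forall>(F, g, h)\<in>set L. hamiltonian F \<and> generates F g \<and> h \<in> Ham"
  obtains A where "calabi_potential (foldr (\<circ>) (map (\<lambda>(F, g, h). h \<circ> g \<circ> inv h) L) id) A"
    "integral UNIV A = - (real CARD('n) + 1) * (\<Sum>(F, g, h)\<leftarrow>L. calabi_integral F)"
proof -
  have "\<exists>A. calabi_potential (foldr (\<circ>) (map (\<lambda>(F, g, h). h \<circ> g \<circ> inv h) L) id) A \<and>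
    integral UNIV A = - (real CARD('n) + 1) * (\<Sum>(F, g, h)\<leftarrow>L. calabi_integral F)"
    using assms
  proof (induction L)
    case Nil
    have 1: "foldr (\<circ>) (map (\<lambda>(F, g, h). h \<circ> g \<circ> inv h) []) id = id" by simp
    show ?case unfolding 1 by (rule exI[of _ "\<lambda>x. 0"], rule conjI[OF calabi_potential_id]) simp
  next
    case (Cons p L)
    let ?\<psi> = "foldr (\<circ>) (map (\<lambda>(F, g, h). h \<circ> g \<circ> inv h) L) id"
    obtain F g h where p: "p = (F, g, h)" by (cases p)
    have F: "hamiltonian F" "generates F g" "h \<in> Ham" using Cons.prems p by auto
    have "\<forall>(F, g, h)\<in>set L. hamiltonian F \<and> generates F g \<and> h \<in> Ham"
      using Cons.prems by simp
    from Cons.IH[OF this] obtain B where B: "calabi_potential ?\<psi> B"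
        "integral UNIV B = - (real CARD('n) + 1) * (\<Sum>(F, g, h)\<leftarrow>L. calabi_integral F)"
      by (elim exE conjE)
    obtain A where A: "calabi_potential g A" "integral UNIV A = - (real CARD('n) + 1) * calabi_integral F"
      by (rule generates_calabi_potential[OF F(1,2)])
    obtain K where "hamiltonian K" "generates K h" using F(3) unfolding Ham_def by blast
    then obtain H where H: "calabi_potential h H" by (rule generates_calabi_potential)
    obtain C where C: "calabi_potential (h \<circ> g \<circ> inv h) C" "integral UNIV C = integral UNIV A"
      by (rule calabi_potential_conjugate[OF H A(1)])
    note CB = calabi_potential_comp[OF C(1) B(1)]
    have "integral UNIV (\<lambda>x. C (?\<psi> x) + B x) =
        - (real CARD('n) + 1) * (\<Sum>(F, g, h)\<leftarrow>(p # L). calabi_integral F)"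
      unfolding CB(2) C(2) A(2) B(2) p by (simp add: distrib_left)
    moreover have "foldr (\<circ>) (map (\<lambda>(F, g, h). h \<circ> g \<circ> inv h) (p # L)) id = (h \<circ> g \<circ> inv h) \<circ> ?\<psi>"
      unfolding p list.map foldr.simps prod.case comp_apply ..
    ultimately show ?case using CB(1) by (intro exI[of _ "\<lambda>x. C (?\<psi> x) + B x"]) (simp only: simp_thms)
  qed
  then show thesis by (elim exE conjE) (rule that)
qed

lemma sum_calabi_integral_bound:
  fixes U :: "'n::finite phase set"
  assumes U: "U \<in> lmeasurable" and L: "\<forall>(F, g, h)\<in>set L. hamiltonian F \<and> ham_supp F \<subseteq> U"
  shows "\<bar>\<Sum>(F, g, h)\<leftarrow>L. calabi_integral F\<bar> \<le> measure lebesgue U * (\<Sum>(F, g, h)\<leftarrow>L. hofer_length F)"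
  using L
proof (induction L)
  case (Cons p L)
  obtain F g h where p: "p = (F, g, h)" by (cases p)
  have "\<bar>calabi_integral F\<bar> \<le> measure lebesgue U * hofer_length F"
    using Cons.prems p by (intro calabi_integral_bound U) auto
  moreover have "\<bar>\<Sum>(F, g, h)\<leftarrow>L. calabi_integral F\<bar> \<le> measure lebesgue U * (\<Sum>(F, g, h)\<leftarrow>L. hofer_length F)"
    using Cons.prems by (intro Cons.IH) simp
  ultimately show ?case
    unfolding p list.map prod.case sum_list.Cons distrib_left by (rule order_trans[OF abs_triangle_ineq add_mono])
qed simp

section \<open>Radial Hamiltonians\<close>

text \<open>
  The angular speed of the flow of \<open>\<rho> (\<bar>z\<bar>\<^sup>2)\<close> on the sphere with \<open>\<bar>z\<bar>\<^sup>2 = s\<close>, that is, twice the derivative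
  of \<open>\<rho>\<close>.
\<close>

definition rotation_speed :: "(real \<Rightarrow> real) \<Rightarrow> real \<Rightarrow> real" where
  "rotation_speed \<rho> s = 2 * frechet_derivative \<rho> (at s) 1"

definition radial_ham :: "(real \<Rightarrow> real) \<Rightarrow> 'n::finite phase \<Rightarrow> 'n phase \<times> real \<Rightarrow> real" where
  "radial_ham \<rho> p = (\<lambda>(z, t). \<rho> ((z - p) \<bullet> (z - p)))"

text \<open>
  Multiplication of \<open>z - p\<close> by \<open>exp (i \<alpha>)\<close>, where \<open>symp_J\<close> plays the role of \<open>i\<close>.
\<close>

definition radial_flow :: "(real \<Rightarrow> real) \<Rightarrow> 'n::finite phase \<Rightarrow> real \<Rightarrow> 'n phase \<Rightarrow> 'n phase" where
  "radial_flow \<rho> p t z = (let \<alpha> = t * rotation_speed \<rho> ((z - p) \<bullet> (z - p))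
     in p + cos \<alpha> *\<^sub>R (z - p) + sin \<alpha> *\<^sub>R symp_J (z - p))"

lemma radial_flow_eq:
  "radial_flow \<rho> p t z = p + cos (t * rotation_speed \<rho> ((z - p) \<bullet> (z - p))) *\<^sub>R (z - p) +
     sin (t * rotation_speed \<rho> ((z - p) \<bullet> (z - p))) *\<^sub>R symp_J (z - p)"
  by (simp add: radial_flow_def Let_def)

lemma inner_rotation: "(cos \<alpha> *\<^sub>R u + sin \<alpha> *\<^sub>R symp_J u) \<bullet> (cos \<alpha> *\<^sub>R u + sin \<alpha> *\<^sub>R symp_J u) = u \<bullet> u"
proof -
  have "(cos \<alpha> *\<^sub>R u + sin \<alpha> *\<^sub>R symp_J u) \<bullet> (cos \<alpha> *\<^sub>R u + sin \<alpha> *\<^sub>R symp_J u)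
    = cos \<alpha> * cos \<alpha> * (u \<bullet> u) + sin \<alpha> * sin \<alpha> * (u \<bullet> u)"
    using inner_symp_J(1)[of u u] inner_symp_J(3)[of u]
    by (simp add: inner_add_left inner_add_right inner_commute[of u "symp_J u"] algebra_simps)
  then show ?thesis by (simp only: distrib_right[symmetric] sin_cos_squared_add3 mult_1_left)
qed

lemma radial_flow_norm: "(radial_flow \<rho> p t z - p) \<bullet> (radial_flow \<rho> p t z - p) = (z - p) \<bullet> (z - p)"
  using inner_rotation[of "t * rotation_speed \<rho> ((z - p) \<bullet> (z - p))" "z - p"]
  by (simp add: radial_flow_eq algebra_simps)

lemma radial_flow_dist: "dist p (radial_flow \<rho> p t z) = dist p z"
proof -
  have "norm (radial_flow \<rho> p t z - p) = norm (z - p)"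
    unfolding norm_eq_sqrt_inner radial_flow_norm ..
  then show ?thesis by (metis dist_commute dist_norm)
qed

lemma radial_flow_minus: "radial_flow \<rho> p (- t) (radial_flow \<rho> p t z) = z"
proof -
  let ?u = "z - p" and ?\<alpha> = "t * rotation_speed \<rho> ((z - p) \<bullet> (z - p))"
  let ?w = "cos ?\<alpha> *\<^sub>R ?u + sin ?\<alpha> *\<^sub>R symp_J ?u"
  have w: "radial_flow \<rho> p t z - p = ?w" by (simp add: radial_flow_eq)
  have "radial_flow \<rho> p (- t) (radial_flow \<rho> p t z) = p + (cos ?\<alpha> *\<^sub>R ?w - sin ?\<alpha> *\<^sub>R symp_J ?w)"
    unfolding radial_flow_eq[of \<rho> p "- t"] unfolding radial_flow_norm unfolding w by simp
  also have "cos ?\<alpha> *\<^sub>R ?w - sin ?\<alpha> *\<^sub>R symp_J ?w = (cos ?\<alpha> * cos ?\<alpha> + sin ?\<alpha> * sin ?\<alpha>) *\<^sub>R ?u"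
    unfolding symp_J_simps(1,3,6) scaleR_add_left scaleR_add_right scaleR_scaleR
    by (simp add: mult.commute flip: scaleR_minus_right)
  finally show ?thesis unfolding sin_cos_squared_add3 by simp
qed

context
  fixes \<rho> :: "real \<Rightarrow> real"
  assumes \<rho>: "\<And>k. Ck_on k \<rho> UNIV"
begin

lemma profile_has_derivative: "(\<rho> has_derivative (\<lambda>v. v * (rotation_speed \<rho> s / 2))) (at s)"
proof -
  have d: "(\<rho> has_derivative frechet_derivative \<rho> (at s)) (at s)" by (rule smooth_has_derivative[OF \<rho>])
  have "frechet_derivative \<rho> (at s) v = v * (rotation_speed \<rho> s / 2)" for v
    using linear_cmul[OF has_derivative_linear[OF d], of v 1] by (simp add: rotation_speed_def)
  then have "frechet_derivative \<rho> (at s) = (\<lambda>v. v * (rotation_speed \<rho> s / 2))" by (rule ext)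
  with d show ?thesis by (simp only:)
qed

lemma rotation_speed_smooth: "Ck_on k (rotation_speed \<rho>) UNIV"
  unfolding rotation_speed_def[abs_def]
  by (rule Ck_on_bounded_linear_compose[OF bounded_linear_mult_right open_UNIV Ck_on_frechet_derivative[OF \<rho>]])

lemma fst_minus_smooth: "Ck_on k (\<lambda>w :: 'n::finite phase \<times> real. fst w - p) UNIV"
  using Ck_on_add[OF open_UNIV Ck_on_bounded_linear[OF open_UNIV bounded_linear_fst] Ck_on_const[OF open_UNIV], of k "- p"]
  by simp

lemma radial_ham_smooth: "Ck_on k (radial_ham \<rho> p) UNIV"
  unfolding radial_ham_def case_prod_beta
  by (rule smooth_compose[OF Ck_on_bilinear[OF bounded_bilinear_inner open_UNIV fst_minus_smooth fst_minus_smooth] \<rho>])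

lemma radial_flow_smooth: "Ck_on k (\<lambda>(z, t). radial_flow \<rho> p t z) UNIV"
proof -
  have \<alpha>: "Ck_on k (\<lambda>w. snd w * rotation_speed \<rho> ((fst w - p) \<bullet> (fst w - p))) UNIV"
    by (rule Ck_on_bilinear[OF bounded_bilinear_mult open_UNIV Ck_on_bounded_linear[OF open_UNIV bounded_linear_snd]
        smooth_compose[OF Ck_on_bilinear[OF bounded_bilinear_inner open_UNIV fst_minus_smooth fst_minus_smooth] rotation_speed_smooth]])
  show ?thesis
    unfolding radial_flow_eq case_prod_beta
    by (rule Ck_on_add[OF open_UNIV Ck_on_add[OF open_UNIV Ck_on_const[OF open_UNIV]
        Ck_on_bilinear[OF bounded_bilinear_scaleR open_UNIV smooth_compose[OF \<alpha> Ck_on_sin_cos[THEN conjunct2]] fst_minus_smooth]]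
        Ck_on_bilinear[OF bounded_bilinear_scaleR open_UNIV smooth_compose[OF \<alpha> Ck_on_sin_cos[THEN conjunct1]]
          Ck_on_bounded_linear_compose[OF bounded_linear_symp_J open_UNIV fst_minus_smooth]]])
qed

lemma ham_field_radial: "ham_field (radial_ham \<rho> p) t z = rotation_speed \<rho> ((z - p) \<bullet> (z - p)) *\<^sub>R symp_J (z - p)"
proof (rule ham_field_eqI)
  fix V
  let ?\<theta> = "rotation_speed \<rho> ((z - p) \<bullet> (z - p))"
  have id: "((\<lambda>z. z - p) has_derivative (\<lambda>v. v)) (at z)"
    by (auto intro!: derivative_eq_intros)
  have "((\<lambda>z. (z - p) \<bullet> (z - p)) has_derivative (\<lambda>v. (z - p) \<bullet> v + v \<bullet> (z - p))) (at z)"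
    by (rule has_derivative_inner[OF id id])
  from has_derivative_compose[OF this profile_has_derivative]
  have "((\<lambda>q. radial_ham \<rho> p (q, t)) has_derivative (\<lambda>v. ((z - p) \<bullet> v + v \<bullet> (z - p)) * (?\<theta> / 2))) (at z)"
    by (simp add: radial_ham_def)
  from fun_cong[OF frechet_derivative_at[OF this, symmetric], of V]
  show "omega0 (?\<theta> *\<^sub>R symp_J (z - p)) V = - frechet_derivative (\<lambda>q. radial_ham \<rho> p (q, t)) (at z) V"
    by (simp add: omega0_eq_inner inner_commute[of V] inner_diff_left algebra_simps)
qed

lemma radial_flow_has_vector_derivative:
  "((\<lambda>s. radial_flow \<rho> p s z) has_vector_derivative ham_field (radial_ham \<rho> p) t (radial_flow \<rho> p t z)) (at t within S)"
proof -
  let ?u = "z - p" and ?\<theta> = "rotation_speed \<rho> ((z - p) \<bullet> (z - p))"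
  have field: "ham_field (radial_ham \<rho> p) t (radial_flow \<rho> p t z) =
      (- (?\<theta> * sin (t * ?\<theta>))) *\<^sub>R ?u + (?\<theta> * cos (t * ?\<theta>)) *\<^sub>R symp_J ?u"
    unfolding ham_field_radial radial_flow_norm by (simp add: radial_flow_eq algebra_simps)
  have c: "((\<lambda>s. cos (s * ?\<theta>)) has_vector_derivative - (?\<theta> * sin (t * ?\<theta>))) (at t within S)"
    and s: "((\<lambda>s. sin (s * ?\<theta>)) has_vector_derivative ?\<theta> * cos (t * ?\<theta>)) (at t within S)"
    by (auto intro!: derivative_eq_intros simp flip: has_real_derivative_iff_has_vector_derivative)
  have scale: "((\<lambda>s. f s *\<^sub>R v) has_vector_derivative f' *\<^sub>R v) (at t within S)"
    if "(f has_vector_derivative f') (at t within S)" for f :: "real \<Rightarrow> real" and f' and v :: "'a phase"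
    by (rule bounded_linear.has_vector_derivative[OF bounded_linear_scaleR_left that])
  have "((\<lambda>s. p + cos (s * ?\<theta>) *\<^sub>R ?u + sin (s * ?\<theta>) *\<^sub>R symp_J ?u) has_vector_derivative
      0 + (- (?\<theta> * sin (t * ?\<theta>))) *\<^sub>R ?u + (?\<theta> * cos (t * ?\<theta>)) *\<^sub>R symp_J ?u) (at t within S)"
    by (rule has_vector_derivative_add[OF has_vector_derivative_add[OF has_vector_derivative_const scale[OF c]] scale[OF s]])
  then show ?thesis unfolding field unfolding radial_flow_eq by (simp only: add_0_left)
qed

lemma radial_isotopy: "ham_isotopy (radial_ham \<rho> p) (radial_flow \<rho> p)"
proof -
  have slice: "Ck_on k (radial_flow \<rho> p t) UNIV" for k t
  proof -
    have "Ck_on k (\<lambda>z. (z, t)) UNIV"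
      by (rule Ck_on_Pair[OF open_UNIV Ck_on_bounded_linear[OF open_UNIV bounded_linear_ident] Ck_on_const[OF open_UNIV]])
    from smooth_compose[OF this radial_flow_smooth] show ?thesis by simp
  qed
  have inv1: "radial_flow \<rho> p (- t) \<circ> radial_flow \<rho> p t = id" for t
    by (rule ext) (simp add: radial_flow_minus)
  have inv2: "radial_flow \<rho> p t \<circ> radial_flow \<rho> p (- t) = id" for t
    using inv1[of "- t"] by simp
  have "diffeomorphism (radial_flow \<rho> p t)" for t
  proof -
    have "inv (radial_flow \<rho> p t) = radial_flow \<rho> p (- t)" by (rule inv_unique_comp[OF inv2 inv1])
    then show ?thesis
      unfolding diffeomorphism_def smooth_on_UNIV using o_bij[OF inv1 inv2] slice by (simp only: simp_thms)
  qed
  moreover have "smooth_on (\<lambda>(z, t). radial_flow \<rho> p t z) (UNIV \<times> {0..1})"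
    unfolding smooth_on_def
    by (rule exI[of _ UNIV], rule exI[of _ "\<lambda>(z, t). radial_flow \<rho> p t z"],
      intro conjI allI ballI refl open_UNIV subset_UNIV radial_flow_smooth)
  moreover have "radial_flow \<rho> p 0 = id" by (rule ext) (simp add: radial_flow_eq)
  ultimately show ?thesis
    unfolding ham_isotopy_def isotopy_def by (intro conjI ballI allI radial_flow_has_vector_derivative)
qed

lemma radial_hamiltonian:
  assumes supp: "\<And>s. r\<^sup>2 < s \<Longrightarrow> \<rho> s = 0" and r: "0 \<le> r"
  shows "hamiltonian (radial_ham \<rho> p)" "z \<notin> cball p r \<Longrightarrow> radial_ham \<rho> p (z, t) = 0"
proof -
  have out: "radial_ham \<rho> p (z, t) = 0" if "z \<notin> cball p r" for z t
  proof -
    have "r < norm (z - p)" using that by (simp add: dist_norm norm_minus_commute)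
    then have "r\<^sup>2 < (z - p) \<bullet> (z - p)"
      using r by (simp add: dot_square_norm power_strict_mono)
    then show ?thesis by (simp add: radial_ham_def supp)
  qed
  have "{w \<in> UNIV \<times> {0..1}. radial_ham \<rho> p w \<noteq> 0} \<subseteq> cball p r \<times> {0..1}"
  proof (rule subsetI)
    fix w assume w: "w \<in> {w \<in> UNIV \<times> {0..1}. radial_ham \<rho> p w \<noteq> 0}"
    obtain z t where zt: "w = (z, t)" by (cases w)
    then have "z \<in> cball p r" using out[of z t] w by blast
    then show "w \<in> cball p r \<times> {0..1}" using w zt by simp
  qed
  then have "bounded {w \<in> UNIV \<times> {0..1}. radial_ham \<rho> p w \<noteq> 0}"
    by (rule bounded_subset[rotated]) (intro bounded_Times bounded_cball bounded_closed_interval)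
  moreover have "smooth_on (radial_ham \<rho> p) (UNIV \<times> {0..1})"
    unfolding smooth_on_def
    by (rule exI[of _ UNIV], rule exI[of _ "radial_ham \<rho> p"],
      intro conjI allI ballI refl open_UNIV subset_UNIV radial_ham_smooth)
  ultimately show "hamiltonian (radial_ham \<rho> p)" by (simp add: hamiltonian_def)
  show "radial_ham \<rho> p (z, t) = 0" if "z \<notin> cball p r" by (rule out[OF that])
qed

end

section \<open>Isotopies with disjoint supports\<close>

lemma ham_field_cong_open:
  assumes "open O'" "x \<in> O'" "\<And>y. y \<in> O' \<Longrightarrow> F (y, t) = G (y, t)"
  shows "ham_field F t x = ham_field G t x"
proof -
  have eq: "frechet_derivative (\<lambda>q. F (q, t)) (at x) = frechet_derivative (\<lambda>q. G (q, t)) (at x)"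
    by (rule frechet_derivative_cong_open[OF assms(1,2)]) (rule assms(3))
  show ?thesis by (simp only: ham_field_def eq)
qed

lemma isotopy_comp:
  assumes \<phi>: "isotopy \<phi>" and \<psi>: "isotopy \<psi>"
  shows "isotopy (\<lambda>t. \<phi> t \<circ> \<psi> t)"
proof -
  obtain W1 g1 where W1: "open W1" "UNIV \<times> {0..1} \<subseteq> W1" and g1: "\<And>k. Ck_on k g1 W1"
    and e1: "\<And>z. z \<in> UNIV \<times> {0..1} \<Longrightarrow> g1 z = (\<lambda>(x, t). \<phi> t x) z"
    using \<phi> unfolding isotopy_def smooth_on_def by blast
  obtain W2 g2 where W2: "open W2" "UNIV \<times> {0..1} \<subseteq> W2" and g2: "\<And>k. Ck_on k g2 W2"
    and e2: "\<And>z. z \<in> UNIV \<times> {0..1} \<Longrightarrow> g2 z = (\<lambda>(x, t). \<psi> t x) z"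
    using \<psi> unfolding isotopy_def smooth_on_def by blast
  let ?h = "\<lambda>w. (g2 w, snd w)"
  let ?W = "W2 \<inter> ?h -` W1"
  have h: "Ck_on k ?h W2" for k
    by (rule Ck_on_Pair[OF W2(1) g2 Ck_on_bounded_linear[OF W2(1) bounded_linear_snd]])
  have W: "open ?W"
    by (rule continuous_open_preimage[OF Ck_on_continuous[OF h[of 0]] W2(1) W1(1)])
  have sub: "UNIV \<times> {0..1} \<subseteq> ?W"
  proof
    fix w :: "'a \<times> real" assume w: "w \<in> UNIV \<times> {0..1}"
    then have "(g2 w, snd w) \<in> UNIV \<times> {0..1}" by auto
    then have "?h w \<in> W1" by (rule subsetD[OF W1(2)])
    then show "w \<in> ?W" using subsetD[OF W2(2) w] by simp
  qed
  have sm: "Ck_on k (\<lambda>w. g1 (?h w)) ?W" for k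
    by (rule Ck_on_compose[OF W W1(1) _ Ck_on_subset[OF h] g1]) auto
  have eq: "g1 (?h w) = (\<lambda>(x, t). (\<phi> t \<circ> \<psi> t) x) w" if w: "w \<in> UNIV \<times> {0..1}" for w
  proof -
    obtain x t where xt: "w = (x, t)" "t \<in> {0..1}" using w by auto
    have "g2 (x, t) = \<psi> t x" "g1 (\<psi> t x, t) = \<phi> t (\<psi> t x)" using e1[of "(\<psi> t x, t)"] e2[of "(x, t)"] xt(2) by simp_all
    then show ?thesis unfolding xt(1) by simp
  qed
  have "smooth_on (\<lambda>(x, t). (\<phi> t \<circ> \<psi> t) x) (UNIV \<times> {0..1})"
    unfolding smooth_on_def
    by (rule exI[of _ ?W], rule exI[of _ "\<lambda>w. g1 (?h w)"], intro conjI allI ballI W sub sm eq)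
  moreover have "diffeomorphism (\<phi> t \<circ> \<psi> t)" if "t \<in> {0..1}" for t
    by (rule diffeomorphism_comp[OF \<phi>[unfolded isotopy_def, THEN conjunct2, rule_format, OF that]
      \<psi>[unfolded isotopy_def, THEN conjunct2, rule_format, OF that]])
  ultimately show ?thesis unfolding isotopy_def by (intro conjI ballI)
qed

lemma inj_preserves_support:
  assumes "inj f" "\<And>z. z \<notin> A \<Longrightarrow> f z = z" "z \<in> A"
  shows "f z \<in> A"
  using assms injD by metis

text \<open>
  Each flow maps the support of its own function to itself and fixes the other points, so that every
  trajectory of the composition is a trajectory of one of the two flows. It stays in an open set in
  which the other function vanishes.
\<close>

lemma ham_isotopy_disjoint_comp:
  assumes \<phi>: "ham_isotopy F \<phi>" and \<psi>: "ham_isotopy G \<psi>"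
    and AB: "closed A" "closed B" "A \<inter> B = {}"
    and F: "\<And>z t. z \<notin> A \<Longrightarrow> F (z, t) = 0" and G: "\<And>z t. z \<notin> B \<Longrightarrow> G (z, t) = 0"
    and \<phi>A: "\<And>z t. t \<in> {0..1} \<Longrightarrow> z \<notin> A \<Longrightarrow> \<phi> t z = z"
    and \<psi>B: "\<And>z t. t \<in> {0..1} \<Longrightarrow> z \<notin> B \<Longrightarrow> \<psi> t z = z"
  shows "ham_isotopy (\<lambda>w. F w + G w) (\<lambda>t. \<phi> t \<circ> \<psi> t)"
proof -
  note d\<phi> = \<phi>[unfolded ham_isotopy_def] and d\<psi> = \<psi>[unfolded ham_isotopy_def]
  have iso: "isotopy \<phi>" "isotopy \<psi>" by (rule d\<phi>[THEN conjunct1] d\<psi>[THEN conjunct1])+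
  have id: "\<phi> 0 = id" "\<psi> 0 = id" using d\<phi> d\<psi> by simp_all
  note ode = d\<phi>[THEN conjunct2, THEN conjunct2, rule_format] d\<psi>[THEN conjunct2, THEN conjunct2, rule_format]
  have inj: "inj (\<phi> t)" "inj (\<psi> t)" if "t \<in> {0..1}" for t
    using iso that unfolding isotopy_def diffeomorphism_def by (simp_all add: bij_is_inj)
  have pres: "\<phi> t z \<in> A" if "t \<in> {0..1}" "z \<in> A" for t z
    by (rule inj_preserves_support[OF inj(1)[OF that(1)] \<phi>A[OF that(1)] that(2)])
  have pres': "\<psi> t z \<in> B" if "t \<in> {0..1}" "z \<in> B" for t z
    by (rule inj_preserves_support[OF inj(2)[OF that(1)] \<psi>B[OF that(1)] that(2)])
  have fieldA: "ham_field (\<lambda>w. F w + G w) t z = ham_field F t z" if "z \<in> A" for t z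
    by (rule ham_field_cong_open[of "- B"]) (use AB that G in auto)
  have fieldB: "ham_field (\<lambda>w. F w + G w) t z = ham_field G t z" if "z \<notin> A" for t z
    by (rule ham_field_cong_open[of "- A"]) (use AB that F in auto)
  have "((\<lambda>s. (\<phi> s \<circ> \<psi> s) z) has_vector_derivative ham_field (\<lambda>w. F w + G w) t ((\<phi> t \<circ> \<psi> t) z)) (at t within {0..1})"
    if t: "t \<in> {0..1}" for z t
  proof (cases "z \<in> A")
    case True
    have \<psi>z: "\<psi> s z = z" if "s \<in> {0..1}" for s
      by (rule \<psi>B[OF that]) (use True AB(3) in blast)
    have "((\<lambda>s. (\<phi> s \<circ> \<psi> s) z) has_vector_derivative ham_field F t (\<phi> t z)) (at t within {0..1})"
      by (rule has_vector_derivative_transform[OF t _ ode(1)[OF t]]) (simp add: \<psi>z)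
    then show ?thesis by (simp only: comp_apply \<psi>z[OF t] fieldA[OF pres[OF t True]])
  next
    case False
    have \<psi>z: "\<psi> s z \<notin> A" if s: "s \<in> {0..1}" for s
    proof (cases "z \<in> B")
      case True
      then show ?thesis using pres'[OF s True] AB(3) by blast
    qed (simp add: \<psi>B[OF s] False)
    have "((\<lambda>s. (\<phi> s \<circ> \<psi> s) z) has_vector_derivative ham_field G t (\<psi> t z)) (at t within {0..1})"
      by (rule has_vector_derivative_transform[OF t _ ode(2)[OF t]]) (simp add: \<phi>A[OF _ \<psi>z])
    then show ?thesis by (simp only: comp_apply \<phi>A[OF t \<psi>z[OF t]] fieldB[OF \<psi>z[OF t]])
  qed
  then show ?thesis
    unfolding ham_isotopy_def using isotopy_comp[OF iso] id by simp
qed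

lemma hamiltonian_add:
  fixes F G :: "'n::finite phase \<times> real \<Rightarrow> real"
  assumes F: "hamiltonian F" and G: "hamiltonian G"
  shows "hamiltonian (\<lambda>w. F w + G w)"
proof -
  obtain W1 g1 where W1: "open W1" "UNIV \<times> {0..1} \<subseteq> W1" and g1: "\<And>k. Ck_on k g1 W1"
    and e1: "\<And>z. z \<in> UNIV \<times> {0..1} \<Longrightarrow> g1 z = F z"
    using F unfolding hamiltonian_def smooth_on_def by blast
  obtain W2 g2 where W2: "open W2" "UNIV \<times> {0..1} \<subseteq> W2" and g2: "\<And>k. Ck_on k g2 W2"
    and e2: "\<And>z. z \<in> UNIV \<times> {0..1} \<Longrightarrow> g2 z = G z"
    using G unfolding hamiltonian_def smooth_on_def by blast
  have W: "open (W1 \<inter> W2)" "UNIV \<times> {0..1} \<subseteq> W1 \<inter> W2" using W1 W2 by auto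
  have sm: "Ck_on k (\<lambda>w. g1 w + g2 w) (W1 \<inter> W2)" for k
    by (rule Ck_on_add[OF W(1) Ck_on_subset[OF g1] Ck_on_subset[OF g2]]) auto
  have "smooth_on (\<lambda>w. F w + G w) (UNIV \<times> {0..1})"
    unfolding smooth_on_def
    by (rule exI[of _ "W1 \<inter> W2"], rule exI[of _ "\<lambda>w. g1 w + g2 w"], intro conjI allI ballI W sm)
      (simp add: e1 e2)
  moreover have "bounded {w \<in> UNIV \<times> {0..1}. F w + G w \<noteq> 0}"
  proof (rule bounded_subset)
    show "bounded ({w \<in> UNIV \<times> {0..1}. F w \<noteq> 0} \<union> {w \<in> UNIV \<times> {0..1}. G w \<noteq> 0})"
      using F G unfolding hamiltonian_def by simp
  qed auto
  ultimately show ?thesis unfolding hamiltonian_def by simp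
qed

section \<open>Twists and half turns\<close>

definition bump_profile :: "real \<Rightarrow> real \<Rightarrow> real" where
  "bump_profile r s = flat_exp 0 (r\<^sup>2 - s)"

lemma bump_profile_smooth: "Ck_on k (bump_profile r) UNIV"
proof -
  have "Ck_on k (\<lambda>s. r\<^sup>2 + - s) UNIV"
    by (rule Ck_on_add[OF open_UNIV Ck_on_const[OF open_UNIV] Ck_on_bounded_linear[OF open_UNIV bounded_linear_minus[OF bounded_linear_ident]]])
  from smooth_compose[OF this Ck_on_flat_exp[of k 0]] show ?thesis
    unfolding bump_profile_def[abs_def] by simp
qed

lemma bump_profile_bounds: "0 \<le> bump_profile r s" "bump_profile r s \<le> 1" "r\<^sup>2 \<le> s \<Longrightarrow> bump_profile r s = 0"
  "s < r\<^sup>2 \<Longrightarrow> 0 < bump_profile r s"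
  by (auto simp: bump_profile_def flat_exp_def)

lemma rotation_speed_bump:
  assumes "r\<^sup>2 \<le> s" shows "rotation_speed (bump_profile r) s = 0"
proof -
  have "((\<lambda>s. flat_exp 0 (r\<^sup>2 - s)) has_real_derivative (flat_exp (0 + 2) (r\<^sup>2 - s) - real 0 * flat_exp (0 + 1) (r\<^sup>2 - s)) * (0 - 1)) (at s)"
    by (rule DERIV_chain2[OF flat_exp_has_derivative]) (auto intro!: derivative_eq_intros)
  then have "(bump_profile r has_real_derivative 0) (at s)"
    using assms unfolding bump_profile_def[abs_def] by (simp add: flat_exp_def)
  then have "(bump_profile r has_derivative (*) 0) (at s)" by (simp only: has_field_derivative_def)
  then show ?thesis
    unfolding rotation_speed_def by (simp add: frechet_derivative_at[symmetric])
qed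

lemma twist_outside:
  assumes "r \<ge> 0" "z \<notin> cball p r" shows "radial_flow (bump_profile r) p t z = z"
proof -
  have "r \<le> norm (z - p)" using assms(2) by (simp add: dist_norm norm_minus_commute)
  then have "r\<^sup>2 \<le> (z - p) \<bullet> (z - p)" using assms(1) by (simp add: dot_square_norm power_mono)
  then show ?thesis by (simp add: radial_flow_eq rotation_speed_bump)
qed

text \<open>
  Without the cutoff this generates a rotation of the whole space with constant angular speed
  \<open>pi\<close>.
\<close>

definition half_turn_profile :: "real \<Rightarrow> real \<Rightarrow> real" where
  "half_turn_profile a s = (pi / 2 * s) * smooth_step a (a + 1) s"

lemma half_turn_profile_smooth: "Ck_on k (half_turn_profile a) UNIV"
  unfolding half_turn_profile_def[abs_def]
  by (rule Ck_on_bilinear[OF bounded_bilinear_mult open_UNIV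
      Ck_on_bounded_linear[OF open_UNIV bounded_linear_mult_right] Ck_on_smooth_step]) simp

lemma rotation_speed_half_turn:
  assumes "s < a" shows "rotation_speed (half_turn_profile a) s = pi"
proof -
  have "frechet_derivative (half_turn_profile a) (at s) = frechet_derivative (\<lambda>s. pi / 2 * s) (at s)"
    by (rule frechet_derivative_cong_open[of "{..<a}"])
      (use assms in \<open>auto simp: half_turn_profile_def smooth_step_values\<close>)
  moreover have "((\<lambda>s. pi / 2 * s) has_derivative (\<lambda>v. pi / 2 * v)) (at s)"
    by (rule bounded_linear_imp_has_derivative[OF bounded_linear_mult_right])
  then have "frechet_derivative (\<lambda>s. pi / 2 * s) (at s) = (\<lambda>v. pi / 2 * v)"
    by (rule frechet_derivative_at[symmetric])
  ultimately show ?thesis by (simp add: rotation_speed_def)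
qed

lemma half_turn_near:
  assumes "(z - c) \<bullet> (z - c) < a"
  shows "radial_flow (half_turn_profile a) c 1 z = c + c - z"
  by (simp add: radial_flow_eq rotation_speed_half_turn[OF assms])

lemma half_turn_Ham:
  assumes "a > 0" shows "radial_flow (half_turn_profile a) c 1 \<in> Ham"
proof -
  have "hamiltonian (radial_ham (half_turn_profile a) c)"
  proof (rule radial_hamiltonian(1)[OF half_turn_profile_smooth])
    fix s assume "(sqrt (a + 1))\<^sup>2 < s"
    then show "half_turn_profile a s = 0"
      using assms by (simp add: half_turn_profile_def smooth_step_values)
  qed (use assms in simp)
  then show ?thesis
    unfolding Ham_def generates_def using radial_isotopy[OF half_turn_profile_smooth] by blast
qed

text \<open>
  A half turn about the midpoint of \<open>p\<close> and \<open>q\<close> exchanges the balls around \<open>p\<close> and \<open>q\<close>, acts on them as the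
  point reflection \<open>z \<mapsto> p + q - z\<close>, and thereby carries the twist about \<open>p\<close> to the twist about \<open>q\<close>.
\<close>

lemma twist_conjugate:
  fixes p q :: "'n::finite phase"
  assumes r: "r > 0"
  obtains h where "h \<in> Ham"
    "h \<circ> radial_flow (bump_profile r) p 1 \<circ> inv h = radial_flow (bump_profile r) q 1"
proof -
  define c where "c = (1/2) *\<^sub>R (p + q)"
  \<comment> \<open>the half turn has to be rigid on a ball about \<open>c\<close> that contains both small balls\<close>
  define a where "a = (dist c p + r + 1)\<^sup>2"
  define h where "h = radial_flow (half_turn_profile a) c 1"
  let ?f = "\<lambda>p. radial_flow (bump_profile r) p 1"
  have cc: "c + c = p + q" by (simp add: c_def flip: scaleR_add_left)
  have "0 < dist c p + r + 1" using r zero_le_dist[of c p] by linarith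
  then have a: "a > 0" by (simp add: a_def)
  have dcq: "dist c q = dist c p"
  proof -
    have "c - q = - (c - p)" using cc by (simp add: algebra_simps)
    then show ?thesis by (metis dist_norm norm_minus_cancel)
  qed
  have near: "h z = p + q - z" if "z \<in> cball p r \<or> z \<in> cball q r" for z
  proof -
    have "dist c z \<le> dist c p + r"
      using that dist_triangle[of c z p] dist_triangle[of c z q] dcq by (auto simp: mem_cball)
    then have "norm (z - c) < dist c p + r + 1" by (simp add: dist_norm norm_minus_commute)
    then have "(norm (z - c))\<^sup>2 < a" unfolding a_def by (rule power_strict_mono) auto
    then have "(z - c) \<bullet> (z - c) < a" by (simp add: dot_square_norm)
    then show ?thesis unfolding h_def using half_turn_near cc by metis
  qed
  have dh: "diffeomorphism h"
    using radial_isotopy[OF half_turn_profile_smooth, of a c] unfolding ham_isotopy_def isotopy_def h_def by simp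
  then have bij: "bij h" by (simp add: diffeomorphism_def)
  have fpq: "?f q (p + q - z) = p + q - ?f p z" for z
  proof -
    have 1: "p + q - z - q = - (z - p)" by simp
    show ?thesis unfolding radial_flow_eq 1 by (simp add: algebra_simps)
  qed
  have commute: "h (?f p z) = ?f q (h z)" for z
  proof (cases "z \<in> cball p r")
    case True
    then have "?f p z \<in> cball p r" by (simp add: radial_flow_dist)
    then show ?thesis using near[of z] near[of "?f p z"] True fpq by simp
  next
    case False
    have "h z \<notin> cball q r"
    proof
      assume hz: "h z \<in> cball q r"
      define y where "y = p + q - h z"
      have "p - y = h z - q" by (simp add: y_def)
      then have y: "y \<in> cball p r" using hz by (simp add: dist_norm norm_minus_commute)
      then have "h y = h z" using near[of y] by (simp add: y_def)
      then have "y = z" by (rule injD[OF bij_is_inj[OF bij]])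
      then show False using y False by simp
    qed
    then show ?thesis
      unfolding twist_outside[OF less_imp_le[OF r] False] by (rule twist_outside[OF less_imp_le[OF r], symmetric])
  qed
  have "h \<circ> ?f p \<circ> inv h = ?f q"
    by (rule ext) (simp add: commute surj_f_inv_f[OF bij_is_surj[OF bij]])
  moreover have "h \<in> Ham" unfolding h_def by (rule half_turn_Ham[OF a])
  ultimately show thesis by (rule that[rotated])
qed

section \<open>Many disjoint twists\<close>

lemma twist_isotopy: "ham_isotopy (radial_ham (bump_profile r) p) (radial_flow (bump_profile r) p)"
  by (rule radial_isotopy[OF bump_profile_smooth])

lemma twist_hamiltonian:
  assumes "r > 0"
  shows "hamiltonian (radial_ham (bump_profile r) p)"
    and "z \<notin> cball p r \<Longrightarrow> radial_ham (bump_profile r) p (z, t) = 0"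
proof -
  have zero: "bump_profile r s = 0" if "r\<^sup>2 < s" for s
    using bump_profile_bounds(3)[of r s] that by simp
  show "hamiltonian (radial_ham (bump_profile r) p)"
    by (rule radial_hamiltonian(1)[OF bump_profile_smooth zero less_imp_le[OF assms]])
  show "radial_ham (bump_profile r) p (z, t) = 0" if "z \<notin> cball p r"
    by (rule radial_hamiltonian(2)[OF bump_profile_smooth zero less_imp_le[OF assms] that])
qed

lemma twist_ham_supp:
  assumes "r > 0" shows "ham_supp (radial_ham (bump_profile r) p) \<subseteq> cball p r"
proof -
  have "closure {x. radial_ham (bump_profile r) p (x, t) \<noteq> 0} \<subseteq> cball p r" for t
    by (rule closure_minimal[OF _ closed_cball]) (use twist_hamiltonian(2)[OF assms] in blast)
  then show ?thesis unfolding ham_supp_def by blast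
qed

lemma calabi_integral_twist_pos:
  fixes p :: "'n::finite phase"
  assumes r: "r > 0" shows "0 < calabi_integral (radial_ham (bump_profile r) p)"
proof -
  let ?f = "\<lambda>x. bump_profile r ((x - p) \<bullet> (x - p))"
  obtain b where b: "cball p r \<subseteq> cbox (-b) b"
    using bounded_subset_cbox_symmetric[OF bounded_cball] by blast
  have p: "p \<in> ball p r" using r by simp
  have "ball p r \<subseteq> interior (cbox (-b) b)"
    by (rule interior_maximal[OF order_trans[OF ball_subset_cball b] open_ball])
  then have pb: "p \<in> box (-b) b" using p by (simp only: interior_cbox) blast
  have cont: "continuous_on UNIV ?f"
  proof -
    have "continuous_on UNIV (bump_profile r)" by (rule Ck_on_continuous[OF bump_profile_smooth[of 0]])
    then show ?thesis by (rule continuous_on_compose2) (auto intro!: continuous_intros)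
  qed
  have cb: "continuous_on (cbox (-b) b) ?f" by (rule continuous_on_subset[OF cont subset_UNIV])
  have zero: "?f x = 0" if "x \<notin> cbox (-b) b" for x
  proof -
    have "x \<notin> cball p r" using b that by blast
    then show ?thesis using twist_hamiltonian(2)[OF r, of x p 0] by (simp add: radial_ham_def)
  qed
  have I: "integral UNIV ?f = integral (cbox (-b) b) ?f"
    by (rule integral_UNIV_eq_cbox[OF zero])
  have "0 \<le> integral (cbox (-b) b) ?f"
    by (rule integral_nonneg[OF integrable_continuous[OF cb]]) (rule bump_profile_bounds(1))
  moreover have "integral (cbox (-b) b) ?f \<noteq> 0"
  proof
    assume "integral (cbox (-b) b) ?f = 0"
    then have "(?f has_integral 0) (cbox (-b) b)"
      using integrable_integral[OF integrable_continuous[OF cb]] by simp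
    then have "?f p = 0"
      by (rule has_integral_0_cbox_imp_0[OF cb bump_profile_bounds(1)])
        (use pb box_subset_cbox in blast)+
    then show False using bump_profile_bounds(4)[of 0 r] r by simp
  qed
  ultimately have "0 < integral UNIV ?f" unfolding I by linarith
  then show ?thesis by (simp add: calabi_integral_def radial_ham_def)
qed

text \<open>
  Induction on \<open>m\<close>. The generating function and the flow built so far live in a ball about \<open>p\<close>; the next
  twist is placed outside of that ball, which enlarges the ball but keeps the bound on the function
  because the supports are disjoint.
\<close>

lemma disjoint_twists:
  fixes p :: "'n::finite phase" and m :: nat
  assumes r: "r > 0"
  obtains G f L where "hamiltonian G" "generates G f" "\<forall>w. 0 \<le> G w \<and> G w \<le> 1"
    "length L = m"
    "\<forall>(F, g, h)\<in>set L. F = radial_ham (bump_profile r) p \<and> generates F g \<and> h \<in> Ham"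
    "f = foldr (\<circ>) (map (\<lambda>(F, g, h). h \<circ> g \<circ> inv h) L) id"
proof -
  let ?F = "\<lambda>p. radial_ham (bump_profile r) p" and ?\<tau> = "\<lambda>p. radial_flow (bump_profile r) p"
  have gen: "generates (?F p) (?\<tau> p 1)"
    unfolding generates_def using twist_isotopy by blast
  have "\<exists>G \<Phi> R L. hamiltonian G \<and> ham_isotopy G \<Phi> \<and> (\<forall>w. 0 \<le> G w \<and> G w \<le> 1) \<and> length L = m \<and>
    (\<forall>z t. z \<notin> cball p R \<longrightarrow> G (z, t) = 0) \<and> (\<forall>t\<in>{0..1}. \<forall>z. z \<notin> cball p R \<longrightarrow> \<Phi> t z = z) \<and>
    (\<forall>(F, g, h)\<in>set L. F = ?F p \<and> generates F g \<and> h \<in> Ham) \<and>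
    \<Phi> 1 = foldr (\<circ>) (map (\<lambda>(F, g, h). h \<circ> g \<circ> inv h) L) id"
  proof (induction m)
    case 0
    have zero: "(\<lambda>w. 0) = (radial_ham (\<lambda>s. 0) p :: 'n phase \<times> real \<Rightarrow> real)"
      by (auto simp: radial_ham_def fun_eq_iff)
    have speed: "rotation_speed (\<lambda>s. 0) = (\<lambda>s. 0)" by (simp add: rotation_speed_def fun_eq_iff)
    have flow: "(\<lambda>t. id) = (radial_flow (\<lambda>s. 0) p :: real \<Rightarrow> 'n phase \<Rightarrow> 'n phase)"
      by (simp add: fun_eq_iff radial_flow_eq speed)
    have "hamiltonian (\<lambda>w :: 'n phase \<times> real. 0)"
      unfolding zero by (rule radial_hamiltonian(1)[OF Ck_on_const[OF open_UNIV], of 0]) simp_all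
    moreover have "ham_isotopy (\<lambda>w :: 'n phase \<times> real. 0) (\<lambda>t. id)"
      unfolding zero flow by (rule radial_isotopy[OF Ck_on_const[OF open_UNIV]])
    ultimately show ?case
      by (intro exI[of _ "\<lambda>w. 0"] exI[of _ "\<lambda>t. id"] exI[of _ "0::real"] exI[of _ "[]"] conjI) (assumption | simp)+
  next
    case (Suc m)
    then obtain G \<Phi> R L where G: "hamiltonian G" "ham_isotopy G \<Phi>" "\<forall>w. 0 \<le> G w \<and> G w \<le> 1" "length L = m"
      and G0: "\<forall>z t. z \<notin> cball p R \<longrightarrow> G (z, t) = 0"
      and \<Phi>0: "\<forall>t\<in>{0..1}. \<forall>z. z \<notin> cball p R \<longrightarrow> \<Phi> t z = z"
      and L: "\<forall>(F, g, h)\<in>set L. F = ?F p \<and> generates F g \<and> h \<in> Ham"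
      and \<Phi>L: "\<Phi> 1 = foldr (\<circ>) (map (\<lambda>(F, g, h). h \<circ> g \<circ> inv h) L) id"
      by (elim exE conjE) (rule that)
    obtain v :: "'n phase" where v: "norm v = \<bar>R\<bar> + r + 1"
      by (rule vector_choose_size[of "\<bar>R\<bar> + r + 1"]) (use r in simp_all)
    define q where "q = p + v"
    have pq: "dist p q = \<bar>R\<bar> + r + 1" using v by (simp add: q_def dist_norm)
    define R' where "R' = \<bar>R\<bar> + r + 1 + r"
    have disj: "cball q r \<inter> cball p R = {}"
    proof (rule ccontr)
      assume "cball q r \<inter> cball p R \<noteq> {}"
      then obtain z where "dist q z \<le> r" "dist p z \<le> R" by auto
      then show False using dist_triangle[of p q z] pq by (simp add: dist_commute)
    qed
    have sub: "z \<notin> cball q r" "z \<notin> cball p R" if "z \<notin> cball p R'" for z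
      using that dist_triangle[of p z q] pq r unfolding R'_def mem_cball by auto
    obtain h where h: "h \<in> Ham" "h \<circ> ?\<tau> p 1 \<circ> inv h = ?\<tau> q 1" by (rule twist_conjugate[OF r])
    let ?G = "\<lambda>w. ?F q w + G w" and ?\<Phi> = "\<lambda>t. ?\<tau> q t \<circ> \<Phi> t" and ?L = "(?F p, ?\<tau> p 1, h) # L"
    have "hamiltonian ?G" by (rule hamiltonian_add[OF twist_hamiltonian(1)[OF r] G(1)])
    moreover have "ham_isotopy ?G ?\<Phi>"
      by (rule ham_isotopy_disjoint_comp[OF twist_isotopy G(2) closed_cball closed_cball disj
          twist_hamiltonian(2)[OF r] G0[rule_format] twist_outside[OF less_imp_le[OF r]] \<Phi>0[rule_format]])
    moreover have "0 \<le> ?G w \<and> ?G w \<le> 1" for w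
    proof -
      obtain z t where w: "w = (z, t)" by (cases w)
      have F: "0 \<le> ?F q w" "?F q w \<le> 1"
        unfolding w radial_ham_def by (simp_all add: bump_profile_bounds)
      show ?thesis
      proof (cases "z \<in> cball q r")
        case True
        then have "z \<notin> cball p R" using disj by blast
        then have "G w = 0" unfolding w by (rule G0[rule_format])
        then show ?thesis using F by simp
      next
        case False
        then have "?F q w = 0" unfolding w by (rule twist_hamiltonian(2)[OF r])
        then show ?thesis using spec[OF G(3), of w] by simp
      qed
    qed
    moreover have "?G (z, t) = 0" if "z \<notin> cball p R'" for z t
      using twist_hamiltonian(2)[OF r sub(1)[OF that], of t] G0[rule_format, OF sub(2)[OF that], of t] by simp
    moreover have "?\<Phi> t z = z" if "t \<in> {0..1}" "z \<notin> cball p R'" for z t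
      using twist_outside[OF less_imp_le[OF r] sub(1)[OF that(2)], of t] \<Phi>0[rule_format, OF that(1) sub(2)[OF that(2)]]
      by simp
    moreover have "\<forall>(F, g, h)\<in>set ?L. F = ?F p \<and> generates F g \<and> h \<in> Ham"
      using L gen h(1) by simp
    moreover have "?\<Phi> 1 = foldr (\<circ>) (map (\<lambda>(F, g, h). h \<circ> g \<circ> inv h) ?L) id"
      unfolding list.map foldr.simps prod.case comp_apply h(2) \<Phi>L ..
    moreover have "length ?L = Suc m" using G(4) by simp
    ultimately show ?case by blast
  qed
  then obtain G \<Phi> L where G: "hamiltonian G" "ham_isotopy G \<Phi>" "\<forall>w. 0 \<le> G w \<and> G w \<le> 1" "length L = m"
    "\<forall>(F, g, h)\<in>set L. F = ?F p \<and> generates F g \<and> h \<in> Ham"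
    "\<Phi> 1 = foldr (\<circ>) (map (\<lambda>(F, g, h). h \<circ> g \<circ> inv h) L) id"
    by (elim exE conjE) (rule that)
  have "generates G (\<Phi> 1)" unfolding generates_def using G(2) by blast
  then show thesis by (rule that[OF G(1) _ G(3-6)])
qed

section \<open>Comparison of the norms\<close>

lemma hofer_length_le_one:
  fixes F :: "'n::finite phase \<times> real \<Rightarrow> real"
  assumes F: "hamiltonian F" and bound: "\<forall>w. 0 \<le> F w \<and> F w \<le> 1"
  shows "hofer_length F \<le> 1"
proof -
  have "hofer_length F \<le> integral {0..1} (\<lambda>t::real. 1)"
    unfolding hofer_length_def
  proof (rule integral_le[OF integrable_continuous_real[OF hamiltonian_oscillation_continuous[OF F]]])
    fix t :: real
    have "(SUP x. F (x, t)) \<le> 1" by (rule cSUP_least) (use bound in auto)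
    moreover have "0 \<le> (INF x. F (x, t))" by (rule cINF_greatest) (use bound in auto)
    ultimately show "(SUP x. F (x, t)) - (INF x. F (x, t)) \<le> 1" by linarith
  qed (rule integrable_const_ivl)
  then show ?thesis by simp
qed

lemma hofer_norm_le_hofer_length:
  assumes "hamiltonian F" "generates F f" shows "hofer_norm f \<le> hofer_length F"
  unfolding hofer_norm_def
proof (rule cInf_lower)
  show "hofer_length F \<in> {hofer_length F |F. hamiltonian F \<and> generates F f}" using assms by blast
  show "bdd_below {hofer_length F |F. hamiltonian F \<and> generates F f}"
    by (rule bdd_belowI[of _ 0]) (use hofer_length_nonneg in blast)
qed

lemma lmeasurable_finite_symplectic_volume:
  fixes U :: "'n::finite phase set"
  assumes "open U" "symplectic_volume U < \<infinity>" shows "U \<in> lmeasurable"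
proof -
  have U: "U \<in> sets lborel" using assms(1) by simp
  have "symplectic_volume U = fact CARD('n) * emeasure lborel U"
    unfolding symplectic_volume_def using U by (simp add: nn_integral_cmult_indicator)
  then have "emeasure lborel U < \<infinity>"
    using assms(2) by (auto simp: ennreal_mult_less_top)
  then show ?thesis using U by (intro fmeasurableI) auto
qed

theorem corollary1p7:
  fixes U :: "((real ^ 'n) \<times> (real ^ 'n)) set"
  assumes "open U" and "U \<noteq> {}" and "symplectic_volume U < \<infinity>"
  shows "\<not> equivalent_norms Ham (fragmented_hofer_norm U) hofer_norm"
proof
  assume "equivalent_norms Ham (fragmented_hofer_norm U) hofer_norm"
  then obtain a b where a: "a > 0"
    and ab: "\<forall>f\<in>Ham. 1 / a * fragmented_hofer_norm U f - b \<le> hofer_norm f \<and> hofer_norm f \<le> a * fragmented_hofer_norm U f + b"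
    unfolding equivalent_norms_def by blast
  obtain p where "p \<in> U" using assms(2) by blast
  then obtain r where r: "r > 0" "cball p r \<subseteq> U" using assms(1) open_contains_cball by blast
  let ?F = "radial_ham (bump_profile r) p"
  define c where "c = calabi_integral ?F"
  define \<mu> where "\<mu> = measure lebesgue U"
  have c: "c > 0" unfolding c_def by (rule calabi_integral_twist_pos[OF r(1)])
  have U: "U \<in> lmeasurable" by (rule lmeasurable_finite_symplectic_volume[OF assms(1,3)])
  have supp: "ham_supp ?F \<subseteq> U" by (rule order_trans[OF twist_ham_supp[OF r(1)] r(2)])
  have F: "hamiltonian ?F" by (rule twist_hamiltonian(1)[OF r(1)])
  \<comment> \<open>the single twist about \<open>p\<close> already shows that \<open>U\<close> has positive measure\<close>
  have "c \<le> \<mu> * hofer_length ?F"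
    using calabi_integral_bound[OF F U supp] c unfolding c_def \<mu>_def by linarith
  then have \<mu>: "\<mu> > 0" using c by (cases "\<mu> = 0") (auto simp: \<mu>_def less_le)
  have bound: "real m * c \<le> \<mu> * (a * (1 + b))" for m
  proof -
    obtain G f L where G: "hamiltonian G" "generates G f" "\<forall>w. 0 \<le> G w \<and> G w \<le> 1" and m: "length L = m"
      and L: "\<forall>(F, g, h)\<in>set L. F = ?F \<and> generates F g \<and> h \<in> Ham"
      and f: "f = foldr (\<circ>) (map (\<lambda>(F, g, h). h \<circ> g \<circ> inv h) L) id"
      by (rule disjoint_twists[OF r(1)])
    have "f \<in> Ham" unfolding Ham_def using G by blast
    have "hofer_norm f \<le> 1"
      using hofer_norm_le_hofer_length[OF G(1,2)] hofer_length_le_one[OF G(1,3)] by linarith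
    have L': "\<forall>(F, g, h)\<in>set L. hamiltonian F \<and> generates F g \<and> ham_supp F \<subseteq> U \<and> h \<in> Ham"
      using L F supp unfolding case_prod_beta by metis
    then have L1: "\<forall>(F, g, h)\<in>set L. hamiltonian F \<and> generates F g \<and> h \<in> Ham"
      unfolding case_prod_beta by blast
    obtain A where A: "calabi_potential f A"
      "integral UNIV A = - (real CARD('n) + 1) * (\<Sum>(F, g, h)\<leftarrow>L. calabi_integral F)"
      unfolding f by (rule fragmentation_calabi[OF L1])
    have sum: "(\<Sum>(F, g, h)\<leftarrow>L. calabi_integral F) = real m * c"
    proof -
      have "map (\<lambda>(F, g, h). calabi_integral F) L = map (\<lambda>x. c) L"
        by (rule map_cong) (use L in \<open>auto simp: c_def\<close>)
      then have "(\<Sum>(F, g, h)\<leftarrow>L. calabi_integral F) = (\<Sum>x\<leftarrow>L. c)" by (rule arg_cong)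
      also have "\<dots> = real m * c" unfolding m[symmetric] by (rule sum_list_triv)
      finally show ?thesis .
    qed
    have "real m * c / \<mu> \<le> fragmented_hofer_norm U f"
      unfolding fragmented_hofer_norm_def
    proof (rule cInf_greatest)
      show "{(\<Sum>(F, g, h)\<leftarrow>L. hofer_length F) | L.
         (\<forall>(F, g, h)\<in>set L. hamiltonian F \<and> generates F g \<and> ham_supp F \<subseteq> U \<and> h \<in> Ham) \<and>
         f = foldr (\<circ>) (map (\<lambda>(F, g, h). h \<circ> g \<circ> inv h) L) id} \<noteq> {}"
        using L' f by blast
    next
      fix x assume "x \<in> {(\<Sum>(F, g, h)\<leftarrow>L. hofer_length F) | L.
         (\<forall>(F, g, h)\<in>set L. hamiltonian F \<and> generates F g \<and> ham_supp F \<subseteq> U \<and> h \<in> Ham) \<and>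
         f = foldr (\<circ>) (map (\<lambda>(F, g, h). h \<circ> g \<circ> inv h) L) id}"
      then obtain K where x: "x = (\<Sum>(F, g, h)\<leftarrow>K. hofer_length F)"
        and K: "\<forall>(F, g, h)\<in>set K. hamiltonian F \<and> generates F g \<and> ham_supp F \<subseteq> U \<and> h \<in> Ham"
        and fK: "f = foldr (\<circ>) (map (\<lambda>(F, g, h). h \<circ> g \<circ> inv h) K) id"
        by blast
      have K1: "\<forall>(F, g, h)\<in>set K. hamiltonian F \<and> generates F g \<and> h \<in> Ham"
        and K2: "\<forall>(F, g, h)\<in>set K. hamiltonian F \<and> ham_supp F \<subseteq> U"
        using K unfolding case_prod_beta by blast+
      obtain B where B: "calabi_potential f B"
        "integral UNIV B = - (real CARD('n) + 1) * (\<Sum>(F, g, h)\<leftarrow>K. calabi_integral F)"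
        unfolding fK by (rule fragmentation_calabi[OF K1])
      \<comment> \<open>the Calabi invariant of \<open>f\<close> computed from \<open>K\<close> agrees with the one computed from \<open>L\<close>\<close>
      have "A = B" by (rule calabi_potential_unique[OF A(1) B(1)])
      then have "(\<Sum>(F, g, h)\<leftarrow>K. calabi_integral F) = real m * c"
        using A(2) B(2) unfolding sum by (simp add: add_nonneg_eq_0_iff)
      moreover have "\<bar>\<Sum>(F, g, h)\<leftarrow>K. calabi_integral F\<bar> \<le> \<mu> * x"
        unfolding x \<mu>_def by (rule sum_calabi_integral_bound[OF U K2])
      ultimately show "real m * c / \<mu> \<le> x" using \<mu> by (simp add: pos_divide_le_eq mult.commute)
    qed
    then have 1: "real m * c \<le> \<mu> * fragmented_hofer_norm U f"
      using \<mu> by (simp add: pos_divide_le_eq mult.commute)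
    have "1 / a * fragmented_hofer_norm U f - b \<le> 1"
      using ab \<open>f \<in> Ham\<close> \<open>hofer_norm f \<le> 1\<close> by fastforce
    then have "fragmented_hofer_norm U f \<le> a * (1 + b)"
      using a by (simp add: field_simps)
    then have "\<mu> * fragmented_hofer_norm U f \<le> \<mu> * (a * (1 + b))"
      using \<mu> by (intro mult_left_mono) simp_all
    with 1 show ?thesis by (rule order_trans)
  qed
  obtain m :: nat where "\<mu> * (a * (1 + b)) < real m * c"
    using reals_Archimedean3[OF c] by blast
  then show False using bound[of m] by linarith
qed

end
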